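(* Let $n\ge3$ and let $\lambda=(\lambda_1<\dots<\lambda_n)$ be a simple real spectrum. The space $Q_{n,\lambda}^0=X_{n,\lambda}^0/T$ can be identified (homeomorphically) with the torus $N_{\mathbb{R}}/N'$ with its wonderful cell decomposition $\mathcal{PT}^{n-1}$ in such a way that for every $k=1,\dots,n$ the subspace $Q_k=Y_k/T$ is identified with the maximal cell $\mathcal{PT}_k$.
   Context: A periodic tridiagonal matrix is a Hermitian $n\times n$ matrix $L=L(\underline a,\underline b)$, $a_i\in\mathbb{R}$, $b_i\in\mathbb{C}$, with diagonal entries $L_{ii}=a_i$, with $L_{i,i+1}=b_i$, $L_{i+1,i}=\overline{b_i}$ for $1\le i\le n-1$, $L_{n,1}=b_n$, $L_{1,n}=\overline{b_n}$, and all other entries $0$. $X_{n,\lambda}$ is the space of all such matrices with spectrum $\lambda$. The torus $T^n$ of diagonal unitary matrices acts on $X_{n,\lambda}$ by conjugation; the diagonal circle $\Delta$ acts trivially, and $T=T^n/\Delta$ acts effectively. $Y_k\subset X_{n,\lambda}$ is the subset of matrices with $b_k=0$, and $X_{n,\lambda}^0=\bigcup_{k=1}^nY_k=\{L\in X_{n,\lambda}\mid \prod_{i=1}^n b_i=0\}$. Wonderful cell decomposition. Let $\epsilon_1,\dots,\epsilon_n$ be the standard orthonormal basis of $\mathbb{R}^n$, $N=\{\sum a_i\epsilon_i\mid a_i\in\mathbb{Z},\ \sum a_i=0,\ a_i\equiv a_j \bmod n\ \forall i,j\}$, a lattice of rank $n-1$, and $N_{\mathbb{R}}$ its real span. Put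 $\alpha_i=(n-1)\epsilon_i-\sum_{j\ne i}\epsilon_j\in N$; then $\sum\alpha_i=0$ and any $n-1$ of the $\alpha_i$ generate $N$. For $\alpha\in N$ let $P_\alpha=\{x\in N_{\mathbb{R}}\mid \operatorname{dist}(x,\alpha)\le\operatorname{dist}(x,\beta)\ \forall\beta\in N,\ \beta\ne\alpha\}$ be the Voronoi cell; $P_\alpha=P_0+\alpha$, and $P_0$ is an $(n-1)$-dimensional permutohedron. Let $N'\subset N$ be the sublattice generated by $\alpha_k-\alpha_{k+1}$, $k=1,\dots,n-1$; $N/N'$ is cyclic of order $n$, generated by the class $[\alpha_1]=\dots=[\alpha_n]$. The wonderful cell decomposition $\mathcal{PT}^{n-1}$ is the cell decomposition of the torus $N_{\mathbb{R}}/N'\cong\mathbb{T}^{n-1}$ whose cells are the images of the faces of the Voronoi cells $P_\alpha$, $\alpha\in N$. It has $n$ maximal cells; $P_{[\alpha]}$ denotes the image of $P_\alpha$, and $\mathcal{PT}_k=P_{k[\alpha_1]}$ for $k=1,\dots,n$. *)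

theory Defs
  imports "HOL-Analysis.Analysis" "HOL-Computational_Algebra.Group_Closure"
begin

text \<open>
  The dimension is the cardinality of the index type \<open>'n\<close>.  The cyclic arrangement of the
  indices is given by an enumeration \<open>ix\<close>, assumed in the theorem to be a bijection from
  \<open>{1..CARD('n)}\<close> onto \<open>'n\<close>; row \<open>i\<close> of a matrix is row \<open>ix i\<close>, and
  \<open>\<epsilon>\<^sub>i\<close> is \<open>axis (ix i) 1\<close>.
\<close>

section \<open>Quotient topology\<close>

definition quotient_topology :: "'a topology \<Rightarrow> ('a \<Rightarrow> 'b) \<Rightarrow> 'b topology" where
  "quotient_topology X f =
     topology (\<lambda>U. U \<subseteq> f ` topspace X \<and> openin X {x \<in> topspace X. f x \<in> U})"

lemma openin_quotient_topology:
  "openin (quotient_topology X f) U \<longleftrightarrow>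
     U \<subseteq> f ` topspace X \<and> openin X {x \<in> topspace X. f x \<in> U}"
proof -
  have "istopology (\<lambda>U. U \<subseteq> f ` topspace X \<and> openin X {x \<in> topspace X. f x \<in> U})"
    unfolding istopology_def
  proof (intro conjI allI impI)
    fix S T
    assume S: "S \<subseteq> f ` topspace X \<and> openin X {x \<in> topspace X. f x \<in> S}"
      and T: "T \<subseteq> f ` topspace X \<and> openin X {x \<in> topspace X. f x \<in> T}"
    show "S \<inter> T \<subseteq> f ` topspace X" using S by blast
    have "{x \<in> topspace X. f x \<in> S \<inter> T} =
        {x \<in> topspace X. f x \<in> S} \<inter> {x \<in> topspace X. f x \<in> T}" by blast
    then show "openin X {x \<in> topspace X. f x \<in> S \<inter> T}" using S T by auto
  next
    fix K
    assume K: "\<forall>U\<in>K. U \<subseteq> f ` topspace X \<and> openin X {x \<in> topspace X. f x \<in> U}"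
    show "\<Union>K \<subseteq> f ` topspace X" using K by blast
    have "{x \<in> topspace X. f x \<in> \<Union>K} = (\<Union>U\<in>K. {x \<in> topspace X. f x \<in> U})" by blast
    then show "openin X {x \<in> topspace X. f x \<in> \<Union>K}" using K by auto
  qed
  then show ?thesis by (simp add: quotient_topology_def topology_inverse')
qed

lemma topspace_quotient_topology: "topspace (quotient_topology X f) = f ` topspace X"
proof
  show "topspace (quotient_topology X f) \<subseteq> f ` topspace X"
    using openin_quotient_topology[of X f "topspace (quotient_topology X f)"] by simp
  have "{x \<in> topspace X. f x \<in> f ` topspace X} = topspace X" by blast
  then have "openin (quotient_topology X f) (f ` topspace X)"
    by (simp add: openin_quotient_topology)
  then show "f ` topspace X \<subseteq> topspace (quotient_topology X f)"
    by (rule openin_subset)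
qed

lemma quotient_map_quotient_topology: "quotient_map X (quotient_topology X f) f"
  unfolding quotient_map_def
  by (auto simp: openin_quotient_topology topspace_quotient_topology)


section \<open>Periodic tridiagonal matrices\<close>

definition matrix_spectrum :: "complex^'n^'n \<Rightarrow> complex set" where
  "matrix_spectrum L = {\<mu>. \<exists>v. v \<noteq> 0 \<and> L *v v = \<mu> *s v}"

definition tridiag_entry ::
    "nat \<Rightarrow> (nat \<Rightarrow> real) \<Rightarrow> (nat \<Rightarrow> complex) \<Rightarrow> nat \<Rightarrow> nat \<Rightarrow> complex" where
  "tridiag_entry n a b i j =
     (if i = j then complex_of_real (a i)
      else if j = i + 1 then b i
      else if i = j + 1 then cnj (b j)
      else if i = n \<and> j = 1 then b n
      else if i = 1 \<and> j = n then cnj (b n)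
      else 0)"

text \<open>\<open>L = L(a,b)\<close>; only the values of \<open>a\<close> and \<open>b\<close> on \<open>{1..CARD('n)}\<close> matter.\<close>

definition is_periodic_tridiagonal ::
    "(nat \<Rightarrow> 'n) \<Rightarrow> (nat \<Rightarrow> real) \<Rightarrow> (nat \<Rightarrow> complex) \<Rightarrow> complex^'n^'n \<Rightarrow> bool" where
  "is_periodic_tridiagonal ix a b L \<longleftrightarrow>
     (\<forall>i\<in>{1..CARD('n)}. \<forall>j\<in>{1..CARD('n)}.
        L $ ix i $ ix j = tridiag_entry CARD('n) a b i j)"

text \<open>
  The spectrum is compared as a set: for a simple spectrum, i.e. \<open>CARD('n)\<close> distinct
  values of \<open>lam\<close>, every eigenvalue then automatically has multiplicity one.
\<close>

definition X_space :: "(nat \<Rightarrow> 'n) \<Rightarrow> (nat \<Rightarrow> real) \<Rightarrow> (complex^'n^'n) set" where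
  "X_space ix lam =
     {L. (\<exists>a b. is_periodic_tridiagonal ix a b L) \<and>
         matrix_spectrum L = (\<lambda>i. complex_of_real (lam i)) ` {1..CARD('n)}}"

text \<open>For \<open>k \<in> {1..CARD('n)}\<close> the entry \<open>b k\<close> is determined by \<open>L\<close>.\<close>

definition Y_space :: "(nat \<Rightarrow> 'n) \<Rightarrow> (nat \<Rightarrow> real) \<Rightarrow> nat \<Rightarrow> (complex^'n^'n) set" where
  "Y_space ix lam k =
     {L \<in> X_space ix lam. \<exists>a b. is_periodic_tridiagonal ix a b L \<and> b k = 0}"

definition X0_space :: "(nat \<Rightarrow> 'n) \<Rightarrow> (nat \<Rightarrow> real) \<Rightarrow> (complex^'n^'n) set" where
  "X0_space ix lam = (\<Union>k\<in>{1..CARD('n)}. Y_space ix lam k)"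

definition conj_transpose :: "complex^'n^'n \<Rightarrow> complex^'n^'n" where
  "conj_transpose D = transpose (map_matrix cnj D)"

definition diagonal_unitary :: "(complex^'n^'n) set" where
  "diagonal_unitary =
     {D. (\<forall>i j. i \<noteq> j \<longrightarrow> D $ i $ j = 0) \<and> D ** conj_transpose D = mat 1}"

text \<open>
  The diagonal circle acts trivially, so orbits of the group of all diagonal unitary matrices are
  the same as orbits of its quotient by the diagonal circle.
\<close>

definition torus_orbit :: "complex^'n^'n \<Rightarrow> (complex^'n^'n) set" where
  "torus_orbit L = {D ** L ** conj_transpose D | D. D \<in> diagonal_unitary}"

definition Q0_topology ::
    "(nat \<Rightarrow> 'n) \<Rightarrow> (nat \<Rightarrow> real) \<Rightarrow> (complex^'n^'n) set topology" where
  "Q0_topology ix lam = quotient_topology (top_of_set (X0_space ix lam)) torus_orbit"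

definition Q_space ::
    "(nat \<Rightarrow> 'n) \<Rightarrow> (nat \<Rightarrow> real) \<Rightarrow> nat \<Rightarrow> (complex^'n^'n) set set" where
  "Q_space ix lam k = torus_orbit ` Y_space ix lam k"


section \<open>The wonderful cell decomposition\<close>

definition lattice_N :: "(real^'n) set" where
  "lattice_N =
     {(\<chi> i. of_int (z i)) | z. (\<Sum>i\<in>UNIV. z i) = 0 \<and>
        (\<forall>i j. z i mod int CARD('n) = z j mod int CARD('n))}"

definition N_real :: "(real^'n) set" where
  "N_real = span lattice_N"

definition alpha :: "'n \<Rightarrow> real^'n" where
  "alpha i = real (CARD('n) - 1) *\<^sub>R axis i 1 - (\<Sum>j\<in>UNIV - {i}. axis j 1)"

definition lattice_N' :: "(nat \<Rightarrow> 'n) \<Rightarrow> (real^'n) set" where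
  "lattice_N' ix = group_closure {alpha (ix k) - alpha (ix (k + 1)) | k. k \<in> {1..<CARD('n)}}"

definition voronoi_cell :: "real^'n \<Rightarrow> (real^'n) set" where
  "voronoi_cell v = {x \<in> N_real. \<forall>w\<in>lattice_N. w \<noteq> v \<longrightarrow> dist x v \<le> dist x w}"

definition torus_class :: "(nat \<Rightarrow> 'n) \<Rightarrow> real^'n \<Rightarrow> (real^'n) set" where
  "torus_class ix x = (+) x ` lattice_N' ix"

definition torus_topology :: "(nat \<Rightarrow> 'n) \<Rightarrow> (real^'n) set topology" where
  "torus_topology ix = quotient_topology (top_of_set N_real) (torus_class ix)"

definition wonderful_cells :: "(nat \<Rightarrow> 'n) \<Rightarrow> (real^'n) set set set" where
  "wonderful_cells ix =
     {torus_class ix ` F | F v. v \<in> lattice_N \<and> F face_of voronoi_cell v \<and> F \<noteq> {}}"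

definition maximal_wonderful_cells :: "(nat \<Rightarrow> 'n) \<Rightarrow> (real^'n) set set set" where
  "maximal_wonderful_cells ix =
     {C \<in> wonderful_cells ix. \<forall>C'\<in>wonderful_cells ix. C \<subseteq> C' \<longrightarrow> C' = C}"

text \<open>\<open>\<P>\<T>\<^sub>k\<close>, written with the representative \<open>k \<alpha>\<^sub>1\<close> of the class \<open>k[\<alpha>\<^sub>1]\<close> in \<open>N/N'\<close>.\<close>

definition PT_cell :: "(nat \<Rightarrow> 'n) \<Rightarrow> nat \<Rightarrow> (real^'n) set set" where
  "PT_cell ix k = torus_class ix ` voronoi_cell (real k *\<^sub>R alpha (ix 1))"

end

theory Submission
  imports Defs
begin

text \<open>
  Write a matrix with spectrum \<open>\<lambda>\<close> as \<open>L = U\<^sup>* diag(\<mu>) U\<close> with \<open>U\<close> unitary; row \<open>i\<close> of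
  \<open>U\<close> is, up to conjugation, a unit eigenvector for the \<open>i\<close>-th eigenvalue.  If \<open>b\<^sub>k = 0\<close>, read
  the rows of \<open>L\<close> in the cyclic order \<open>k+1, \<dots>, n, 1, \<dots>, k\<close> and give them the ranks
  \<open>1, \<dots>, n\<close>: in this order \<open>L\<close> is an ordinary tridiagonal matrix.  The weights
  \<open>|U\<^sub>i\<^sub>a|\<^sup>2\<close> form a probability distribution on the rows \<open>a\<close>, so eigenvector \<open>i\<close> has a mean
  rank \<open>p\<^sub>i = \<Sum>\<^sub>a rank(a) |U\<^sub>i\<^sub>a|\<^sup>2\<close>.  The vector \<open>p\<close> depends only on the torus orbit of \<open>L\<close>,
  and it is the coordinate that identifies \<open>Q\<^sub>k\<close> with a permutohedron.

  \<^item> The matrix of weights is doubly stochastic, so \<open>p\<close> satisfies the inequalities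
    \<open>\<Sum>\<^sub>I p\<^sub>i \<ge> |I|(|I|+1)/2\<close> of the permutohedron (\<open>rank_sum_ge\<close>).  Equality for \<open>I\<close> means that
    the eigenvectors in \<open>I\<close> live exactly on the first \<open>|I|\<close> rows, that is, \<open>L\<close> splits into two
    blocks there (\<open>block_support_if_tight\<close>, \<open>block_support_if_splits\<close>).

  \<^item> \<open>p\<close> determines the orbit (\<open>torus_orbit_eq_if_mean_rank_eq\<close>).  Within an irreducible
    block, the flag spanned by the first columns of \<open>U\<close> is generated by the first of them under
    \<open>diag(\<mu>)\<close>, so a suitable diagonal matrix \<open>A\<close> carries the flag of one frame \<open>X\<close> to that of
    another frame \<open>Y\<close>, and \<open>C = Y\<^sup>* A X\<close> is upper triangular.  The identity
    \<open>\<Sum> (l - m) |C\<^sub>m\<^sub>l|\<^sup>2 = \<Sum> |A\<^sub>i|\<^sup>2 (p\<^sub>i(X) - p\<^sub>i(Y))\<close> has nonnegative terms on the left, so equal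
    mean ranks force \<open>C\<close> to be diagonal, and \<open>C\<close> intertwines the two tridiagonal matrices.

  \<^item> Every point of the permutohedron occurs (\<open>permutohedron_filled\<close>).  The Lanczos process
    parametrises the irreducible matrices by the positive weights in the first column;
    followed by \<open>p\<close> it is continuous and injective, hence open by invariance of domain, and its image is closed in the
    interior by compactness.

  \<^item> The Voronoi cell of \<open>0\<close> is the permutohedron translated so that its centre is the origin
    (\<open>voronoi_cell_0_iff\<close>).  Where \<open>b\<^sub>k = b\<^sub>l = 0\<close> with \<open>k \<le> l\<close>, passing from the order
    starting at \<open>k+1\<close> to the one starting at \<open>l+1\<close> changes \<open>p\<close> by \<open>n \<one>\<^sub>J - (l - k)\<close>, where \<open>J\<close> is
    the set of the \<open>l - k\<close> eigenvectors carried by the rows \<open>k+1, \<dots>, l\<close>.  After recentring in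
    \<open>P\<^bsub>k\<alpha>\<^sub>1\<^esub>\<close> and \<open>P\<^bsub>l\<alpha>\<^sub>1\<^esub>\<close> this difference lies in \<open>N'\<close>, so the maps on the \<open>Q\<^sub>k\<close> glue to a map
    into the torus (\<open>cell_points_agree\<close>).  Conversely, points congruent modulo \<open>N'\<close> in two cells
    make an inequality tight, so they come from matrices that lie in both \<open>Y\<^sub>k\<close> and \<open>Y\<^sub>l\<close>
    (\<open>rotated_mean_rank_congruent\<close>); hence the glued map is injective.

  A continuous bijection from the compact space \<open>Q\<^sup>0\<close> to the Hausdorff torus is a homeomorphism.
\<close>

section \<open>Unitary matrices and mean ranks\<close>

definition ranking :: "('n::finite \<Rightarrow> nat) \<Rightarrow> bool" where
  "ranking r \<longleftrightarrow> bij_betw r UNIV {1..CARD('n)}"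

definition unitary_matrix :: "complex^'n^'n \<Rightarrow> bool" where
  "unitary_matrix U \<longleftrightarrow> U ** conj_transpose U = mat 1"

definition diag_matrix :: "('n \<Rightarrow> complex) \<Rightarrow> complex^'n^'n" where
  "diag_matrix d = (\<chi> i j. if i = j then d i else 0)"

text \<open>
  The eigenvectors are conjugated rows of \<open>U\<close>: the parametrisation is chosen so that rows of \<open>U\<close>
  are indexed by eigenvalues and columns by the rows of \<open>L\<close>.
\<close>

definition isospectral :: "('n \<Rightarrow> real) \<Rightarrow> complex^'n^'n \<Rightarrow> complex^'n^'n" where
  "isospectral \<mu> U = conj_transpose U ** diag_matrix (\<lambda>i. of_real (\<mu> i)) ** U"

text \<open>
  The \<open>i\<close>-th diagonal entry of \<open>U diag(r) U\<^sup>*\<close>; the vector of all mean ranks is thus a moment map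
  for the orbit of a Hermitian matrix with eigenvalues \<open>1, \<dots>, n\<close>.
\<close>

definition mean_rank :: "('n::finite \<Rightarrow> nat) \<Rightarrow> complex^'n^'n \<Rightarrow> 'n \<Rightarrow> real" where
  "mean_rank r U i = (\<Sum>a\<in>UNIV. real (r a) * (cmod (U $ i $ a))\<^sup>2)"

lemma conj_transpose_nth [simp]: "conj_transpose M $ i $ j = cnj (M $ j $ i)"
  by (simp add: conj_transpose_def transpose_def map_matrix_def)

lemma conj_transpose_mult: "conj_transpose (M ** K) = conj_transpose K ** conj_transpose M"
  by (simp add: vec_eq_iff matrix_matrix_mult_def mult.commute)

lemma conj_transpose_conj_transpose [simp]: "conj_transpose (conj_transpose M) = M"
  by (simp add: vec_eq_iff)

lemma diag_matrix_mult_left: "(diag_matrix d ** M) $ i $ j = d i * M $ i $ j"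
  by (simp add: diag_matrix_def matrix_matrix_mult_def if_distrib[of "\<lambda>x. x * _"] sum.delta cong: if_cong)

lemma diag_matrix_mult_right: "(M ** diag_matrix d) $ i $ j = M $ i $ j * d j"
  by (simp add: diag_matrix_def matrix_matrix_mult_def if_distrib[of "\<lambda>x. _ * x"] sum.delta cong: if_cong)

lemma diag_matrix_commute: "diag_matrix d ** diag_matrix e = diag_matrix e ** diag_matrix d"
  by (simp add: vec_eq_iff diag_matrix_mult_left) (simp add: diag_matrix_def)

lemma unitary_matrix_left: "unitary_matrix U \<Longrightarrow> conj_transpose U ** U = mat 1"
  unfolding unitary_matrix_def using matrix_left_right_inverse by blast

lemma unitary_rows:
  assumes "unitary_matrix U"
  shows "(\<Sum>a\<in>UNIV. U $ i $ a * cnj (U $ j $ a)) = (if i = j then 1 else 0)"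
proof -
  have "(U ** conj_transpose U) $ i $ j = mat 1 $ i $ j"
    using assms by (simp add: unitary_matrix_def)
  then show ?thesis by (simp add: matrix_matrix_mult_def mat_def)
qed

lemma unitary_columns:
  assumes "unitary_matrix U"
  shows "(\<Sum>i\<in>UNIV. cnj (U $ i $ a) * U $ i $ b) = (if a = b then 1 else 0)"
proof -
  have "(conj_transpose U ** U) $ a $ b = mat 1 $ a $ b"
    using unitary_matrix_left[OF assms] by simp
  then show ?thesis by (simp add: matrix_matrix_mult_def mat_def)
qed

lemma unitary_row_norm:
  assumes "unitary_matrix U"
  shows "(\<Sum>a\<in>UNIV. (cmod (U $ i $ a))\<^sup>2) = 1"
proof -
  have "complex_of_real (\<Sum>a\<in>UNIV. (cmod (U $ i $ a))\<^sup>2) = 1"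
    using unitary_rows[OF assms, of i i] by (simp flip: complex_norm_square of_real_power)
  then show ?thesis by (metis of_real_eq_1_iff)
qed

lemma unitary_column_norm:
  assumes "unitary_matrix U"
  shows "(\<Sum>i\<in>UNIV. (cmod (U $ i $ a))\<^sup>2) = 1"
proof -
  have "complex_of_real (\<Sum>i\<in>UNIV. (cmod (U $ i $ a))\<^sup>2) = 1"
    using unitary_columns[OF assms, of a a] by (simp add: mult.commute flip: complex_norm_square of_real_power)
  then show ?thesis by (metis of_real_eq_1_iff)
qed

lemma isospectral_nth:
  "isospectral \<mu> U $ a $ b = (\<Sum>i\<in>UNIV. cnj (U $ i $ a) * of_real (\<mu> i) * U $ i $ b)"
  by (simp add: isospectral_def matrix_matrix_mult_def[of "_ ** _"] diag_matrix_mult_right)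

lemma isospectral_hermitian: "conj_transpose (isospectral \<mu> U) = isospectral \<mu> U"
  by (simp add: vec_eq_iff isospectral_nth mult.commute mult.left_commute)

lemma isospectral_hermitian_nth: "cnj (isospectral \<mu> U $ a $ b) = isospectral \<mu> U $ b $ a"
  using isospectral_hermitian[of \<mu> U] by (metis conj_transpose_nth)

lemma isospectral_mult_left:
  assumes "unitary_matrix U"
  shows "U ** isospectral \<mu> U = diag_matrix (\<lambda>i. of_real (\<mu> i)) ** U"
  using assms by (simp add: isospectral_def matrix_mul_assoc unitary_matrix_def)

lemma isospectral_mult_right:
  assumes "unitary_matrix U"
  shows "isospectral \<mu> U ** conj_transpose U = conj_transpose U ** diag_matrix (\<lambda>i. of_real (\<mu> i))"
proof -
  have "isospectral \<mu> U ** conj_transpose U =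
      conj_transpose U ** diag_matrix (\<lambda>i. of_real (\<mu> i)) ** (U ** conj_transpose U)"
    by (simp add: isospectral_def matrix_mul_assoc)
  then show ?thesis using assms by (simp add: unitary_matrix_def)
qed

lemma eigen_equation:
  assumes "unitary_matrix U"
  shows "(\<Sum>b\<in>UNIV. U $ i $ b * isospectral \<mu> U $ b $ a) = of_real (\<mu> i) * U $ i $ a"
proof -
  have "(U ** isospectral \<mu> U) $ i $ a = (diag_matrix (\<lambda>i. of_real (\<mu> i)) ** U) $ i $ a"
    using isospectral_mult_left[OF assms] by simp
  then show ?thesis by (simp add: diag_matrix_mult_left) (simp add: matrix_matrix_mult_def)
qed


section \<open>The permutohedron inequalities and reducibility\<close>

text \<open>
  The frame is block diagonal: the eigenvectors in \<open>I\<close> are supported on the rows of rank at most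
  \<open>m\<close>, the others on the remaining rows.
\<close>

definition block_support :: "('n \<Rightarrow> nat) \<Rightarrow> nat \<Rightarrow> 'n set \<Rightarrow> complex^'n^'n \<Rightarrow> bool" where
  "block_support r m I U \<longleftrightarrow> (\<forall>i a. U $ i $ a \<noteq> 0 \<longrightarrow> (i \<in> I \<longleftrightarrow> r a \<le> m))"

definition splits :: "('n \<Rightarrow> nat) \<Rightarrow> nat \<Rightarrow> complex^'n^'n \<Rightarrow> bool" where
  "splits r m L \<longleftrightarrow> (\<forall>a b. r a \<le> m \<and> m < r b \<longrightarrow> L $ a $ b = 0 \<and> L $ b $ a = 0)"

lemma ranking_inj: "ranking r \<Longrightarrow> inj r"
  by (simp add: ranking_def bij_betw_def)

lemma ranking_range: "ranking (r :: 'n::finite \<Rightarrow> nat) \<Longrightarrow> r a \<ge> 1 \<and> r a \<le> CARD('n)"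
  using bij_betwE[of r UNIV "{1..CARD('n)}"] by (auto simp: ranking_def)

lemma ranking_ex:
  fixes r :: "'n::finite \<Rightarrow> nat"
  assumes "ranking r" "1 \<le> k" "k \<le> CARD('n)"
  obtains a where "r a = k"
proof -
  have "k \<in> range r" using assms by (simp add: ranking_def bij_betw_def)
  then show ?thesis using that by blast
qed

lemma ranking_sum:
  fixes r :: "'n::finite \<Rightarrow> nat" and f :: "nat \<Rightarrow> 'b::comm_monoid_add"
  assumes r: "ranking r" and m: "m \<le> CARD('n)"
  shows "(\<Sum>a | r a \<le> m. f (r a)) = (\<Sum>k=1..m. f k)"
proof (rule sum.reindex_bij_betw)
  have "r ` {a. r a \<le> m} = {1..m}"
  proof
    show "r ` {a. r a \<le> m} \<subseteq> {1..m}" using ranking_range[OF r] by auto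
    show "{1..m} \<subseteq> r ` {a. r a \<le> m}"
    proof
      fix k assume "k \<in> {1..m}"
      moreover then obtain a where "r a = k" using ranking_ex[OF r, of k] m by auto
      ultimately show "k \<in> r ` {a. r a \<le> m}" by auto
    qed
  qed
  then show "bij_betw r {a. r a \<le> m} {1..m}"
    using ranking_inj[OF r] by (auto simp: bij_betw_def intro: inj_on_subset)
qed

lemma ranking_card:
  fixes r :: "'n::finite \<Rightarrow> nat"
  assumes "ranking r" "m \<le> CARD('n)"
  shows "card {a. r a \<le> m} = m"
  using ranking_sum[OF assms, of "\<lambda>_. 1::nat"] by simp

lemma sum_upto_real: "(\<Sum>k=1..m. real k) = real m * (real m + 1) / 2"
  by (induction m) (auto simp: field_simps)

text \<open>
  The numbers \<open>w a\<close> lie in \<open>[0,1]\<close> and add up to \<open>m\<close>, so the weighted rank sum is smallest when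
  they are \<open>1\<close> on the ranks up to \<open>m\<close> and \<open>0\<close> beyond.  Comparing every rank with the threshold
  \<open>m + 1/2\<close> writes the excess over this minimum as a sum in which each summand is a strictly
  positive factor times \<open>1 - w a\<close> or \<open>w a\<close>; this gives the inequality and its equality case at
  once.
\<close>

lemma rank_sum_excess:
  fixes r :: "'n::finite \<Rightarrow> nat" and I :: "'n set"
  assumes r: "ranking r" and U: "unitary_matrix U" and m: "m = card I"
  defines "w \<equiv> \<lambda>a. \<Sum>i\<in>I. (cmod (U $ i $ a))\<^sup>2"
  shows "(\<Sum>i\<in>I. mean_rank r U i) - real m * (real m + 1) / 2 =
     (\<Sum>a\<in>UNIV. if r a \<le> m then (real m + 1/2 - real (r a)) * (1 - w a)
                 else (real (r a) - real m - 1/2) * w a)"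
proof -
  have mn: "m \<le> CARD('n)" unfolding m by (simp add: card_mono)
  have tot: "(\<Sum>a\<in>UNIV. w a) = real m"
    unfolding w_def by (subst sum.swap) (simp add: unitary_row_norm[OF U] m)
  have mr: "(\<Sum>i\<in>I. mean_rank r U i) = (\<Sum>a\<in>UNIV. real (r a) * w a)"
    unfolding w_def mean_rank_def by (subst sum.swap) (simp add: sum_distrib_left)
  have split: "(\<Sum>a\<in>UNIV. if r a \<le> m then f a else 0) = (\<Sum>a | r a \<le> m. f a)" for f :: "'n \<Rightarrow> real"
    by (simp add: sum.If_cases)
  have e: "(if r a \<le> m then (real m + 1/2 - real (r a)) * (1 - w a)
                 else (real (r a) - real m - 1/2) * w a) =
      (if r a \<le> m then real m + 1/2 - real (r a) else 0) + (real (r a) * w a - (real m + 1/2) * w a)" for a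
    by (cases "r a \<le> m") (simp_all add: field_simps)
  have "(\<Sum>a\<in>UNIV. if r a \<le> m then (real m + 1/2 - real (r a)) * (1 - w a)
                 else (real (r a) - real m - 1/2) * w a) =
     (\<Sum>k=1..m. real m + 1/2 - real k) + (\<Sum>a\<in>UNIV. real (r a) * w a) - (real m + 1/2) * real m"
    unfolding e sum.distrib split ranking_sum[OF r mn, of "\<lambda>k. real m + 1/2 - real k"]
    by (simp add: sum_subtractf tot flip: sum_distrib_left)
  also have "(\<Sum>k=1..m. real m + 1/2 - real k) = (real m + 1/2) * real m - real m * (real m + 1) / 2"
    unfolding sum_subtractf sum_upto_real by simp
  finally show ?thesis unfolding mr by simp
qed

lemma column_part_le_one:
  assumes "unitary_matrix U"
  shows "(\<Sum>i\<in>I. (cmod (U $ i $ a))\<^sup>2) \<le> 1"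
  using sum_mono2[of UNIV I "\<lambda>i. (cmod (U $ i $ a))\<^sup>2"] unitary_column_norm[OF assms, of a] by simp

lemma rank_excess_term_nonneg:
  fixes I :: "'n::finite set"
  assumes "unitary_matrix U"
  defines "w \<equiv> \<lambda>a. \<Sum>i\<in>I. (cmod (U $ i $ a))\<^sup>2"
  shows "0 \<le> (if r a \<le> m then (real m + 1/2 - real (r a)) * (1 - w a)
                 else (real (r a) - real m - 1/2) * w a)"
proof -
  have "w a \<le> 1" "0 \<le> w a"
    using column_part_le_one[OF assms(1)] by (auto simp: w_def sum_nonneg)
  then show ?thesis by (cases "r a \<le> m") (auto intro!: mult_nonneg_nonneg)
qed

lemma rank_sum_ge:
  fixes r :: "'n::finite \<Rightarrow> nat"
  assumes "ranking r" "unitary_matrix U"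
  shows "(\<Sum>i\<in>I. mean_rank r U i) \<ge> real (card I) * (real (card I) + 1) / 2"
proof -
  have "0 \<le> (\<Sum>i\<in>I. mean_rank r U i) - real (card I) * (real (card I) + 1) / 2"
    unfolding rank_sum_excess[OF assms refl]
    by (intro sum_nonneg rank_excess_term_nonneg[OF assms(2)])
  then show ?thesis by simp
qed

text \<open>
  In the equality case every summand of \<open>rank_sum_excess\<close> vanishes, so the column weights
  \<open>w a\<close> are \<open>0\<close> or \<open>1\<close>.
\<close>

lemma block_support_if_tight:
  fixes r :: "'n::finite \<Rightarrow> nat"
  assumes r: "ranking r" and U: "unitary_matrix U"
    and tight: "(\<Sum>i\<in>I. mean_rank r U i) \<le> real (card I) * (real (card I) + 1) / 2"
  shows "block_support r (card I) I U"
proof -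
  define m where "m = card I"
  define w where "w a = (\<Sum>i\<in>I. (cmod (U $ i $ a))\<^sup>2)" for a
  define t where "t a = (if r a \<le> m then (real m + 1/2 - real (r a)) * (1 - w a)
                 else (real (r a) - real m - 1/2) * w a)" for a
  have t0: "t a \<ge> 0" for a
    unfolding t_def w_def by (rule rank_excess_term_nonneg[OF U])
  have "(\<Sum>i\<in>I. mean_rank r U i) - real m * (real m + 1) / 2 = sum t UNIV"
    unfolding t_def w_def by (rule rank_sum_excess[OF r U m_def])
  then have "sum t UNIV \<le> 0" using tight by (simp add: m_def)
  then have "sum t UNIV = 0" using t0 by (simp add: sum_nonneg order_antisym)
  then have ta: "t a = 0" for a using t0 by (simp add: sum_nonneg_eq_0_iff)
  show ?thesis unfolding block_support_def m_def[symmetric]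
  proof (intro allI impI)
    fix i a assume nz: "U $ i $ a \<noteq> 0"
    then have pos: "(cmod (U $ i $ a))\<^sup>2 > 0" by simp
    show "i \<in> I \<longleftrightarrow> r a \<le> m"
    proof (cases "r a \<le> m")
      case True
      then have "real m + 1/2 - real (r a) > 0" by simp
      then have w1: "w a = 1" using ta[of a] True by (simp add: t_def)
      have "i \<in> I"
      proof (rule ccontr)
        assume "i \<notin> I"
        then have "w a + (cmod (U $ i $ a))\<^sup>2 = (\<Sum>i\<in>insert i I. (cmod (U $ i $ a))\<^sup>2)"
          by (simp add: w_def)
        also have "\<dots> \<le> 1" by (rule column_part_le_one[OF U])
        finally show False using w1 pos by simp
      qed
      then show ?thesis using True by simp
    next
      case False
      then have "real (r a) - real m - 1/2 > 0" by linarith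
      then have "w a = 0" using ta[of a] False by (simp add: t_def)
      then have "i \<notin> I" using nz by (auto simp: w_def sum_nonneg_eq_0_iff)
      then show ?thesis using False by simp
    qed
  qed
qed

lemma block_support_partial_row:
  assumes U: "unitary_matrix U" and b: "block_support r m I U"
  shows "(\<Sum>a | r a \<le> m. (cmod (U $ i $ a))\<^sup>2) = (if i \<in> I then 1 else 0)"
proof (cases "i \<in> I")
  case True
  have "(\<Sum>a | r a \<le> m. (cmod (U $ i $ a))\<^sup>2) = (\<Sum>a\<in>UNIV. (cmod (U $ i $ a))\<^sup>2)"
    using b True by (intro sum.mono_neutral_left) (auto simp: block_support_def)
  then show ?thesis using True unitary_row_norm[OF U] by simp
next
  case False
  then have "(\<Sum>a | r a \<le> m. (cmod (U $ i $ a))\<^sup>2) = 0"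
    using b by (intro sum.neutral) (auto simp: block_support_def)
  then show ?thesis using False by simp
qed

lemma block_support_card:
  fixes r :: "'n::finite \<Rightarrow> nat"
  assumes r: "ranking r" and U: "unitary_matrix U" and b: "block_support r m I U" and m: "m \<le> CARD('n)"
  shows "card I = m"
proof -
  have "(\<Sum>i\<in>UNIV. \<Sum>a | r a \<le> m. (cmod (U $ i $ a))\<^sup>2) = real (card I)"
    by (simp add: block_support_partial_row[OF U b] sum.If_cases)
  moreover have "(\<Sum>i\<in>UNIV. \<Sum>a | r a \<le> m. (cmod (U $ i $ a))\<^sup>2) = real m"
    by (subst sum.swap) (simp add: unitary_column_norm[OF U] ranking_card[OF r m])
  ultimately show ?thesis by simp
qed

lemma tight_if_block_support:
  fixes r :: "'n::finite \<Rightarrow> nat"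
  assumes r: "ranking r" and U: "unitary_matrix U" and b: "block_support r m I U" and m: "m \<le> CARD('n)"
  shows "(\<Sum>i\<in>I. mean_rank r U i) = real m * (real m + 1) / 2"
proof -
  have c: "m = card I" using block_support_card[OF assms] by simp
  define w where "w a = (\<Sum>i\<in>I. (cmod (U $ i $ a))\<^sup>2)" for a
  have "w a = 1" if "r a \<le> m" for a
  proof -
    have "w a = (\<Sum>i\<in>UNIV. (cmod (U $ i $ a))\<^sup>2)"
      unfolding w_def using b that by (intro sum.mono_neutral_left) (auto simp: block_support_def)
    then show ?thesis using unitary_column_norm[OF U] by simp
  qed
  moreover have "w a = 0" if "\<not> r a \<le> m" for a
    unfolding w_def using b that by (intro sum.neutral) (auto simp: block_support_def)
  ultimately have "(\<Sum>i\<in>I. mean_rank r U i) - real m * (real m + 1) / 2 = 0"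
    unfolding rank_sum_excess[OF r U c] w_def[symmetric] by (intro sum.neutral) auto
  then show ?thesis by simp
qed

lemma splits_if_block_support:
  assumes "block_support r m I U"
  shows "splits r m (isospectral \<mu> U)"
proof -
  have z: "isospectral \<mu> U $ a $ b = 0" if "(r a \<le> m) \<noteq> (r b \<le> m)" for a b
    unfolding isospectral_nth
  proof (rule sum.neutral, rule ballI)
    fix i
    have "U $ i $ a = 0 \<or> U $ i $ b = 0" using assms that by (auto simp: block_support_def)
    then show "cnj (U $ i $ a) * of_real (\<mu> i) * U $ i $ b = 0" by auto
  qed
  then show ?thesis by (auto simp: splits_def)
qed

text \<open>
  The projection to the rows of rank at most \<open>m\<close> commutes with \<open>L\<close>.  In the eigenbasis it becomes
  the matrix \<open>t\<close>, which commutes with the diagonal matrix of distinct eigenvalues and is therefore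
  diagonal; being idempotent it sorts the eigenvectors into two groups.
\<close>

lemma block_support_if_splits:
  assumes U: "unitary_matrix U" and inj: "inj \<mu>" and s: "splits r m (isospectral \<mu> U)"
  obtains I where "block_support r m I U"
proof -
  define L where "L = isospectral \<mu> U"
  define P where "P = {a. r a \<le> m}"
  define t where "t i j = (\<Sum>a\<in>P. U $ i $ a * cnj (U $ j $ a))" for i j
  have L0: "L $ b $ a = 0" if "(a \<in> P) \<noteq> (b \<in> P)" for a b
    using s that by (auto simp: splits_def L_def P_def)
  have ev: "(\<Sum>b\<in>P. U $ i $ b * L $ b $ a) = of_real (\<mu> i) * U $ i $ a" if "a \<in> P" for i a
  proof -
    have "(\<Sum>b\<in>P. U $ i $ b * L $ b $ a) = (\<Sum>b\<in>UNIV. U $ i $ b * L $ b $ a)"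
      using L0 that by (intro sum.mono_neutral_left) auto
    then show ?thesis using eigen_equation[OF U] by (simp add: L_def)
  qed
  have t0: "t i j = 0" if "i \<noteq> j" for i j
  proof -
    have "of_real (\<mu> i) * t i j = (\<Sum>a\<in>P. (\<Sum>b\<in>P. U $ i $ b * L $ b $ a) * cnj (U $ j $ a))"
      unfolding t_def by (simp add: sum_distrib_left ev mult.assoc)
    also have "\<dots> = (\<Sum>b\<in>P. U $ i $ b * cnj (\<Sum>a\<in>P. U $ j $ a * L $ a $ b))"
      unfolding sum_distrib_right cnj_sum sum_distrib_left
      by (subst sum.swap) (simp add: L_def isospectral_hermitian_nth mult_ac)
    also have "\<dots> = (\<Sum>b\<in>P. U $ i $ b * cnj (of_real (\<mu> j) * U $ j $ b))"
      using ev by (intro sum.cong refl) simp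
    also have "\<dots> = of_real (\<mu> j) * t i j"
      unfolding t_def by (simp add: sum_distrib_left mult_ac)
    finally have "of_real (\<mu> i - \<mu> j) * t i j = 0" by (simp add: algebra_simps)
    then show ?thesis using that inj by (auto simp: inj_def)
  qed
  have key: "(if a \<in> P then U $ i $ a else 0) = t i i * U $ i $ a" for i a
  proof -
    have "(\<Sum>j\<in>UNIV. t i j * U $ j $ a) = (\<Sum>b\<in>P. U $ i $ b * (\<Sum>j\<in>UNIV. cnj (U $ j $ b) * U $ j $ a))"
      unfolding t_def sum_distrib_right sum_distrib_left by (subst sum.swap) (simp add: mult.assoc)
    also have "\<dots> = (if a \<in> P then U $ i $ a else 0)"
      by (simp add: unitary_columns[OF U] if_distrib[of "\<lambda>x. _ * x"] sum.delta' cong: if_cong)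
    finally have "(if a \<in> P then U $ i $ a else 0) = (\<Sum>j\<in>UNIV. t i j * U $ j $ a)" by simp
    also have "\<dots> = (\<Sum>j\<in>{i}. t i j * U $ j $ a)"
      using t0 by (intro sum.mono_neutral_right) auto
    finally show ?thesis by simp
  qed
  have "block_support r m {i. t i i = 1} U"
    unfolding block_support_def
  proof (intro allI impI)
    fix i a assume "U $ i $ a \<noteq> 0"
    then show "i \<in> {i. t i i = 1} \<longleftrightarrow> r a \<le> m"
      using key[of a i] by (auto simp: P_def split: if_splits)
  qed
  then show ?thesis by (rule that)
qed

section \<open>Comparison of two frames\<close>

definition tridiagonal :: "('n \<Rightarrow> nat) \<Rightarrow> complex^'n^'n \<Rightarrow> bool" where
  "tridiagonal r L \<longleftrightarrow> (\<forall>a b. r a + 1 < r b \<longrightarrow> L $ a $ b = 0 \<and> L $ b $ a = 0)"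

text \<open>
  For the cyclic order starting at \<open>k + 1\<close>, the frames parametrise \<open>Y\<^sub>k\<close> together with a choice of
  phases of the eigenvectors.
\<close>

definition frames :: "('n \<Rightarrow> real) \<Rightarrow> ('n \<Rightarrow> nat) \<Rightarrow> (complex^'n^'n) set" where
  "frames \<mu> r = {U. unitary_matrix U \<and> tridiagonal r (isospectral \<mu> U)}"

text \<open>
  The columns of \<open>A X\<close>, expanded in the orthonormal basis formed by the columns of \<open>Y\<close>.
\<close>

definition transition :: "('n \<Rightarrow> complex) \<Rightarrow> complex^'n^'n \<Rightarrow> complex^'n^'n \<Rightarrow> complex^'n^'n" where
  "transition A X Y = conj_transpose Y ** diag_matrix A ** X"

text \<open>
  The diagonal matrices \<open>A\<close> and \<open>diag(\<mu>)\<close> commute.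
\<close>

lemma transition_intertwines:
  assumes "unitary_matrix X" "unitary_matrix Y"
  shows "isospectral \<mu> Y ** transition A X Y = transition A X Y ** isospectral \<mu> X"
proof -
  let ?D = "diag_matrix (\<lambda>i. complex_of_real (\<mu> i))"
  have "isospectral \<mu> Y ** transition A X Y =
      (isospectral \<mu> Y ** conj_transpose Y) ** diag_matrix A ** X"
    by (simp add: transition_def matrix_mul_assoc)
  also have "\<dots> = conj_transpose Y ** (?D ** diag_matrix A) ** X"
    by (simp add: isospectral_mult_right[OF assms(2)] matrix_mul_assoc)
  also have "\<dots> = conj_transpose Y ** (diag_matrix A ** ?D) ** X"
    by (simp only: diag_matrix_commute)
  also have "\<dots> = conj_transpose Y ** diag_matrix A ** (?D ** X)"
    by (simp add: matrix_mul_assoc)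
  also have "\<dots> = conj_transpose Y ** diag_matrix A ** (X ** isospectral \<mu> X)"
    by (simp add: isospectral_mult_left[OF assms(1)])
  also have "\<dots> = transition A X Y ** isospectral \<mu> X"
    by (simp add: transition_def matrix_mul_assoc)
  finally show ?thesis .
qed

lemma parseval_unitary:
  fixes M :: "complex^'n^'n" and U :: "complex^'n^'n"
  assumes "unitary_matrix U"
  shows "(\<Sum>l\<in>UNIV. (cmod ((M ** U) $ i $ l))\<^sup>2) = (\<Sum>a\<in>UNIV. (cmod (M $ i $ a))\<^sup>2)"
proof -
  have "(M ** U) ** conj_transpose (M ** U) = M ** conj_transpose M"
    using assms by (metis conj_transpose_mult matrix_mul_assoc matrix_mul_rid unitary_matrix_def)
  then have "((M ** U) ** conj_transpose (M ** U)) $ i $ i = (M ** conj_transpose M) $ i $ i"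
    by simp
  then have "(\<Sum>l\<in>UNIV. (M ** U) $ i $ l * cnj ((M ** U) $ i $ l)) = (\<Sum>a\<in>UNIV. M $ i $ a * cnj (M $ i $ a))"
    by (simp add: matrix_matrix_mult_def[of "_ :: complex^'n^'n" "conj_transpose _"])
  then have "complex_of_real (\<Sum>l\<in>UNIV. (cmod ((M ** U) $ i $ l))\<^sup>2) =
      complex_of_real (\<Sum>a\<in>UNIV. (cmod (M $ i $ a))\<^sup>2)"
    by (simp flip: complex_norm_square of_real_power)
  then show ?thesis by (simp only: of_real_eq_iff)
qed

lemma unitary_matrix_conj_transpose: "unitary_matrix U \<Longrightarrow> unitary_matrix (conj_transpose U)"
  by (simp add: unitary_matrix_def unitary_matrix_left)

lemma transition_row_norm:
  assumes "unitary_matrix X"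
  shows "(\<Sum>l\<in>UNIV. (cmod (transition A X Y $ m $ l))\<^sup>2) =
         (\<Sum>i\<in>UNIV. (cmod (A i))\<^sup>2 * (cmod (Y $ i $ m))\<^sup>2)"
  unfolding transition_def parseval_unitary[OF assms]
  by (simp add: diag_matrix_mult_right norm_mult power_mult_distrib mult.commute)

lemma transition_column_norm:
  assumes "unitary_matrix Y"
  shows "(\<Sum>m\<in>UNIV. (cmod (transition A X Y $ m $ l))\<^sup>2) =
         (\<Sum>i\<in>UNIV. (cmod (A i))\<^sup>2 * (cmod (X $ i $ l))\<^sup>2)"
proof -
  have c: "conj_transpose (transition A X Y) = transition (\<lambda>i. cnj (A i)) Y X"
  proof -
    have "conj_transpose (diag_matrix A) = diag_matrix (\<lambda>i. cnj (A i))"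
      by (simp add: vec_eq_iff diag_matrix_def)
    then show ?thesis by (simp add: transition_def conj_transpose_mult matrix_mul_assoc)
  qed
  have "(cmod (transition A X Y $ m $ l))\<^sup>2 = (cmod (transition (\<lambda>i. cnj (A i)) Y X $ l $ m))\<^sup>2" for m
    using c by (metis conj_transpose_nth complex_mod_cnj)
  then show ?thesis
    by (simp add: transition_row_norm[OF assms])
qed

text \<open>
  By Parseval, the row and column sums of the squared moduli of \<open>C = Y\<^sup>* A X\<close> are weighted sums of
  squared entries of \<open>Y\<close> and \<open>X\<close>; weighting them with the ranks produces mean ranks.
\<close>

lemma transition_rank_gap:
  assumes "unitary_matrix X" "unitary_matrix Y"
  shows "(\<Sum>m\<in>UNIV. \<Sum>l\<in>UNIV. (real (r l) - real (r m)) * (cmod (transition A X Y $ m $ l))\<^sup>2) =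
     (\<Sum>i\<in>UNIV. (cmod (A i))\<^sup>2 * (mean_rank r X i - mean_rank r Y i))"
proof -
  define c where "c m l = (cmod (transition A X Y $ m $ l))\<^sup>2" for m l
  have "(\<Sum>m\<in>UNIV. \<Sum>l\<in>UNIV. (real (r l) - real (r m)) * c m l) =
      (\<Sum>l\<in>UNIV. real (r l) * (\<Sum>m\<in>UNIV. c m l)) - (\<Sum>m\<in>UNIV. real (r m) * (\<Sum>l\<in>UNIV. c m l))"
    unfolding left_diff_distrib sum_subtractf sum_distrib_left by (subst sum.swap) simp
  also have "\<dots> = (\<Sum>l\<in>UNIV. real (r l) * (\<Sum>i\<in>UNIV. (cmod (A i))\<^sup>2 * (cmod (X $ i $ l))\<^sup>2))
      - (\<Sum>m\<in>UNIV. real (r m) * (\<Sum>i\<in>UNIV. (cmod (A i))\<^sup>2 * (cmod (Y $ i $ m))\<^sup>2))"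
    unfolding c_def transition_row_norm[OF assms(1)] transition_column_norm[OF assms(2)] ..
  also have "\<dots> = (\<Sum>i\<in>UNIV. (cmod (A i))\<^sup>2 * mean_rank r X i)
      - (\<Sum>i\<in>UNIV. (cmod (A i))\<^sup>2 * mean_rank r Y i)"
  proof -
    have "(\<Sum>l\<in>UNIV. real (r l) * (\<Sum>i\<in>UNIV. (cmod (A i))\<^sup>2 * (cmod (Z $ i $ l))\<^sup>2)) =
       (\<Sum>i\<in>UNIV. (cmod (A i))\<^sup>2 * mean_rank r Z i)" for Z :: "complex^'a^'a"
      unfolding mean_rank_def sum_distrib_left by (subst sum.swap) (simp add: mult_ac)
    then show ?thesis by simp
  qed
  finally show ?thesis by (simp add: c_def right_diff_distrib sum_subtractf)
qed

text \<open>
  For an upper triangular \<open>C\<close> all summands on the left of \<open>transition_rank_gap\<close> are nonnegative, and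
  the off-diagonal ones carry a positive factor.
\<close>

lemma transition_diagonal:
  assumes r: "inj r" and XY: "unitary_matrix X" "unitary_matrix Y"
    and upper: "\<And>m l. r l < r m \<Longrightarrow> transition A X Y $ m $ l = 0"
    and gap: "(\<Sum>i\<in>UNIV. (cmod (A i))\<^sup>2 * (mean_rank r X i - mean_rank r Y i)) \<le> 0"
    and ml: "m \<noteq> l"
  shows "transition A X Y $ m $ l = 0"
proof -
  define g where "g m l = (real (r l) - real (r m)) * (cmod (transition A X Y $ m $ l))\<^sup>2" for m l
  have g0: "g m l \<ge> 0" for m l
    using upper[of l m] by (cases "r l < r m") (auto simp: g_def)
  have "(\<Sum>m\<in>UNIV. \<Sum>l\<in>UNIV. g m l) \<le> 0"
    unfolding g_def transition_rank_gap[OF XY] by (rule gap)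
  then have "(\<Sum>m\<in>UNIV. \<Sum>l\<in>UNIV. g m l) = 0"
    by (intro order_antisym sum_nonneg g0) auto
  then have "(\<Sum>l\<in>UNIV. g m l) = 0"
    by (subst (asm) sum_nonneg_eq_0_iff) (auto intro: sum_nonneg g0)
  then have "g m l = 0" by (subst (asm) sum_nonneg_eq_0_iff) (auto intro: g0)
  moreover have "r m \<noteq> r l" using r ml by (auto simp: inj_def)
  ultimately show ?thesis by (auto simp: g_def)
qed

text \<open>
  One step of the three-term recursion, read off from the entry \<open>(m, p)\<close> of
  \<open>isospectral \<mu> Y ** C = C ** isospectral \<mu> X\<close>: all terms except the one with column \<open>l\<close> vanish by
  the induction hypothesis or by tridiagonality.
\<close>

lemma transition_upper_step:
  fixes r :: "'n::finite \<Rightarrow> nat"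
  assumes r: "inj r" and X: "X \<in> frames \<mu> r" and Y: "Y \<in> frames \<mu> r"
    and pl: "r l = r p + 1"
    and nz: "isospectral \<mu> X $ p $ l \<noteq> 0"
    and IH: "\<And>k m. r k < r l \<Longrightarrow> r k < r m \<Longrightarrow> transition A X Y $ m $ k = 0"
    and ml: "r l < r m"
  shows "transition A X Y $ m $ l = 0"
proof -
  define C where "C = transition A X Y"
  define L where "L = isospectral \<mu> X"
  define K where "K = isospectral \<mu> Y"
  have U: "unitary_matrix X" "unitary_matrix Y" and tri: "tridiagonal r L" "tridiagonal r K"
    using X Y by (auto simp: frames_def L_def K_def)
  have "(K ** C) $ m $ p = (C ** L) $ m $ p"
    unfolding K_def L_def C_def transition_intertwines[OF U] ..
  then have eq: "(\<Sum>b\<in>UNIV. K $ m $ b * C $ b $ p) = (\<Sum>b\<in>UNIV. C $ m $ b * L $ b $ p)"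
    by (simp add: matrix_matrix_mult_def)
  have "K $ m $ b * C $ b $ p = 0" for b
  proof (cases "r p < r b")
    case True
    then show ?thesis using IH[of p b] pl by (simp add: C_def)
  next
    case False
    then have "r b + 1 < r m" using pl ml by simp
    then show ?thesis using tri(2) by (simp add: tridiagonal_def)
  qed
  then have "(\<Sum>b\<in>UNIV. K $ m $ b * C $ b $ p) = 0" by (intro sum.neutral) blast
  then have "(\<Sum>b\<in>UNIV. C $ m $ b * L $ b $ p) = 0" using eq by simp
  moreover have "(\<Sum>b\<in>UNIV. C $ m $ b * L $ b $ p) = (\<Sum>b\<in>{l}. C $ m $ b * L $ b $ p)"
  proof (rule sum.mono_neutral_right; clarsimp)
    fix b assume b: "b \<noteq> l" "L $ b $ p \<noteq> 0"
    then have "r b \<noteq> r l" using r by (auto simp: inj_def)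
    moreover have "\<not> r l < r b"
    proof
      assume "r l < r b"
      then have "r p + 1 < r b" using pl by simp
      then show False using tri(1) b by (auto simp: tridiagonal_def)
    qed
    ultimately show "C $ m $ b = 0" using IH[of b m] ml by (simp add: C_def)
  qed
  moreover have "L $ l $ p \<noteq> 0"
    using nz isospectral_hermitian_nth[of \<mu> X p l] by (auto simp: L_def)
  ultimately show ?thesis by (simp add: C_def)
qed

text \<open>
  Inside a block the columns are generated by the recursion; at the beginning of a block the recursion
  stops and the triangular shape has to come from the choice of \<open>A\<close>, which is the hypothesis
  \<open>start\<close>.
\<close>

lemma transition_upper:
  fixes r :: "'n::finite \<Rightarrow> nat"
  assumes r: "ranking r" and X: "X \<in> frames \<mu> r" and Y: "Y \<in> frames \<mu> r"
    and start: "\<And>l i. splits r (r l - 1) (isospectral \<mu> X) \<Longrightarrow> A i * X $ i $ l = Y $ i $ l"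
  shows "r l < r m \<Longrightarrow> transition A X Y $ m $ l = 0"
proof (induction "r l" arbitrary: l m rule: less_induct)
  case less
  show ?case
  proof (cases "splits r (r l - 1) (isospectral \<mu> X)")
    case True
    have "transition A X Y $ m $ l = (conj_transpose Y ** Y) $ m $ l"
      unfolding transition_def matrix_mul_assoc[symmetric] using start[OF True]
      by (simp add: matrix_matrix_mult_def[of "conj_transpose Y"] diag_matrix_mult_left)
    also have "\<dots> = 0"
      using Y less.prems by (auto simp: frames_def unitary_matrix_left mat_def)
    finally show ?thesis .
  next
    case False
    then obtain a b where ab: "r a \<le> r l - 1" "r l - 1 < r b"
        "isospectral \<mu> X $ a $ b \<noteq> 0 \<or> isospectral \<mu> X $ b $ a \<noteq> 0"
      by (auto simp: splits_def)
    moreover have "\<not> r a + 1 < r b" using ab(3) X by (auto simp: frames_def tridiagonal_def)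
    ultimately have "r b = r l" "r l = r a + 1" using ranking_range[OF r, of a] by auto
    then have "b = l" using ranking_inj[OF r] by (auto simp: inj_def)
    then have "isospectral \<mu> X $ a $ l \<noteq> 0"
      using ab(3) isospectral_hermitian_nth[of \<mu> X b a] by auto
    then show ?thesis
      using transition_upper_step[OF ranking_inj[OF r] X Y \<open>r l = r a + 1\<close>] less by blast
  qed
qed

text \<open>
  The intertwining diagonal matrix need not be unitary, but because both matrices are Hermitian its
  entries have equal modulus wherever a matrix entry links them, so only the phases matter.
\<close>

lemma torus_orbit_eq_if_intertwined:
  assumes C: "\<And>a b. c b * isospectral \<mu> Y $ a $ b = c a * isospectral \<mu> X $ a $ b"
    and nz: "\<And>a. c a \<noteq> 0"
  shows "\<exists>D\<in>diagonal_unitary. isospectral \<mu> Y = D ** isospectral \<mu> X ** conj_transpose D"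
proof -
  define d where "d a = c a / of_real (cmod (c a))" for a
  define L where "L = isospectral \<mu> X"
  define K where "K = isospectral \<mu> Y"
  have nd: "cmod (d a) = 1" for a using nz[of a] by (simp add: d_def norm_divide)
  then have dd: "d a * cnj (d a) = 1" for a by (simp add: complex_norm_square[symmetric])
  have e: "K $ a $ b = d a * L $ a $ b * cnj (d b)" for a b
  proof (cases "L $ a $ b = 0")
    case True
    then show ?thesis using C[of b a] nz[of b] by (simp add: L_def K_def)
  next
    case False
    have 1: "c b * K $ a $ b = c a * L $ a $ b" "c a * K $ b $ a = c b * L $ b $ a"
      using C by (auto simp: L_def K_def)
    have h: "cmod (K $ b $ a) = cmod (K $ a $ b)" "cmod (L $ b $ a) = cmod (L $ a $ b)"
      unfolding K_def L_def by (metis complex_mod_cnj isospectral_hermitian_nth)+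
    have "cmod (c b) * cmod (K $ a $ b) = cmod (c a) * cmod (L $ a $ b)"
      "cmod (c a) * cmod (K $ a $ b) = cmod (c b) * cmod (L $ a $ b)"
      using 1 h by (metis norm_mult)+
    then have "cmod (c a) * (cmod (c a) * cmod (L $ a $ b)) = cmod (c b) * (cmod (c b) * cmod (L $ a $ b))"
      by (metis mult.left_commute)
    then have "cmod (c a) * cmod (c a) = cmod (c b) * cmod (c b)" using False by simp
    then have cc: "cmod (c a) = cmod (c b)" by (metis norm_ge_zero real_sqrt_abs2 abs_of_nonneg)
    have "d b * K $ a $ b = d a * L $ a $ b"
      using 1(1) by (simp add: d_def cc)
    then have "cnj (d b) * (d b * K $ a $ b) = d a * L $ a $ b * cnj (d b)" by simp
    then show ?thesis using dd[of b] by (simp add: mult.assoc[symmetric] mult.commute[of "cnj _"])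
  qed
  have "diag_matrix d \<in> diagonal_unitary"
    using dd by (auto simp: diagonal_unitary_def diag_matrix_mult_left vec_eq_iff mat_def) 
      (auto simp: diag_matrix_def)
  moreover have "K = diag_matrix d ** L ** conj_transpose (diag_matrix d)"
  proof -
    have *: "conj_transpose (diag_matrix d) = diag_matrix (\<lambda>a. cnj (d a))"
      by (simp add: vec_eq_iff diag_matrix_def)
    show ?thesis
      unfolding * vec_eq_iff diag_matrix_mult_left diag_matrix_mult_right
      by (simp add: e)
  qed
  ultimately show ?thesis unfolding K_def L_def by blast
qed

lemma torus_orbit_eqI:
  assumes "D \<in> diagonal_unitary" "K = D ** L ** conj_transpose D"
  shows "torus_orbit K = torus_orbit L"
proof -
  have u: "unitary_matrix D" and dg: "\<And>i j. i \<noteq> j \<Longrightarrow> D $ i $ j = 0"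
    using assms(1) by (auto simp: diagonal_unitary_def unitary_matrix_def)
  have prod: "E ** F \<in> diagonal_unitary" if "E \<in> diagonal_unitary" "F \<in> diagonal_unitary"
    for E F :: "complex^'a^'a"
  proof -
    have uE: "unitary_matrix E" "unitary_matrix F"
      using that by (auto simp: diagonal_unitary_def unitary_matrix_def)
    have "(E ** F) ** conj_transpose (E ** F) = E ** (F ** conj_transpose F) ** conj_transpose E"
      by (simp add: conj_transpose_mult matrix_mul_assoc)
    also have "\<dots> = mat 1" using uE by (simp add: unitary_matrix_def)
    finally have "unitary_matrix (E ** F)" by (simp add: unitary_matrix_def)
    moreover have "(E ** F) $ i $ j = 0" if "i \<noteq> j" for i j
      unfolding matrix_matrix_mult_def
      using that \<open>E \<in> _\<close> \<open>F \<in> _\<close> by (auto simp: diagonal_unitary_def intro!: sum.neutral) metis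
    ultimately show ?thesis by (auto simp: diagonal_unitary_def unitary_matrix_def)
  qed
  have inv: "conj_transpose D \<in> diagonal_unitary"
    using unitary_matrix_conj_transpose[OF u] dg by (auto simp: diagonal_unitary_def unitary_matrix_def)
  have L: "L = conj_transpose D ** K ** conj_transpose (conj_transpose D)"
  proof -
    have "conj_transpose D ** K ** D = (conj_transpose D ** D) ** L ** (conj_transpose D ** D)"
      by (simp add: assms(2) matrix_mul_assoc)
    then show ?thesis by (simp add: unitary_matrix_left[OF u])
  qed
  have sub: "torus_orbit (E ** M ** conj_transpose E) \<subseteq> torus_orbit M" if "E \<in> diagonal_unitary"
    for E M :: "complex^'a^'a"
  proof
    fix Z assume "Z \<in> torus_orbit (E ** M ** conj_transpose E)"
    then obtain F where "F \<in> diagonal_unitary" "Z = F ** (E ** M ** conj_transpose E) ** conj_transpose F"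
      by (auto simp: torus_orbit_def)
    then have "Z = (F ** E) ** M ** conj_transpose (F ** E)" "F ** E \<in> diagonal_unitary"
      using prod[OF _ that] by (auto simp: conj_transpose_mult matrix_mul_assoc)
    then show "Z \<in> torus_orbit M" unfolding torus_orbit_def by blast
  qed
  show ?thesis
  proof
    show "torus_orbit K \<subseteq> torus_orbit L" using sub[OF assms(1), of L] by (simp only: assms(2)[symmetric])
    show "torus_orbit L \<subseteq> torus_orbit K" using sub[OF inv, of K] by (simp only: L[symmetric])
  qed
qed

lemma mult_diagonal_row:
  fixes M N :: "complex^'n^'n"
  assumes "\<And>k. k \<noteq> i \<Longrightarrow> M $ i $ k = 0"
  shows "(M ** N) $ i $ j = M $ i $ i * N $ i $ j"
proof -
  have "(M ** N) $ i $ j = (\<Sum>k\<in>UNIV. M $ i $ k * N $ k $ j)"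
    by (simp add: matrix_matrix_mult_def)
  also have "\<dots> = (\<Sum>k\<in>{i}. M $ i $ k * N $ k $ j)"
    using assms by (intro sum.mono_neutral_right) auto
  finally show ?thesis by simp
qed

lemma mult_diagonal_column:
  fixes M N :: "complex^'n^'n"
  assumes "\<And>k. k \<noteq> j \<Longrightarrow> N $ k $ j = 0"
  shows "(M ** N) $ i $ j = M $ i $ j * N $ j $ j"
proof -
  have "(M ** N) $ i $ j = (\<Sum>k\<in>UNIV. M $ i $ k * N $ k $ j)"
    by (simp add: matrix_matrix_mult_def)
  also have "\<dots> = (\<Sum>k\<in>{j}. M $ i $ k * N $ k $ j)"
    using assms by (intro sum.mono_neutral_right) auto
  finally show ?thesis by simp
qed

section \<open>Mean ranks determine the torus orbit\<close>

definition first_entry :: "('n \<Rightarrow> nat) \<Rightarrow> complex^'n^'n \<Rightarrow> 'n \<Rightarrow> 'n \<Rightarrow> bool" where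
  "first_entry r U i a \<longleftrightarrow> U $ i $ a \<noteq> 0 \<and> (\<forall>b. r b < r a \<longrightarrow> U $ i $ b = 0)"

lemma first_entry_exists:
  fixes r :: "'n::finite \<Rightarrow> nat"
  assumes "unitary_matrix U"
  shows "\<exists>a. first_entry r U i a"
proof -
  have "\<exists>a. U $ i $ a \<noteq> 0"
  proof (rule ccontr)
    assume "\<not> ?thesis"
    then show False using unitary_row_norm[OF assms, of i] by simp
  qed
  then obtain a where "U $ i $ a \<noteq> 0" "\<forall>b. U $ i $ b \<noteq> 0 \<longrightarrow> r a \<le> r b"
    using ex_has_least_nat[of "\<lambda>a. U $ i $ a \<noteq> 0" _ r] by blast
  then have "first_entry r U i a" by (fastforce simp: first_entry_def)
  then show ?thesis by blast
qed

text \<open>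
  If an eigenvector vanishes on all ranks below \<open>r a\<close>, its eigenvalue equation in the row of rank
  \<open>r a - 1\<close> reduces to a single term, the product of the first nonzero entry with the linking entry
  of \<open>L\<close>.
\<close>

lemma splits_before_first_entry:
  assumes r: "ranking r" and U: "U \<in> frames \<mu> r" and f: "first_entry r U i a"
  shows "splits r (r a - 1) (isospectral \<mu> U)"
proof -
  define L where "L = isospectral \<mu> U"
  have U': "unitary_matrix U" and tri: "tridiagonal r L"
    using U by (auto simp: frames_def L_def)
  have herm: "L $ x $ y = 0 \<longleftrightarrow> L $ y $ x = 0" for x y
    unfolding L_def by (metis isospectral_hermitian_nth complex_cnj_zero_iff)
  have "L $ y $ x = 0" if xy: "r x \<le> r a - 1" "r a - 1 < r y" for x y
  proof (cases "r x + 1 < r y")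
    case True
    then show ?thesis using tri by (simp add: tridiagonal_def)
  next
    case False
    then have rx: "r x + 1 = r a" and "r y = r a" using xy ranking_range[OF r, of x] by auto
    then have "y = a" using ranking_inj[OF r] by (auto simp: inj_def)
    have "U $ i $ b * L $ b $ x = 0" if "b \<noteq> a" for b
    proof (cases "r b < r a")
      case True
      then show ?thesis using f by (simp add: first_entry_def)
    next
      case False
      moreover have "r b \<noteq> r a" using that ranking_inj[OF r] by (auto simp: inj_def)
      ultimately have "r x + 1 < r b" using rx by simp
      then show ?thesis using tri by (simp add: tridiagonal_def)
    qed
    then have "(\<Sum>b\<in>{a}. U $ i $ b * L $ b $ x) = (\<Sum>b\<in>UNIV. U $ i $ b * L $ b $ x)"
      by (intro sum.mono_neutral_left) auto
    also have "\<dots> = of_real (\<mu> i) * U $ i $ x"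
      unfolding L_def by (rule eigen_equation[OF U'])
    also have "\<dots> = 0" using f rx by (simp add: first_entry_def)
    finally show ?thesis using f \<open>y = a\<close> by (simp add: first_entry_def)
  qed
  then show ?thesis using herm by (auto simp: splits_def simp flip: L_def)
qed

text \<open>
  The eigenvectors carried by a block are visible in the mean ranks, as a tight inequality; so two frames
  with the same mean ranks have the same blocks carrying the same eigenvalues.
\<close>

lemma common_block_support:
  fixes r :: "'n::finite \<Rightarrow> nat"
  assumes r: "ranking r" and inj: "inj \<mu>" and U: "unitary_matrix X" "unitary_matrix Y"
    and eq: "\<And>i. mean_rank r X i = mean_rank r Y i"
    and s: "splits r m (isospectral \<mu> X)" and m: "m \<le> CARD('n)"
  obtains I where "block_support r m I X" "block_support r m I Y"
proof -
  obtain I where I: "block_support r m I X" using block_support_if_splits[OF U(1) inj s] .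
  have c: "card I = m" using block_support_card[OF r U(1) I m] .
  have "(\<Sum>i\<in>I. mean_rank r Y i) \<le> real (card I) * (real (card I) + 1) / 2"
    using tight_if_block_support[OF r U(1) I m] by (simp only: eq c order_refl)
  then have "block_support r m I Y" using block_support_if_tight[OF r U(2), of I] by (simp only: c)
  then show ?thesis using I that by blast
qed

lemma first_entry_at_block_start:
  assumes "ranking r" "block_support r (r l - 1) I U" "U $ i $ l \<noteq> 0"
  shows "first_entry r U i l"
proof -
  have "\<not> r l \<le> r l - 1" using ranking_range[OF assms(1), of l] by linarith
  then have "i \<notin> I" using assms by (auto simp: block_support_def)
  then have "U $ i $ b = 0" if "r b < r l" for b
    using assms(2) that by (force simp: block_support_def)
  then show ?thesis using assms(3) by (simp add: first_entry_def)
qed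

lemma first_entry_le:
  fixes r :: "'n::finite \<Rightarrow> nat"
  assumes r: "ranking r" and inj: "inj \<mu>" and XY: "X \<in> frames \<mu> r" "Y \<in> frames \<mu> r"
    and eq: "\<And>i. mean_rank r X i = mean_rank r Y i"
    and f: "first_entry r X i a" and nz: "Y $ i $ b \<noteq> 0"
  shows "r a \<le> r b"
proof -
  have U: "unitary_matrix X" "unitary_matrix Y" using XY by (auto simp: frames_def)
  have "r a - 1 \<le> CARD('n)" using ranking_range[OF r, of a] by linarith
  then obtain I where I: "block_support r (r a - 1) I X" "block_support r (r a - 1) I Y"
    using common_block_support[OF r inj U eq splits_before_first_entry[OF r XY(1) f]] by blast
  have "\<not> r a \<le> r a - 1" using ranking_range[OF r, of a] by linarith
  then have "i \<notin> I" using I(1) f by (auto simp: block_support_def first_entry_def)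
  then have "\<not> r b \<le> r a - 1" using I(2) nz by (auto simp: block_support_def)
  then show ?thesis by simp
qed

text \<open>
  The diagonal matrix \<open>A\<close> matches the first nonzero entries of corresponding eigenvectors.  These sit at
  the same place in both frames, at the start of the common block.  With this \<open>A\<close> the transition
  matrix is triangular, hence diagonal because the mean ranks agree.
\<close>

theorem torus_orbit_eq_if_mean_rank_eq:
  fixes r :: "'n::finite \<Rightarrow> nat"
  assumes r: "ranking r" and inj: "inj \<mu>" and X: "X \<in> frames \<mu> r" and Y: "Y \<in> frames \<mu> r"
    and eq: "\<And>i. mean_rank r X i = mean_rank r Y i"
  shows "torus_orbit (isospectral \<mu> X) = torus_orbit (isospectral \<mu> Y)"
proof -
  have U: "unitary_matrix X" "unitary_matrix Y" using X Y by (auto simp: frames_def)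
  obtain F where F: "\<And>i. first_entry r X i (F i)"
    using first_entry_exists[OF U(1), of r] by metis
  have unique: "a = F i" if "first_entry r Y i a" for i a
  proof -
    have "r (F i) \<le> r a"
      using first_entry_le[OF r inj X Y eq F] that by (simp add: first_entry_def)
    moreover have "r a \<le> r (F i)"
      using first_entry_le[OF r inj Y X eq[symmetric] that] F by (simp add: first_entry_def)
    ultimately show ?thesis using ranking_inj[OF r] by (auto simp: inj_def)
  qed
  have FY: "first_entry r Y i (F i)" for i
    using first_entry_exists[OF U(2), of r i] unique by blast
  define A where "A i = Y $ i $ F i / X $ i $ F i" for i
  define C where "C = transition A X Y"
  have A0: "A i \<noteq> 0" for i using F[of i] FY[of i] by (simp add: A_def first_entry_def)
  have start: "A i * X $ i $ l = Y $ i $ l" if s: "splits r (r l - 1) (isospectral \<mu> X)" for l i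
  proof -
    have "r l - 1 \<le> CARD('n)" using ranking_range[OF r, of l] by linarith
    then obtain I where I: "block_support r (r l - 1) I X" "block_support r (r l - 1) I Y"
      using common_block_support[OF r inj U eq s] by blast
    show ?thesis
    proof (cases "X $ i $ l = 0")
      case False
      then have "first_entry r X i l" using first_entry_at_block_start[OF r I(1)] by blast
      then have "r l \<le> r (F i)" "r (F i) \<le> r l"
        using first_entry_le[OF r inj X X refl] F[of i] by (auto simp: first_entry_def)
      then have "l = F i" using ranking_inj[OF r] by (auto simp: inj_def)
      then show ?thesis using False by (simp add: A_def)
    next
      case True
      have "Y $ i $ l = 0"
      proof (rule ccontr)
        assume "Y $ i $ l \<noteq> 0"
        then have "l = F i" using first_entry_at_block_start[OF r I(2)] unique by blast
        then show False using True F[of i] by (simp add: first_entry_def)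
      qed
      then show ?thesis using True by simp
    qed
  qed
  have diag: "C $ m $ l = 0" if "m \<noteq> l" for m l
    unfolding C_def
    by (rule transition_diagonal[OF ranking_inj[OF r] U transition_upper[OF r X Y start] _ that])
      (simp_all add: eq)
  have Cnz: "C $ l $ l \<noteq> 0" for l
  proof
    assume "C $ l $ l = 0"
    then have "C $ m $ l = 0" for m using diag[of m l] by (cases "m = l") auto
    then have "(\<Sum>i\<in>UNIV. (cmod (A i))\<^sup>2 * (cmod (X $ i $ l))\<^sup>2) = 0"
      using transition_column_norm[OF U(2), of A X l] by (simp add: C_def)
    then have "X $ i $ l = 0" for i
      using A0[of i] by (subst (asm) sum_nonneg_eq_0_iff) auto
    then show False using unitary_column_norm[OF U(1), of l] by simp
  qed
  have "C $ b $ b * isospectral \<mu> Y $ a $ b = C $ a $ a * isospectral \<mu> X $ a $ b" for a b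
  proof -
    have "(isospectral \<mu> Y ** C) $ a $ b = (C ** isospectral \<mu> X) $ a $ b"
      unfolding C_def by (simp add: transition_intertwines[OF U])
    moreover have "(isospectral \<mu> Y ** C) $ a $ b = isospectral \<mu> Y $ a $ b * C $ b $ b"
      using diag by (rule mult_diagonal_column)
    moreover have "(C ** isospectral \<mu> X) $ a $ b = C $ a $ a * isospectral \<mu> X $ a $ b"
      using diag by (intro mult_diagonal_row) metis
    ultimately show ?thesis by (simp add: mult.commute)
  qed
  then obtain D where "D \<in> diagonal_unitary"
      "isospectral \<mu> Y = D ** isospectral \<mu> X ** conj_transpose D"
    using torus_orbit_eq_if_intertwined[of "\<lambda>a. C $ a $ a" \<mu> Y X] Cnz by blast
  then show ?thesis using torus_orbit_eqI by metis
qed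

lemma mat_1_diagonal_unitary: "mat 1 \<in> diagonal_unitary"
  by (auto simp: diagonal_unitary_def vec_eq_iff) (auto simp: mat_def)

lemma mem_torus_orbit_self:
  fixes L :: "complex^'a^'a"
  shows "L \<in> torus_orbit L"
proof -
  have "conj_transpose (mat 1) = (mat 1 :: complex^'a^'a)"
    by (simp add: vec_eq_iff mat_def)
  then have "L = mat 1 ** L ** conj_transpose (mat 1)" by (simp only: matrix_mul_lid matrix_mul_rid)
  then show ?thesis using mat_1_diagonal_unitary unfolding torus_orbit_def by blast
qed

text \<open>
  For a simple spectrum the eigenvectors are unique up to phases, and the torus only changes the phases of
  their entries; hence mean ranks are functions on the orbit space.
\<close>

theorem cmod_eq_if_torus_orbit_eq:
  assumes U: "unitary_matrix X" "unitary_matrix Y" and inj: "inj \<mu>"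
    and orb: "torus_orbit (isospectral \<mu> X) = torus_orbit (isospectral \<mu> Y)"
  shows "cmod (X $ i $ a) = cmod (Y $ i $ a)"
proof -
  define \<Lambda> where "\<Lambda> = diag_matrix (\<lambda>i. complex_of_real (\<mu> i))"
  obtain D where D: "D \<in> diagonal_unitary" "isospectral \<mu> Y = D ** isospectral \<mu> X ** conj_transpose D"
    using mem_torus_orbit_self[of "isospectral \<mu> Y"] orb by (auto simp: torus_orbit_def)
  have uD: "unitary_matrix D" using D by (simp add: diagonal_unitary_def unitary_matrix_def)
  define Z where "Z = Y ** D ** conj_transpose X"
  have "isospectral \<mu> Y ** D = D ** isospectral \<mu> X ** (conj_transpose D ** D)"
    by (simp add: D(2) matrix_mul_assoc)
  then have YD: "isospectral \<mu> Y ** D = D ** isospectral \<mu> X"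
    by (simp add: unitary_matrix_left[OF uD])
  have "Z ** \<Lambda> = Y ** D ** (conj_transpose X ** \<Lambda>)" by (simp add: Z_def matrix_mul_assoc)
  also have "\<dots> = Y ** (D ** isospectral \<mu> X) ** conj_transpose X"
    by (simp add: \<Lambda>_def isospectral_mult_right[OF U(1), symmetric] matrix_mul_assoc)
  also have "\<dots> = (Y ** isospectral \<mu> Y) ** D ** conj_transpose X"
    by (simp add: YD[symmetric] matrix_mul_assoc)
  also have "\<dots> = \<Lambda> ** Z" by (simp add: Z_def \<Lambda>_def isospectral_mult_left[OF U(2)] matrix_mul_assoc)
  finally have "(Z ** \<Lambda>) $ i $ j = (\<Lambda> ** Z) $ i $ j" for i j by simp
  then have "Z $ i $ j * of_real (\<mu> j) = of_real (\<mu> i) * Z $ i $ j" for i j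
    by (simp add: \<Lambda>_def diag_matrix_mult_left diag_matrix_mult_right)
  then have Z00: "of_real (\<mu> j - \<mu> i) * Z $ i $ j = 0" for i j by (simp add: algebra_simps)
  have Z0: "Z $ i $ j = 0" if "i \<noteq> j" for i j
  proof -
    have "\<mu> j - \<mu> i \<noteq> 0" using that inj by (auto simp: inj_def)
    then show ?thesis using Z00[of j i] by (simp del: of_real_diff)
  qed
  have "Z ** conj_transpose Z = Y ** D ** (conj_transpose X ** X) ** conj_transpose D ** conj_transpose Y"
    by (simp add: Z_def conj_transpose_mult matrix_mul_assoc)
  also have "\<dots> = Y ** (D ** conj_transpose D) ** conj_transpose Y"
    by (simp add: unitary_matrix_left[OF U(1)] matrix_mul_assoc)
  also have "\<dots> = mat 1" using uD U(2) by (simp add: unitary_matrix_def)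
  finally have uZ: "unitary_matrix Z" by (simp add: unitary_matrix_def)
  have one: "cmod (M $ j $ j) = 1" if "unitary_matrix M" "\<And>i j. i \<noteq> j \<Longrightarrow> M $ i $ j = 0"
    for M :: "complex^'a^'a" and j
  proof -
    have "(\<Sum>b\<in>{j}. (cmod (M $ j $ b))\<^sup>2) = (\<Sum>b\<in>UNIV. (cmod (M $ j $ b))\<^sup>2)"
      using that(2) by (intro sum.mono_neutral_left) auto
    then show ?thesis using unitary_row_norm[OF that(1), of j] by (simp add: power2_eq_1_iff) 
        (smt (verit) norm_ge_zero)
  qed
  have D0: "\<And>i j. i \<noteq> j \<Longrightarrow> D $ i $ j = 0" using D by (simp add: diagonal_unitary_def)
  have "Z ** X = Y ** D ** (conj_transpose X ** X)" by (simp add: Z_def matrix_mul_assoc)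
  then have "(Z ** X) $ i $ a = (Y ** D) $ i $ a" by (simp add: unitary_matrix_left[OF U(1)])
  moreover have "(Z ** X) $ i $ a = Z $ i $ i * X $ i $ a"
    using Z0 by (intro mult_diagonal_row) metis
  moreover have "(Y ** D) $ i $ a = Y $ i $ a * D $ a $ a"
    using D0 by (rule mult_diagonal_column)
  ultimately have "Z $ i $ i * X $ i $ a = Y $ i $ a * D $ a $ a" by simp
  then have "cmod (Z $ i $ i) * cmod (X $ i $ a) = cmod (Y $ i $ a) * cmod (D $ a $ a)"
    by (metis norm_mult)
  then show ?thesis using one[OF uZ Z0] one[OF uD D0] by simp
qed


section \<open>Hermitian matrices with a given simple spectrum\<close>

lemma matrix_spectrum_isospectral:
  fixes \<mu> :: "'n::finite \<Rightarrow> real"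
  assumes U: "unitary_matrix U"
  shows "matrix_spectrum (isospectral \<mu> U) = range (\<lambda>i. complex_of_real (\<mu> i))"
proof
  define L where "L = isospectral \<mu> U"
  define \<Lambda> where "\<Lambda> = diag_matrix (\<lambda>i. complex_of_real (\<mu> i))"
  have \<Lambda>v: "(\<Lambda> *v w) $ i = of_real (\<mu> i) * w $ i" for w i
    by (simp add: \<Lambda>_def diag_matrix_def matrix_vector_mult_def if_distrib[of "\<lambda>x. x * _"] sum.delta cong: if_cong)
  show "matrix_spectrum (isospectral \<mu> U) \<subseteq> range (\<lambda>i. complex_of_real (\<mu> i))"
  proof
    fix z assume "z \<in> matrix_spectrum (isospectral \<mu> U)"
    then obtain v where v: "v \<noteq> 0" "L *v v = z *s v" by (auto simp: matrix_spectrum_def L_def)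
    define w where "w = U *v v"
    have "conj_transpose U *v w = v"
      by (simp add: w_def matrix_vector_mul_assoc unitary_matrix_left[OF U])
    then have "w \<noteq> 0" using v by (metis matrix_vector_mult_0_right)
    then obtain i where i: "w $ i \<noteq> 0" by (auto simp: vec_eq_iff)
    have "\<Lambda> *v w = (\<Lambda> ** U) *v v" by (simp add: w_def matrix_vector_mul_assoc)
    also have "\<dots> = U *v (L *v v)"
      by (simp add: \<Lambda>_def L_def isospectral_mult_left[OF U, symmetric] matrix_vector_mul_assoc)
    also have "\<dots> = z *s w" by (simp add: v w_def vector_scalar_commute)
    finally have "(\<Lambda> *v w) $ i = z * w $ i" by simp
    then have "of_real (\<mu> i) * w $ i = z * w $ i" unfolding \<Lambda>v .
    then show "z \<in> range (\<lambda>i. complex_of_real (\<mu> i))" using i by auto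
  qed
  show "range (\<lambda>i. complex_of_real (\<mu> i)) \<subseteq> matrix_spectrum (isospectral \<mu> U)"
  proof clarify
    fix i
    define e :: "complex^'n" where "e = axis i 1"
    define v where "v = conj_transpose U *v e"
    have "U *v v = e"
      using U by (simp add: v_def matrix_vector_mul_assoc unitary_matrix_def)
    moreover have "e \<noteq> 0" by (simp add: e_def axis_eq_0_iff)
    ultimately have "v \<noteq> 0" by (metis matrix_vector_mult_0_right)
    have "\<Lambda> *v e = of_real (\<mu> i) *s e"
      by (simp add: vec_eq_iff \<Lambda>v) (simp add: e_def axis_def)
    then have "L *v v = of_real (\<mu> i) *s v"
      by (simp add: L_def v_def matrix_vector_mul_assoc isospectral_mult_right[OF U] flip: \<Lambda>_def)
        (simp add: vector_scalar_commute flip: matrix_vector_mul_assoc)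
    then show "complex_of_real (\<mu> i) \<in> matrix_spectrum (isospectral \<mu> U)"
      using \<open>v \<noteq> 0\<close> by (auto simp: matrix_spectrum_def L_def)
  qed
qed

text \<open>
  Since the eigenvalues are distinct, eigenvectors of the Hermitian matrix are automatically orthogonal; it
  suffices to normalise them.
\<close>

lemma isospectral_exists:
  fixes \<mu> :: "'n::finite \<Rightarrow> real"
  assumes inj: "inj \<mu>" and herm: "conj_transpose L = L"
    and spec: "range (\<lambda>i. complex_of_real (\<mu> i)) \<subseteq> matrix_spectrum L"
  obtains U where "unitary_matrix U" "L = isospectral \<mu> U"
proof -
  have "\<exists>v. v \<noteq> 0 \<and> L *v v = of_real (\<mu> i) *s v" for i
    using spec by (auto simp: matrix_spectrum_def)
  then obtain v where v: "\<And>i. v i \<noteq> 0" "\<And>i. L *v v i = of_real (\<mu> i) *s v i" by metis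
  have hn: "cnj (L $ a $ b) = L $ b $ a" for a b using herm by (metis conj_transpose_nth)
  have ev: "(\<Sum>b\<in>UNIV. L $ a $ b * v i $ b) = of_real (\<mu> i) * v i $ a" for i a
    using v(2)[of i] by (simp add: vec_eq_iff matrix_vector_mult_def)
  define g where "g i j = (\<Sum>a\<in>UNIV. cnj (v i $ a) * v j $ a)" for i j
  have g0: "g i j = 0" if "i \<noteq> j" for i j
  proof -
    have "of_real (\<mu> j) * g i j = (\<Sum>a\<in>UNIV. cnj (v i $ a) * (\<Sum>b\<in>UNIV. L $ a $ b * v j $ b))"
      unfolding g_def ev by (simp add: sum_distrib_left mult_ac)
    also have "\<dots> = (\<Sum>b\<in>UNIV. cnj (\<Sum>a\<in>UNIV. L $ b $ a * v i $ a) * v j $ b)"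
      unfolding cnj_sum sum_distrib_left sum_distrib_right
      by (subst sum.swap) (simp add: hn mult_ac)
    also have "\<dots> = of_real (\<mu> i) * g i j"
      unfolding g_def ev by (simp add: sum_distrib_left mult_ac)
    finally have "of_real (\<mu> i - \<mu> j) * g i j = 0" by (simp only: of_real_diff left_diff_distrib) simp
    moreover have "\<mu> i - \<mu> j \<noteq> 0" using that inj by (auto simp: inj_def)
    ultimately show ?thesis by (simp del: of_real_diff)
  qed
  have gn: "g i i = of_real ((norm (v i))\<^sup>2)" for i
  proof -
    have "g i i = of_real (\<Sum>a\<in>UNIV. (cmod (v i $ a))\<^sup>2)"
      by (simp add: g_def mult.commute flip: complex_norm_square of_real_power)
    also have "(\<Sum>a\<in>UNIV. (cmod (v i $ a))\<^sup>2) = (norm (v i))\<^sup>2"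
      by (simp add: norm_vec_def L2_set_def sum_nonneg)
    finally show ?thesis .
  qed
  define U :: "complex^'n^'n" where "U = (\<chi> i a. cnj (v i $ a) / of_real (norm (v i)))"
  have "(U ** conj_transpose U) $ i $ j = (if i = j then 1 else 0)" for i j
  proof -
    have "(U ** conj_transpose U) $ i $ j = g i j / (of_real (norm (v i)) * of_real (norm (v j)))"
      by (simp add: matrix_matrix_mult_def U_def g_def sum_divide_distrib)
    then show ?thesis using g0[of i j] gn[of i] v(1)[of i] by (auto simp: power2_eq_square)
  qed
  then have U: "unitary_matrix U" by (simp add: unitary_matrix_def vec_eq_iff mat_def)
  have "U ** L = diag_matrix (\<lambda>i. of_real (\<mu> i)) ** U"
    unfolding vec_eq_iff
  proof (intro allI)
    fix i a
    have "(U ** L) $ i $ a = cnj (\<Sum>b\<in>UNIV. L $ a $ b * v i $ b) / of_real (norm (v i))"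
      by (simp add: matrix_matrix_mult_def U_def hn sum_divide_distrib mult_ac)
    then show "(U ** L) $ i $ a = (diag_matrix (\<lambda>i. of_real (\<mu> i)) ** U) $ i $ a"
      by (simp add: ev diag_matrix_mult_left) (simp add: U_def)
  qed
  then have "conj_transpose U ** U ** L = isospectral \<mu> U"
    by (simp add: isospectral_def flip: matrix_mul_assoc)
  then have "L = isospectral \<mu> U" by (simp add: unitary_matrix_left[OF U])
  then show ?thesis using U that by blast
qed

section \<open>The space of frames is compact\<close>

lemma mean_rank_total:
  fixes r :: "'n::finite \<Rightarrow> nat"
  assumes r: "ranking r" and U: "unitary_matrix U"
  shows "(\<Sum>i\<in>UNIV. mean_rank r U i) = real CARD('n) * (real CARD('n) + 1) / 2"
proof -
  have "block_support r CARD('n) UNIV U"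
    using ranking_range[OF r] by (simp add: block_support_def)
  then show ?thesis using tight_if_block_support[OF r U] by blast
qed

lemma mean_rank_ge_1:
  fixes r :: "'n::finite \<Rightarrow> nat"
  assumes r: "ranking r" and U: "unitary_matrix U"
  shows "mean_rank r U i \<ge> 1"
  using rank_sum_ge[OF r U, of "{i}"] by simp

lemma mean_rank_le_card:
  fixes r :: "'n::finite \<Rightarrow> nat"
  assumes r: "ranking r" and U: "unitary_matrix U"
  shows "mean_rank r U i \<le> real CARD('n)"
proof -
  have "mean_rank r U i \<le> (\<Sum>a\<in>UNIV. real CARD('n) * (cmod (U $ i $ a))\<^sup>2)"
    unfolding mean_rank_def using ranking_range[OF r] by (intro sum_mono mult_right_mono) auto
  also have "\<dots> = real CARD('n)"
    by (simp add: unitary_row_norm[OF U] flip: sum_distrib_left)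
  finally show ?thesis .
qed

lemma continuous_on_isospectral [continuous_intros]: "continuous_on S (isospectral \<mu>)"
proof -
  have "isospectral \<mu> = (\<lambda>U. \<chi> a b. \<Sum>i\<in>UNIV. cnj (U $ i $ a) * of_real (\<mu> i) * U $ i $ b)"
    by (intro ext) (simp add: vec_eq_iff isospectral_nth)
  then show ?thesis by (simp only:) (intro continuous_intros)
qed

lemma continuous_on_mean_rank: "continuous_on S (\<lambda>U. mean_rank r U i)"
  unfolding mean_rank_def by (intro continuous_intros)

lemma compact_unitary_matrices: "compact {U :: complex^'n^'n. unitary_matrix U}"
proof -
  have "{U :: complex^'n^'n. unitary_matrix U} =
      (\<Inter>i. \<Inter>j. {U. (\<Sum>a\<in>UNIV. U $ i $ a * cnj (U $ j $ a)) = (if i = j then 1 else 0)})"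
    by (auto simp: unitary_rows)
      (simp add: unitary_matrix_def vec_eq_iff matrix_matrix_mult_def mat_def)
  also have "closed \<dots>"
    by (intro closed_INT ballI closed_Collect_eq continuous_intros)
  finally have "closed {U :: complex^'n^'n. unitary_matrix U}" .
  moreover have "norm U = sqrt (real CARD('n))" if "unitary_matrix U" for U :: "complex^'n^'n"
  proof -
    have "norm (U $ i) = 1" for i
      using unitary_row_norm[OF that, of i] by (simp add: norm_vec_def L2_set_def)
    then show ?thesis by (subst norm_vec_def) (simp add: L2_set_def)
  qed
  then have "bounded {U :: complex^'n^'n. unitary_matrix U}"
    unfolding bounded_iff by (metis mem_Collect_eq order_refl)
  ultimately show ?thesis by (simp add: compact_eq_bounded_closed)
qed

lemma compact_frames: "compact (frames \<mu> r)"
proof -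
  have "{U. tridiagonal r (isospectral \<mu> U)} =
      (\<Inter>(a, b)\<in>{(a, b). r a + 1 < r b}.
        {U. isospectral \<mu> U $ a $ b = 0} \<inter> {U. isospectral \<mu> U $ b $ a = 0})"
    by (auto simp: tridiagonal_def)
  also have "closed \<dots>"
    by (intro closed_INT ballI, clarsimp, intro closed_Int closed_Collect_eq continuous_intros)
  finally have "compact ({U. unitary_matrix U} \<inter> {U. tridiagonal r (isospectral \<mu> U)})"
    by (intro compact_Int_closed compact_unitary_matrices)
  then show ?thesis by (simp add: frames_def Collect_conj_eq)
qed


section \<open>Frames from weights: the Lanczos construction\<close>

text \<open>
  The normalisation by \<open>sgn\<close> gives a total function; on linearly dependent input the vector is
  \<open>0\<close>.
\<close>

fun gram_schmidt :: "(nat \<Rightarrow> 'a::real_inner) \<Rightarrow> nat \<Rightarrow> 'a" where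
  "gram_schmidt y k = sgn (y k - (\<Sum>m\<in>{..<k}. (y k \<bullet> gram_schmidt y m) *\<^sub>R gram_schmidt y m))"

declare gram_schmidt.simps [simp del]

definition residual :: "(nat \<Rightarrow> 'a::real_inner) \<Rightarrow> nat \<Rightarrow> 'a" where
  "residual y k = y k - (\<Sum>m\<in>{..<k}. (y k \<bullet> gram_schmidt y m) *\<^sub>R gram_schmidt y m)"

lemma gram_schmidt_residual: "gram_schmidt y k = sgn (residual y k)"
  by (simp add: residual_def gram_schmidt.simps[of y k])

lemma gram_schmidt_in_span: "gram_schmidt y k \<in> span (y ` {..k})"
proof (induction k rule: less_induct)
  case (less k)
  have "gram_schmidt y m \<in> span (y ` {..k})" if "m < k" for m
    by (rule subsetD[OF span_mono less[OF that]]) (use that in auto)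
  then have "residual y k \<in> span (y ` {..k})"
    unfolding residual_def by (intro span_diff span_sum span_scale) (auto intro: span_base)
  then show ?case unfolding gram_schmidt_residual sgn_div_norm by (rule span_scale)
qed

lemma in_span_gram_schmidt: "y k \<in> span (gram_schmidt y ` {..k})"
proof -
  have "norm (residual y k) *\<^sub>R gram_schmidt y k = residual y k"
    by (cases "residual y k = 0") (simp_all add: gram_schmidt_residual sgn_div_norm)
  then have "y k = norm (residual y k) *\<^sub>R gram_schmidt y k +
      (\<Sum>m\<in>{..<k}. (y k \<bullet> gram_schmidt y m) *\<^sub>R gram_schmidt y m)"
    by (simp add: residual_def)
  moreover have "\<dots> \<in> span (gram_schmidt y ` {..k})"
    by (intro span_add span_sum span_scale) (auto intro: span_base)
  ultimately show ?thesis by simp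
qed

lemma span_gram_schmidt: "span (y ` {..k}) \<subseteq> span (gram_schmidt y ` {..k})"
proof (rule span_minimal)
  show "y ` {..k} \<subseteq> span (gram_schmidt y ` {..k})"
    using in_span_gram_schmidt span_mono[OF image_mono[of "{.._}" "{..k}"]] by fastforce
qed simp

lemma residual_nonzero:
  assumes "y k \<notin> span (y ` {..<k})"
  shows "residual y k \<noteq> 0"
proof
  assume "residual y k = 0"
  then have "y k = (\<Sum>m\<in>{..<k}. (y k \<bullet> gram_schmidt y m) *\<^sub>R gram_schmidt y m)"
    by (simp add: residual_def)
  moreover have "gram_schmidt y m \<in> span (y ` {..<k})" if "m < k" for m
    by (rule subsetD[OF span_mono gram_schmidt_in_span]) (use that in auto)
  then have "(\<Sum>m\<in>{..<k}. (y k \<bullet> gram_schmidt y m) *\<^sub>R gram_schmidt y m) \<in> span (y ` {..<k})"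
    by (intro span_sum span_scale) auto
  ultimately show False using assms by simp
qed

lemma gram_schmidt_orthonormal:
  assumes ind: "\<And>k. k < N \<Longrightarrow> y k \<notin> span (y ` {..<k})"
  shows "k < N \<Longrightarrow> m < N \<Longrightarrow> gram_schmidt y k \<bullet> gram_schmidt y m = (if k = m then 1 else 0)"
proof -
  have unit: "gram_schmidt y k \<bullet> gram_schmidt y k = 1" if "k < N" for k
    using residual_nonzero[of y k] ind[OF that]
    by (simp add: gram_schmidt_residual norm_sgn flip: power2_norm_eq_inner)
  have orth: "k < N \<Longrightarrow> m < k \<Longrightarrow> gram_schmidt y k \<bullet> gram_schmidt y m = 0" for k m
  proof (induction k arbitrary: m rule: less_induct)
    case (less k)
    have "gram_schmidt y j \<bullet> gram_schmidt y m = (if j = m then 1 else 0)" if "j < k" for j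
    proof (cases j m rule: linorder_cases)
      case less
      then show ?thesis using less.IH[of m j] less.prems by (simp add: inner_commute)
    next
      case equal
      then show ?thesis using unit less.prems by auto
    next
      case greater
      then show ?thesis using less.IH[of j m] that less.prems by simp
    qed
    then have "(\<Sum>j\<in>{..<k}. (y k \<bullet> gram_schmidt y j) * (gram_schmidt y j \<bullet> gram_schmidt y m)) =
        (\<Sum>j\<in>{..<k}. if j = m then y k \<bullet> gram_schmidt y m else 0)"
      by (intro sum.cong) auto
    then have "residual y k \<bullet> gram_schmidt y m = 0"
      using less.prems by (simp add: residual_def inner_diff_left inner_sum_left)
    then show ?case by (subst gram_schmidt_residual) (simp add: sgn_div_norm)
  qed
  show "k < N \<Longrightarrow> m < N \<Longrightarrow> gram_schmidt y k \<bullet> gram_schmidt y m = (if k = m then 1 else 0)"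
    using unit orth by (metis inner_commute linorder_neqE_nat)
qed

lemma continuous_on_gram_schmidt:
  assumes cont: "\<And>k. continuous_on S (\<lambda>w. y w k)"
    and ind: "\<And>w k. w \<in> S \<Longrightarrow> k < N \<Longrightarrow> y w k \<notin> span (y w ` {..<k})"
  shows "k < N \<Longrightarrow> continuous_on S (\<lambda>w. gram_schmidt (y w) k)"
proof (induction k rule: less_induct)
  case (less k)
  then have "continuous_on S (\<lambda>w. residual (y w) k)"
    unfolding residual_def by (intro continuous_intros cont) auto
  then show ?case
    unfolding gram_schmidt_residual
    using residual_nonzero ind less.prems by (intro continuous_on_sgn) blast+
qed

text \<open>
  The vectors \<open>\<Lambda>\<^sup>k v\<close> for \<open>\<Lambda> = diag(\<mu>)\<close> and \<open>v = sqrt w\<close>, so that the first column of the frame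
  built from them has squared entries \<open>w\<close>.
\<close>

definition krylov :: "('n \<Rightarrow> real) \<Rightarrow> real^'n \<Rightarrow> nat \<Rightarrow> real^'n" where
  "krylov \<mu> w k = (\<chi> i. \<mu> i ^ k * sqrt (w $ i))"

text \<open>
  A linear relation would be a nonzero polynomial of degree \<open>k\<close> with the \<open>n > k\<close> roots \<open>\<mu> i\<close>.
\<close>

lemma krylov_independent:
  fixes \<mu> :: "'n::finite \<Rightarrow> real"
  assumes inj: "inj \<mu>" and w: "\<And>i. w $ i > 0" and k: "k < CARD('n)"
  shows "krylov \<mu> w k \<notin> span (krylov \<mu> w ` {..<k})"
proof
  define V where "V = {x :: real^'n. \<exists>p. (\<forall>j\<ge>k. coeff p j = 0) \<and> (\<forall>i. x $ i = poly p (\<mu> i) * sqrt (w $ i))}"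
  have "subspace V"
    unfolding subspace_def
  proof (intro conjI ballI allI)
    show "0 \<in> V" unfolding V_def by (auto intro: exI[of _ 0])
  next
    fix x y assume "x \<in> V" "y \<in> V"
    then obtain p q where "\<forall>j\<ge>k. coeff p j = 0" "\<forall>i. x $ i = poly p (\<mu> i) * sqrt (w $ i)"
        "\<forall>j\<ge>k. coeff q j = 0" "\<forall>i. y $ i = poly q (\<mu> i) * sqrt (w $ i)" unfolding V_def by blast
    then show "x + y \<in> V" unfolding V_def by (auto intro!: exI[of _ "p + q"] simp: algebra_simps)
  next
    fix x and c :: real assume "x \<in> V"
    then obtain p where "\<forall>j\<ge>k. coeff p j = 0" "\<forall>i. x $ i = poly p (\<mu> i) * sqrt (w $ i)"
      unfolding V_def by blast
    then show "c *\<^sub>R x \<in> V" unfolding V_def by (auto intro!: exI[of _ "smult c p"])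
  qed
  moreover have "krylov \<mu> w j \<in> V" if "j < k" for j
    unfolding V_def using that
    by (auto simp: krylov_def poly_monom intro!: exI[of _ "monom 1 j"])
  then have "krylov \<mu> w ` {..<k} \<subseteq> V" by blast
  moreover assume "krylov \<mu> w k \<in> span (krylov \<mu> w ` {..<k})"
  ultimately have "krylov \<mu> w k \<in> V" using span_minimal by blast
  then obtain p where p: "\<And>j. j \<ge> k \<Longrightarrow> coeff p j = 0"
      "\<And>i. krylov \<mu> w k $ i = poly p (\<mu> i) * sqrt (w $ i)" by (auto simp: V_def)
  define q where "q = monom 1 k - p"
  have "poly q (\<mu> i) = 0" for i
    using p(2)[of i] w[of i] by (simp add: q_def krylov_def poly_monom)
  then have "range \<mu> \<subseteq> {x. poly q x = 0}" by auto
  moreover have "coeff q k = 1" using p(1) by (simp add: q_def)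
  then have q0: "q \<noteq> 0" by auto
  ultimately have "card (range \<mu>) \<le> card {x. poly q x = 0}"
    by (intro card_mono poly_roots_finite) auto
  also have "\<dots> \<le> degree q" using q0 by (rule card_poly_roots_bound)
  also have "degree q \<le> k" unfolding q_def using p(1) by (intro degree_le) auto
  finally show False using k inj by (simp add: card_image)
qed

definition weights :: "(real^'n) set" where
  "weights = {w. (\<forall>i. w $ i > 0) \<and> (\<Sum>i\<in>UNIV. w $ i) = 1}"

definition lanczos :: "('n \<Rightarrow> real) \<Rightarrow> ('n \<Rightarrow> nat) \<Rightarrow> real^'n \<Rightarrow> complex^'n^'n" where
  "lanczos \<mu> r w = (\<chi> i a. of_real (gram_schmidt (krylov \<mu> w) (r a - 1) $ i))"

lemma lanczos_first_column:
  assumes w: "w \<in> weights" and a: "r a = 1"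
  shows "(cmod (lanczos \<mu> r w $ i $ a))\<^sup>2 = w $ i"
proof -
  have pos: "w $ i > 0" for i using w by (simp add: weights_def)
  have "norm (krylov \<mu> w 0) = 1"
    using w pos by (simp add: krylov_def norm_vec_def L2_set_def weights_def less_imp_le)
  then have "gram_schmidt (krylov \<mu> w) 0 = krylov \<mu> w 0"
    by (subst gram_schmidt.simps) (simp add: sgn_div_norm)
  then show ?thesis using pos[of i] by (simp add: lanczos_def a krylov_def)
qed

text \<open>
  Multiplication by \<open>\<Lambda>\<close> moves the span of the first \<open>l + 1\<close> Krylov vectors into the span of the first
  \<open>l + 2\<close>; so in the orthonormalised basis \<open>\<Lambda>\<close> has only one subdiagonal, and it is symmetric.
\<close>

lemma lanczos_frame:
  fixes r :: "'n::finite \<Rightarrow> nat"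
  assumes r: "ranking r" and inj: "inj \<mu>" and w: "w \<in> weights"
  shows "lanczos \<mu> r w \<in> frames \<mu> r"
proof -
  define y where "y = krylov \<mu> w"
  define g where "g = gram_schmidt y"
  define M where "M x = (\<chi> i. \<mu> i * x $ i)" for x :: "real^'n"
  have ind: "y k \<notin> span (y ` {..<k})" if "k < CARD('n)" for k
    unfolding y_def using w by (intro krylov_independent[OF inj _ that]) (simp add: weights_def)
  have orth: "g k \<bullet> g m = (if k = m then 1 else 0)" if "k < CARD('n)" "m < CARD('n)" for k m
    unfolding g_def using gram_schmidt_orthonormal[of "CARD('n)" y] ind that by blast
  have rk: "r a - 1 < CARD('n)" for a using ranking_range[OF r, of a] by linarith
  have rinj: "r a - 1 = r b - 1 \<longleftrightarrow> a = b" for a b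
    using ranking_range[OF r, of a] ranking_range[OF r, of b] ranking_inj[OF r]
    by (auto simp: inj_def)
  have "(conj_transpose (lanczos \<mu> r w) ** lanczos \<mu> r w) $ a $ b = (if a = b then 1 else 0)" for a b
  proof -
    have "(conj_transpose (lanczos \<mu> r w) ** lanczos \<mu> r w) $ a $ b =
        of_real (g (r a - 1) \<bullet> g (r b - 1))"
      by (simp add: matrix_matrix_mult_def lanczos_def inner_vec_def g_def y_def)
    then show ?thesis by (simp only: orth[OF rk rk] rinj) simp
  qed
  then have "conj_transpose (lanczos \<mu> r w) ** lanczos \<mu> r w = mat 1"
    by (simp add: vec_eq_iff mat_def)
  then have U: "unitary_matrix (lanczos \<mu> r w)"
    unfolding unitary_matrix_def using matrix_left_right_inverse by blast
  have lin: "linear M" by (intro linearI) (simp_all add: M_def vec_eq_iff algebra_simps)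
  have My: "M (y k) = y (Suc k)" for k by (simp add: M_def y_def krylov_def vec_eq_iff)
  have band: "g m \<bullet> M (g l) = 0" if "l + 1 < m" "m < CARD('n)" for l m
  proof -
    have "M (g l) \<in> M ` span (y ` {..l})"
      using gram_schmidt_in_span unfolding g_def by blast
    also have "\<dots> = span (M ` y ` {..l})" by (rule span_linear_image[OF lin, symmetric])
    also have "\<dots> \<subseteq> span (y ` {..Suc l})" by (intro span_mono) (auto simp: My)
    also have "\<dots> \<subseteq> span (g ` {..Suc l})" unfolding g_def by (rule span_gram_schmidt)
    finally have "M (g l) \<in> span (g ` {..Suc l})" .
    moreover have "orthogonal (g m) x" if "x \<in> g ` {..Suc l}" for x
      using that \<open>l + 1 < m\<close> \<open>m < CARD('n)\<close> by (auto simp: orthogonal_def orth)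
    ultimately have "orthogonal (g m) (M (g l))" using orthogonal_to_span by blast
    then show ?thesis by (simp add: orthogonal_def)
  qed
  have L: "isospectral \<mu> (lanczos \<mu> r w) $ a $ b = of_real (g (r a - 1) \<bullet> M (g (r b - 1)))" for a b
    by (simp add: isospectral_nth lanczos_def inner_vec_def g_def y_def M_def mult_ac)
  have "isospectral \<mu> (lanczos \<mu> r w) $ b $ a = 0" if "r a + 1 < r b" for a b
    unfolding L using band[of "r a - 1" "r b - 1"] that rk[of b] ranking_range[OF r, of a] by simp
  then have "tridiagonal r (isospectral \<mu> (lanczos \<mu> r w))"
    unfolding tridiagonal_def by (metis isospectral_hermitian_nth complex_cnj_zero_iff)
  then show ?thesis using U by (simp add: frames_def)
qed

lemma continuous_on_lanczos:
  fixes r :: "'n::finite \<Rightarrow> nat"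
  assumes r: "ranking r" and inj: "inj \<mu>"
  shows "continuous_on weights (lanczos \<mu> r)"
proof -
  have "continuous_on weights (\<lambda>w. gram_schmidt (krylov \<mu> w) (r a - 1))" for a
  proof (rule continuous_on_gram_schmidt[where N = "CARD('n)"])
    show "continuous_on weights (\<lambda>w. krylov \<mu> w k)" for k
      unfolding krylov_def by (intro continuous_intros)
    show "krylov \<mu> w k \<notin> span (krylov \<mu> w ` {..<k})" if "w \<in> weights" "k < CARD('n)" for w k
      using that by (intro krylov_independent[OF inj]) (auto simp: weights_def)
    show "r a - 1 < CARD('n)" using ranking_range[OF r, of a] by linarith
  qed
  then show ?thesis unfolding lanczos_def by (intro continuous_intros)
qed


section \<open>The mean ranks fill the permutohedron\<close>

definition mean_rank_vector :: "('n::finite \<Rightarrow> nat) \<Rightarrow> complex^'n^'n \<Rightarrow> real^'n" where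
  "mean_rank_vector r U = (\<chi> i. mean_rank r U i)"

text \<open>
  The interior of the convex hull of all permutations of \<open>(1, \<dots>, n)\<close>, relative to the hyperplane that
  contains it.
\<close>

definition open_permutohedron :: "(real^'n::finite) set" where
  "open_permutohedron = {p. (\<Sum>i\<in>UNIV. p $ i) = real CARD('n) * (real CARD('n) + 1) / 2 \<and>
     (\<forall>I. I \<noteq> {} \<longrightarrow> I \<noteq> UNIV \<longrightarrow> real (card I) * (real (card I) + 1) / 2 < (\<Sum>i\<in>I. p $ i))}"

lemma continuous_on_mean_rank_vector: "continuous_on S (mean_rank_vector r)"
  unfolding mean_rank_vector_def by (intro continuous_intros continuous_on_mean_rank)

text \<open>
  A tight inequality would make the first row of \<open>L\<close> orthogonal to some eigenvector, but the weights are
  positive.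
\<close>

lemma mean_rank_lanczos_in_open_permutohedron:
  fixes r :: "'n::finite \<Rightarrow> nat"
  assumes r: "ranking r" and inj: "inj \<mu>" and w: "w \<in> weights"
  shows "mean_rank_vector r (lanczos \<mu> r w) \<in> open_permutohedron"
proof -
  define U where "U = lanczos \<mu> r w"
  have U: "unitary_matrix U" using lanczos_frame[OF assms] by (simp add: U_def frames_def)
  obtain a where a: "r a = 1" using ranking_ex[OF r, of 1] by auto
  have "real (card I) * (real (card I) + 1) / 2 < (\<Sum>i\<in>I. mean_rank r U i)"
    if I: "I \<noteq> {}" "I \<noteq> UNIV" for I
  proof (rule ccontr)
    assume "\<not> ?thesis"
    then have b: "block_support r (card I) I U" using block_support_if_tight[OF r U] by simp
    obtain i where i: "i \<notin> I" using I by blast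
    have "card I \<noteq> 0" using I by simp
    then have "U $ i $ a = 0" using b i a by (force simp: block_support_def)
    moreover have "(cmod (U $ i $ a))\<^sup>2 = w $ i" unfolding U_def by (rule lanczos_first_column[of w r a \<mu> i, OF w a])
    ultimately show False using w by (simp add: weights_def) (metis less_irrefl)
  qed
  then show ?thesis
    using mean_rank_total[OF r U] by (simp add: open_permutohedron_def mean_rank_vector_def U_def)
qed

text \<open>
  Otherwise \<open>L\<close> splits before the first nonzero entry of eigenvector \<open>i\<close>, and a splitting makes an
  inequality tight.
\<close>

lemma first_column_nonzero:
  fixes r :: "'n::finite \<Rightarrow> nat"
  assumes r: "ranking r" and inj: "inj \<mu>" and U: "U \<in> frames \<mu> r"
    and int: "mean_rank_vector r U \<in> open_permutohedron" and a: "r a = 1"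
  shows "U $ i $ a \<noteq> 0"
proof -
  have U': "unitary_matrix U" using U by (simp add: frames_def)
  obtain b where f: "first_entry r U i b" using first_entry_exists[OF U'] by blast
  have rb: "r b \<ge> 1" "r b \<le> CARD('n)" using ranking_range[OF r] by auto
  have m: "r b - 1 \<le> CARD('n)" using rb by linarith
  obtain I where I: "block_support r (r b - 1) I U"
    using block_support_if_splits[OF U' inj splits_before_first_entry[OF r U f]] .
  have c: "card I = r b - 1" by (rule block_support_card[OF r U' I m])
  have t: "(\<Sum>i\<in>I. mean_rank r U i) = real (card I) * (real (card I) + 1) / 2"
    using tight_if_block_support[OF r U' I m] by (simp only: c)
  have "I \<noteq> UNIV" using c rb by auto
  moreover have "real (card I) * (real (card I) + 1) / 2 < (\<Sum>i\<in>I. mean_rank_vector r U $ i)"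
    if "I \<noteq> {}" "I \<noteq> UNIV"
    using int that unfolding open_permutohedron_def by blast
  ultimately have "I = {}" using t by (auto simp: mean_rank_vector_def)
  then have "r b = r a" using c rb a by simp
  then have "b = a" using ranking_inj[OF r] by (auto simp: inj_def)
  then show ?thesis using f by (simp add: first_entry_def)
qed

lemma convex_open_permutohedron: "convex (open_permutohedron :: (real^'n::finite) set)"
proof -
  have E: "open_permutohedron = {p :: real^'n. (\<Sum>i\<in>UNIV. p $ i) = real CARD('n) * (real CARD('n) + 1) / 2} \<inter>
     (\<Inter>I\<in>- {{}, UNIV}. {p. real (card I) * (real (card I) + 1) / 2 < (\<Sum>i\<in>I. p $ i)})"
    by (auto simp: open_permutohedron_def)
  have ind: "(\<Sum>i\<in>I. p $ i) = (\<chi> i. if i \<in> I then 1 else 0) \<bullet> p" for I and p :: "real^'n"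
    by (simp add: inner_vec_def if_distrib[of "\<lambda>x. x * _"] sum.If_cases cong: if_cong)
  have h1: "convex {p :: real^'n. (\<Sum>i\<in>I. p $ i) = c}" for I c
    unfolding ind by (rule convex_hyperplane)
  have h2: "convex {p :: real^'n. c < (\<Sum>i\<in>I. p $ i)}" for I c
    unfolding ind by (rule convex_halfspace_gt)
  show ?thesis unfolding E by (intro convex_Int convex_INT h1 h2)
qed

lemma inj_on_mean_rank_lanczos:
  fixes r :: "'n::finite \<Rightarrow> nat"
  assumes r: "ranking r" and inj: "inj \<mu>"
  shows "inj_on (\<lambda>w. mean_rank_vector r (lanczos \<mu> r w)) weights"
proof (rule inj_onI)
  fix v w :: "real^'n" assume vw: "v \<in> weights" "w \<in> weights"
    and eq: "mean_rank_vector r (lanczos \<mu> r v) = mean_rank_vector r (lanczos \<mu> r w)"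
  let ?V = "lanczos \<mu> r v" and ?W = "lanczos \<mu> r w"
  have fr: "?V \<in> frames \<mu> r" "?W \<in> frames \<mu> r" using lanczos_frame[OF r inj] vw by auto
  have "mean_rank r ?V i = mean_rank r ?W i" for i
    using eq by (simp add: mean_rank_vector_def vec_eq_iff)
  then have "torus_orbit (isospectral \<mu> ?V) = torus_orbit (isospectral \<mu> ?W)"
    by (rule torus_orbit_eq_if_mean_rank_eq[OF r inj fr])
  then have c: "cmod (?V $ i $ a) = cmod (?W $ i $ a)" for i a
    using cmod_eq_if_torus_orbit_eq[OF _ _ inj] fr by (simp add: frames_def)
  obtain a where a: "r a = 1" using ranking_ex[OF r, of 1] by auto
  have "v $ i = w $ i" for i
    using lanczos_first_column[of v r a \<mu> i, OF vw(1) a] lanczos_first_column[of w r a \<mu> i, OF vw(2) a] c[of i a]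
    by simp
  then show "v = w" by (simp add: vec_eq_iff)
qed

text \<open>
  The image of the weight simplex in the connected set \<open>S\<close> is open by invariance of domain.  It is
  closed because a limit of Lanczos frames with mean ranks in \<open>S\<close> has no zero in its first column, so
  its weights are again positive and it is itself a Lanczos frame.
\<close>

lemma open_permutohedron_filled:
  fixes r :: "'n::finite \<Rightarrow> nat" and p :: "real^'n"
  assumes r: "ranking r" and inj: "inj \<mu>" and p: "p \<in> open_permutohedron"
  shows "\<exists>w\<in>weights. mean_rank_vector r (lanczos \<mu> r w) = p"
proof -
  define f where "f w = mean_rank_vector r (lanczos \<mu> r w)" for w
  define S where "S = (open_permutohedron :: (real^'n) set)"
  \<comment> \<open>\<open>P c\<close> is the hyperplane of the permutohedron, \<open>P 1\<close> that of the weights\<close>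
  define c where "c = real CARD('n) * (real CARD('n) + 1) / 2"
  define P where "P s = {x :: real^'n. (\<Sum>i\<in>UNIV. x $ i) = s}" for s :: real
  obtain a where a: "r a = 1" using ranking_ex[OF r, of 1] by auto
  have fS: "f ` weights \<subseteq> S"
    using mean_rank_lanczos_in_open_permutohedron[OF r inj] by (auto simp: f_def S_def)
  have contl: "continuous_on weights (lanczos \<mu> r)" by (rule continuous_on_lanczos[OF r inj])
  have cont: "continuous_on weights f"
    unfolding f_def by (rule continuous_on_compose2[OF continuous_on_mean_rank_vector contl subset_refl])
  have affP: "affine (P s)" for s
  proof -
    have "P s = {x. (\<chi> i. 1) \<bullet> x = s}" by (simp add: P_def inner_vec_def)
    then show ?thesis using affine_hyperplane by simp
  qed
  have "P c = (+) (\<chi> i. (c - 1) / real CARD('n)) ` P 1"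
  proof (intro equalityI subsetI)
    fix x assume "x \<in> P c"
    then have "x - (\<chi> i. (c - 1) / real CARD('n)) \<in> P 1" by (simp add: P_def sum_subtractf)
    then show "x \<in> (+) (\<chi> i. (c - 1) / real CARD('n)) ` P 1" by (force simp: image_iff)
  next
    fix x assume "x \<in> (+) (\<chi> i. (c - 1) / real CARD('n)) ` P 1"
    then show "x \<in> P c" by (auto simp: P_def sum.distrib)
  qed
  then have dim: "aff_dim (P c) = aff_dim (P 1)" by (simp add: aff_dim_translation_eq)
  have op1: "openin (top_of_set (P 1)) weights"
  proof -
    have "weights = P 1 \<inter> (\<Inter>i. {w. 0 < w $ i})" by (auto simp: weights_def P_def)
    moreover have "open (\<Inter>i. {w :: real^'n. 0 < w $ i})"
      by (intro open_INT ballI open_Collect_less continuous_intros) auto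
    ultimately show ?thesis by (metis openin_open_Int)
  qed
  have SP: "S \<subseteq> P c" by (auto simp: S_def P_def open_permutohedron_def c_def)
  have "openin (top_of_set (P c)) (f ` weights)"
  proof (rule invariance_of_domain_affine_sets[OF op1 affP affP _ cont])
    show "f \<in> weights \<rightarrow> P c" using fS SP by blast
    show "inj_on f weights" unfolding f_def by (rule inj_on_mean_rank_lanczos[OF r inj])
  qed (simp add: dim)
  then have opS: "openin (top_of_set S) (f ` weights)"
    using openin_subset_trans fS SP by blast
  define K where "K = closure (lanczos \<mu> r ` weights)"
  have lf: "lanczos \<mu> r ` weights \<subseteq> frames \<mu> r" using lanczos_frame[OF r inj] by blast
  have KF: "K \<subseteq> frames \<mu> r"
    unfolding K_def using lf compact_frames compact_imp_closed closure_minimal by metis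
  have "compact K" unfolding K_def
    using compact_frames lf by (metis bounded_subset compact_closure compact_imp_bounded)
  then have "closed (mean_rank_vector r ` K)"
    by (intro compact_imp_closed compact_continuous_image continuous_on_mean_rank_vector)
  moreover have "f ` weights = S \<inter> mean_rank_vector r ` K"
  proof
    have "lanczos \<mu> r ` weights \<subseteq> K" unfolding K_def by (rule closure_subset)
    then show "f ` weights \<subseteq> S \<inter> mean_rank_vector r ` K" using fS by (auto simp: f_def)
    show "S \<inter> mean_rank_vector r ` K \<subseteq> f ` weights"
    proof clarify
      fix U assume "U \<in> K" and US: "mean_rank_vector r U \<in> S"
      obtain V where V: "\<And>k. V k \<in> lanczos \<mu> r ` weights" "V \<longlonglongrightarrow> U"
        using \<open>U \<in> K\<close> unfolding K_def closure_sequential by blast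
      have "\<forall>k. \<exists>v. v \<in> weights \<and> V k = lanczos \<mu> r v" using V(1) by blast
      then obtain v where v: "\<And>k. v k \<in> weights" "\<And>k. V k = lanczos \<mu> r (v k)"
        by metis
      define w where "w = (\<chi> i. (cmod (U $ i $ a))\<^sup>2)"
      have U: "U \<in> frames \<mu> r" using \<open>U \<in> K\<close> KF by blast
      have "w \<in> weights"
        using first_column_nonzero[OF r inj U US[unfolded S_def] a] U unitary_column_norm[of U a]
        by (simp add: weights_def w_def frames_def)
      \<comment> \<open>the first column converges, and on Lanczos frames it recovers the weights\<close>
      have vv: "v k = (\<chi> i. (cmod (V k $ i $ a))\<^sup>2)" for k
        using lanczos_first_column[of "v k" r a \<mu>, OF v(1) a] by (simp add: v(2) vec_eq_iff)
      have "(\<lambda>k. \<chi> i. (cmod (V k $ i $ a))\<^sup>2) \<longlonglongrightarrow> w"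
        unfolding w_def by (intro tendsto_intros V(2))
      moreover have "v = (\<lambda>k. \<chi> i. (cmod (V k $ i $ a))\<^sup>2)" using vv by (rule ext)
      ultimately have "v \<longlonglongrightarrow> w" by (simp only:)
      then have "(\<lambda>k. lanczos \<mu> r (v k)) \<longlonglongrightarrow> lanczos \<mu> r w"
        using v(1) by (intro continuous_on_tendsto_compose[OF contl _ \<open>w \<in> weights\<close>]) simp_all
      moreover have "V = (\<lambda>k. lanczos \<mu> r (v k))" using v(2) by (rule ext)
      ultimately have "V \<longlonglongrightarrow> lanczos \<mu> r w" by (simp only:)
      then have "U = lanczos \<mu> r w" using V(2) LIMSEQ_unique by blast
      then show "mean_rank_vector r U \<in> f ` weights" using \<open>w \<in> weights\<close> by (simp add: f_def)
    qed
  qed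
  ultimately have clS: "closedin (top_of_set S) (f ` weights)"
    by (metis closedin_closed_Int)
  have "connected S" unfolding S_def by (intro convex_connected convex_open_permutohedron)
  then have "f ` weights = {} \<or> f ` weights = S" using opS clS unfolding connected_clopen by blast
  moreover have "(\<chi> i. 1 / real CARD('n)) \<in> (weights :: (real^'n) set)" by (simp add: weights_def)
  ultimately have "f ` weights = S" by blast
  then have "p \<in> f ` weights" using p by (simp add: S_def)
  then show ?thesis by (auto simp: f_def)
qed

text \<open>
  A boundary point is approached along the segment to the centre; the frames form a compact set.
\<close>

theorem permutohedron_filled:
  fixes r :: "'n::finite \<Rightarrow> nat" and p :: "real^'n"
  assumes r: "ranking r" and inj: "inj \<mu>"
    and tot: "(\<Sum>i\<in>UNIV. p $ i) = real CARD('n) * (real CARD('n) + 1) / 2"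
    and ge: "\<And>I. real (card I) * (real (card I) + 1) / 2 \<le> (\<Sum>i\<in>I. p $ i)"
  shows "\<exists>U\<in>frames \<mu> r. mean_rank_vector r U = p"
proof -
  define q where "q = (\<chi> i::'n. (real CARD('n) + 1) / 2)"
  define t where "t k = inverse (real (Suc k))" for k
  define x where "x k = (1 - t k) *\<^sub>R p + t k *\<^sub>R q" for k
  have t: "0 < t k" "t k \<le> 1" for k by (auto simp: t_def field_simps)
  have "x k \<in> open_permutohedron" for k
  proof -
    have s: "(\<Sum>i\<in>I. x k $ i) = (1 - t k) * (\<Sum>i\<in>I. p $ i) + t k * (real (card I) * (real CARD('n) + 1) / 2)" for I
      by (simp add: x_def q_def sum.distrib sum_distrib_left)
    have "(\<Sum>i\<in>UNIV. x k $ i) = real CARD('n) * (real CARD('n) + 1) / 2"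
      unfolding s tot by (simp add: field_simps)
    moreover have "real (card I) * (real (card I) + 1) / 2 < (\<Sum>i\<in>I. x k $ i)" if "I \<noteq> {}" "I \<noteq> UNIV" for I
    proof -
      define e where "e = real (card I) * (real (card I) + 1) / 2"
      have "card I < CARD('n)" using that by (simp add: psubset_card_mono psubsetI)
      moreover have "0 < card I" using that by (simp add: card_gt_0_iff)
      ultimately have "e < real (card I) * (real CARD('n) + 1) / 2"
        unfolding e_def by (intro divide_strict_right_mono mult_strict_left_mono) auto
      then have "t k * e < t k * (real (card I) * (real CARD('n) + 1) / 2)"
        using t(1) by (rule mult_strict_left_mono)
      moreover have "(1 - t k) * e \<le> (1 - t k) * (\<Sum>i\<in>I. p $ i)"
        using ge[of I] t(2) by (intro mult_left_mono) (auto simp: e_def)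
      ultimately have "(1 - t k) * e + t k * e < (\<Sum>i\<in>I. x k $ i)" unfolding s by linarith
      moreover have "(1 - t k) * e + t k * e = e" by (simp add: algebra_simps)
      ultimately show ?thesis by (simp add: e_def)
    qed
    ultimately show ?thesis by (simp add: open_permutohedron_def)
  qed
  then have xk: "x k \<in> mean_rank_vector r ` frames \<mu> r" for k
    using open_permutohedron_filled[OF r inj] lanczos_frame[OF r inj] by (metis imageI)
  have "t \<longlonglongrightarrow> 0" unfolding t_def by (rule LIMSEQ_inverse_real_of_nat)
  then have "x \<longlonglongrightarrow> (1 - 0) *\<^sub>R p + 0 *\<^sub>R q" unfolding x_def by (intro tendsto_intros)
  then have "x \<longlonglongrightarrow> p" by simp
  moreover have "closed (mean_rank_vector r ` frames \<mu> r)"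
    by (intro compact_imp_closed compact_continuous_image continuous_on_mean_rank_vector compact_frames)
  ultimately have "p \<in> mean_rank_vector r ` frames \<mu> r" using xk closed_sequentially by blast
  then show ?thesis by blast
qed

section \<open>The lattices and the Voronoi cells in coordinates\<close>

lemma alpha_nth: "alpha i $ j = real CARD('n) * (if i = j then 1 else 0) - 1" for i j :: "'n::finite"
proof -
  have 1: "1 \<le> CARD('n)" by (simp add: Suc_leI)
  have 2: "(\<Sum>k\<in>UNIV - {i}. axis k (1::real) $ j) = (if i = j then 0 else 1)"
  proof -
    have "(\<Sum>k\<in>UNIV - {i}. axis k (1::real) $ j) = (\<Sum>k\<in>UNIV - {i}. if k = j then 1 else 0)"
      by (intro sum.cong) (auto simp: axis_def)
    then show ?thesis by (simp add: sum.delta)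
  qed
  have "alpha i $ j = real (CARD('n) - 1) * axis i 1 $ j - (\<Sum>k\<in>UNIV - {i}. axis k (1::real) $ j)"
    by (simp add: alpha_def)
  then show ?thesis unfolding 2 using 1 by (auto simp: axis_def of_nat_diff)
qed

text \<open>
  In the coordinates \<open>y\<close>, with \<open>lattice_point y = \<Sum> y\<^sub>i \<alpha>\<^sub>i\<close>, the lattice \<open>N\<close> is the image of
  \<open>\<int>\<^sup>n\<close>, with kernel spanned by \<open>(1, \<dots>, 1)\<close>.
\<close>

definition lattice_point :: "('n::finite \<Rightarrow> int) \<Rightarrow> real^'n" where
  "lattice_point y = (\<chi> i. real_of_int (int CARD('n) * y i - (\<Sum>j\<in>UNIV. y j)))"

lemma lattice_N_eq: "lattice_N = range (lattice_point :: ('n::finite \<Rightarrow> int) \<Rightarrow> real^'n)"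
proof
  show "lattice_N \<subseteq> range (lattice_point :: ('n \<Rightarrow> int) \<Rightarrow> real^'n)"
  proof
    fix x :: "real^'n" assume "x \<in> lattice_N"
    then obtain z where x: "x = (\<chi> i. of_int (z i))" and z: "(\<Sum>i\<in>UNIV. z i) = 0"
        "\<And>i j. z i mod int CARD('n) = z j mod int CARD('n)"
      unfolding lattice_N_def by blast
    fix i0 :: 'n
    define y where "y i = (z i - z i0) div int CARD('n)" for i
    have "int CARD('n) dvd z i - z i0" for i using z(2) by (simp add: mod_eq_dvd_iff)
    then have y: "z i = int CARD('n) * y i + z i0" for i by (simp add: y_def)
    have "(\<Sum>i\<in>UNIV. z i) = (\<Sum>i\<in>UNIV. int CARD('n) * y i + z i0)" by (rule sum.cong[OF refl y])
    then have "0 = int CARD('n) * (\<Sum>j\<in>UNIV. y j) + int CARD('n) * z i0"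
      unfolding z(1) by (simp add: sum.distrib sum_distrib_left)
    then have "int CARD('n) * (z i0 + (\<Sum>j\<in>UNIV. y j)) = 0" by (simp add: algebra_simps)
    then have "z i0 = - (\<Sum>j\<in>UNIV. y j)" by simp
    then have "z i = int CARD('n) * y i - (\<Sum>j\<in>UNIV. y j)" for i using y[of i] by linarith
    then have "x = lattice_point y" by (simp add: x lattice_point_def)
    then show "x \<in> range lattice_point" by blast
  qed
  show "range (lattice_point :: ('n \<Rightarrow> int) \<Rightarrow> real^'n) \<subseteq> lattice_N"
  proof clarify
    fix y :: "'n \<Rightarrow> int"
    define z where "z i = int CARD('n) * y i - (\<Sum>j\<in>UNIV. y j)" for i
    have "(\<Sum>i\<in>UNIV. z i) = 0" by (simp add: z_def sum_subtractf flip: sum_distrib_left)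
    moreover have "z i mod int CARD('n) = z j mod int CARD('n)" for i j
      by (simp add: mod_eq_dvd_iff z_def flip: right_diff_distrib)
    moreover have "lattice_point y = (\<chi> i. of_int (z i))"
      by (simp add: lattice_point_def z_def vec_eq_iff)
    ultimately show "lattice_point y \<in> lattice_N" unfolding lattice_N_def by blast
  qed
qed

lemma lattice_point_diff: "lattice_point y - lattice_point z = lattice_point (\<lambda>i. y i - z i)"
  by (simp add: lattice_point_def vec_eq_iff sum_subtractf algebra_simps)

lemma lattice_point_add: "lattice_point y + lattice_point z = lattice_point (\<lambda>i. y i + z i)"
  by (simp add: lattice_point_def vec_eq_iff sum.distrib algebra_simps)

lemma lattice_N_diff: "v \<in> lattice_N \<Longrightarrow> w \<in> lattice_N \<Longrightarrow> v - w \<in> lattice_N"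
  by (auto simp: lattice_N_eq lattice_point_diff)

lemma lattice_N_add: "v \<in> lattice_N \<Longrightarrow> w \<in> lattice_N \<Longrightarrow> v + w \<in> lattice_N"
  by (auto simp: lattice_N_eq lattice_point_add)

lemma scaled_alpha: "real k *\<^sub>R alpha a = lattice_point (\<lambda>i. if i = a then int k else 0)"
  by (simp add: vec_eq_iff alpha_nth lattice_point_def sum.delta' algebra_simps)

lemma scaled_alpha_in_lattice_N: "real k *\<^sub>R alpha a \<in> lattice_N"
  by (simp add: scaled_alpha lattice_N_eq)

lemma alpha_in_lattice_N: "alpha a \<in> lattice_N"
  using scaled_alpha_in_lattice_N[of 1] by simp

lemma N_real_eq: "N_real = {x :: real^'n::finite. (\<Sum>i\<in>UNIV. x $ i) = 0}"
proof
  have "subspace {x :: real^'n. (\<Sum>i\<in>UNIV. x $ i) = 0}"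
    by (simp add: subspace_def sum.distrib flip: sum_distrib_left)
  moreover have "lattice_N \<subseteq> {x :: real^'n. (\<Sum>i\<in>UNIV. x $ i) = 0}"
    by (auto simp: lattice_N_def simp flip: of_int_sum)
  ultimately show "N_real \<subseteq> {x :: real^'n. (\<Sum>i\<in>UNIV. x $ i) = 0}"
    unfolding N_real_def by (rule span_minimal[rotated])
  show "{x :: real^'n. (\<Sum>i\<in>UNIV. x $ i) = 0} \<subseteq> N_real"
  proof clarify
    fix x :: "real^'n" assume x: "(\<Sum>i\<in>UNIV. x $ i) = 0"
    have "(\<Sum>i\<in>UNIV. (x $ i / real CARD('n)) *\<^sub>R alpha i) $ j = x $ j" for j
    proof -
      have "(\<Sum>i\<in>UNIV. (x $ i / real CARD('n)) *\<^sub>R alpha i) $ j =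
          (\<Sum>i\<in>UNIV. (if i = j then x $ i else 0) - x $ i / real CARD('n))"
        by (auto simp: alpha_nth algebra_simps intro!: sum.cong)
      also have "\<dots> = x $ j" by (simp add: sum_subtractf x flip: sum_divide_distrib)
      finally show ?thesis .
    qed
    then have "x = (\<Sum>i\<in>UNIV. (x $ i / real CARD('n)) *\<^sub>R alpha i)" by (simp add: vec_eq_iff)
    also have "\<dots> \<in> span lattice_N"
      by (intro span_sum span_scale span_base alpha_in_lattice_N)
    finally show "x \<in> N_real" by (simp add: N_real_def)
  qed
qed

lemma subspace_N_real: "subspace N_real"
  by (simp add: N_real_def)

lemma lattice_N_subset_N_real: "lattice_N \<subseteq> N_real"
  by (auto simp: N_real_def intro: span_base)

text \<open>
  The lattice \<open>N'\<close> is \<open>n\<close> times the root lattice of type \<open>A\<close>.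
\<close>

definition root_point :: "('n::finite \<Rightarrow> int) \<Rightarrow> real^'n" where
  "root_point z = (\<chi> i. real CARD('n) * of_int (z i))"

lemma group_closure_sum: "(\<And>i. i \<in> A \<Longrightarrow> f i \<in> group_closure S) \<Longrightarrow> sum f A \<in> group_closure S"
  by (induction A rule: infinite_finite_induct) (auto intro: group_closure_add)

lemma group_closure_int_scale:
  fixes x :: "'a::real_vector"
  assumes "x \<in> group_closure S"
  shows "of_int k *\<^sub>R x \<in> group_closure S"
proof -
  have n: "real m *\<^sub>R x \<in> group_closure S" for m
    by (induction m) (auto simp: algebra_simps intro: group_closure_add assms)
  show ?thesis
  proof (cases k)
    case (nonneg m)
    then show ?thesis using n by simp
  next
    case (neg m)
    have "- (real (Suc m) *\<^sub>R x) \<in> group_closure S" using n[of "Suc m"] by (simp only: group_closure_minus_iff)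
    moreover have "of_int k *\<^sub>R x = - (real (Suc m) *\<^sub>R x)" by (simp add: neg algebra_simps)
    ultimately show ?thesis by simp
  qed
qed

lemma lattice_N'_eq:
  fixes ix :: "nat \<Rightarrow> 'n::finite"
  assumes ix: "bij_betw ix {1..CARD('n)} UNIV"
  shows "lattice_N' ix = {root_point z | z. (\<Sum>i\<in>UNIV. z i) = 0}"
proof -
  define d :: "'n \<Rightarrow> 'n \<Rightarrow> int" where "d a i = (if i = a then 1 else 0)" for a i
  define G where "G = {alpha (ix k) - alpha (ix (k + 1)) | k. k \<in> {1..<CARD('n)}}"
  have dsum: "(\<Sum>i\<in>UNIV. d a i) = 1" for a by (simp add: d_def)
  have al: "alpha a - alpha b = root_point (\<lambda>i. d a i - d b i)" for a b
    by (auto simp: vec_eq_iff alpha_nth root_point_def d_def)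
  have add: "root_point y + root_point z = root_point (\<lambda>i. y i + z i)"
    and diff: "root_point y - root_point z = root_point (\<lambda>i. y i - z i)"
    for y z :: "'n \<Rightarrow> int" by (simp_all add: root_point_def vec_eq_iff algebra_simps)
  have L: "lattice_N' ix = group_closure G" by (simp add: lattice_N'_def G_def)
  show ?thesis
  proof (intro equalityI subsetI)
    fix x assume "x \<in> lattice_N' ix"
    then have "x \<in> group_closure G" by (simp add: L)
    then show "x \<in> {root_point z | z. (\<Sum>i\<in>UNIV. z i) = 0}"
    proof induction
      case (base s)
      then consider "s = 0" | k where "s = alpha (ix k) - alpha (ix (k + 1))" by (auto simp: G_def)
      then show ?case
      proof cases
        case 1
        then have "s = root_point (\<lambda>i. 0)" by (simp add: root_point_def vec_eq_iff)
        then show ?thesis by (auto intro!: exI[of _ "\<lambda>i. 0"])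
      next
        case 2
        then have "s = root_point (\<lambda>i. d (ix k) i - d (ix (k + 1)) i)" by (simp add: al)
        moreover have "(\<Sum>i\<in>UNIV. d (ix k) i - d (ix (k + 1)) i) = 0" by (simp add: sum_subtractf dsum)
        ultimately show ?thesis by blast
      qed
    next
      case (diff s t)
      then obtain y z where "s = root_point y" "t = root_point z"
          "(\<Sum>i\<in>UNIV. y i) = 0" "(\<Sum>i\<in>UNIV. z i) = 0" by blast
      then have "s - t = root_point (\<lambda>i. y i - z i)" "(\<Sum>i\<in>UNIV. y i - z i) = 0"
        by (simp_all add: sum_subtractf \<open>\<And>y z. root_point y - root_point z = _\<close>)
      then show ?case by blast
    qed
  next
    fix x :: "real^'n" assume "x \<in> {root_point z | z. (\<Sum>i\<in>UNIV. z i) = 0}"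
    then obtain z where x: "x = root_point z" and z: "(\<Sum>i\<in>UNIV. z i) = 0" by blast
    have chain: "1 \<le> k \<Longrightarrow> k \<le> CARD('n) \<Longrightarrow> alpha (ix 1) - alpha (ix k) \<in> group_closure G" for k
    proof (induction k)
      case (Suc k)
      show ?case
      proof (cases "k = 0")
        case False
        have "alpha (ix k) - alpha (ix (k + 1)) \<in> group_closure G"
          using Suc.prems False by (intro group_closure.base) (auto simp: G_def)
        moreover have "alpha (ix 1) - alpha (ix k) \<in> group_closure G" using Suc False by simp
        ultimately have "(alpha (ix 1) - alpha (ix k)) + (alpha (ix k) - alpha (ix (k + 1))) \<in> group_closure G"
          by (rule group_closure_add[rotated])
        then show ?thesis by simp
      qed simp
    qed simp
    have "alpha a - alpha (ix 1) \<in> group_closure G" for a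
    proof -
      have "a \<in> ix ` {1..CARD('n)}" using ix by (simp add: bij_betw_def)
      then obtain k where "k \<in> {1..CARD('n)}" "a = ix k" by blast
      then have "- (alpha (ix 1) - alpha a) \<in> group_closure G"
        using chain[of k] by (simp only: group_closure_minus_iff) simp
      then show ?thesis by simp
    qed
    then have "(\<Sum>a\<in>UNIV. of_int (z a) *\<^sub>R (alpha a - alpha (ix 1))) \<in> group_closure G"
      by (intro group_closure_sum group_closure_int_scale)
    moreover have "(\<Sum>a\<in>UNIV. of_int (z a) *\<^sub>R (alpha a - alpha (ix 1))) = x"
    proof -
      have "(\<Sum>a\<in>UNIV. of_int (z a) *\<^sub>R (alpha a - alpha (ix 1))) $ i = x $ i" for i
      proof -
        have "(\<Sum>a\<in>UNIV. of_int (z a) *\<^sub>R (alpha a - alpha (ix 1))) $ i =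
            (\<Sum>a\<in>UNIV. (if a = i then real CARD('n) * of_int (z a) else 0)) -
            real CARD('n) * (if ix 1 = i then 1 else 0) * (\<Sum>a\<in>UNIV. of_int (z a))"
          unfolding sum_distrib_left sum_component sum_subtractf[symmetric]
          by (intro sum.cong) (auto simp: alpha_nth algebra_simps)
        also have "(\<Sum>a\<in>UNIV. real_of_int (z a)) = 0" using z by (simp flip: of_int_sum)
        finally show ?thesis by (simp add: x root_point_def)
      qed
      then show ?thesis by (simp add: vec_eq_iff)
    qed
    ultimately show "x \<in> lattice_N' ix" by (simp add: L)
  qed
qed

lemma voronoi_cell_translate:
  fixes v x :: "real^'n::finite"
  assumes v: "v \<in> lattice_N"
  shows "x \<in> voronoi_cell v \<longleftrightarrow> x - v \<in> voronoi_cell 0"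
proof -
  have "x \<in> N_real \<longleftrightarrow> x - v \<in> N_real"
    using v lattice_N_subset_N_real subspace_N_real
    by (metis diff_add_cancel subsetD subspace_add subspace_diff)
  moreover have "(\<forall>w\<in>lattice_N. w \<noteq> v \<longrightarrow> dist x v \<le> dist x w) \<longleftrightarrow>
      (\<forall>w\<in>lattice_N. w \<noteq> 0 \<longrightarrow> dist (x - v) 0 \<le> dist (x - v) w)"
  proof (intro iffI ballI impI)
    fix w :: "real^'n" assume *: "\<forall>w\<in>lattice_N. w \<noteq> v \<longrightarrow> dist x v \<le> dist x w" "w \<in> lattice_N" "w \<noteq> 0"
    then have "dist x v \<le> dist x (w + v)" using lattice_N_add[OF _ v] by simp
    then show "dist (x - v) 0 \<le> dist (x - v) w" by (simp add: dist_norm algebra_simps)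
  next
    fix w :: "real^'n" assume *: "\<forall>w\<in>lattice_N. w \<noteq> 0 \<longrightarrow> dist (x - v) 0 \<le> dist (x - v) w" "w \<in> lattice_N" "w \<noteq> v"
    then have "dist (x - v) 0 \<le> dist (x - v) (w - v)" using lattice_N_diff[OF _ v] by simp
    then show "dist x v \<le> dist x w" by (simp add: dist_norm)
  qed
  ultimately show ?thesis by (simp add: voronoi_cell_def)
qed

text \<open>
  The Voronoi inequality for the lattice point with coordinates \<open>y\<close>.  Lowering the maximal entries of
  \<open>y\<close> by one changes both sides by amounts which are compared through the inequality for the set \<open>I\<close>
  of maximal positions; after finitely many steps \<open>y\<close> is constant and both sides vanish.
\<close>

lemma permutohedron_quadratic_bound:
  fixes x :: "real^'n::finite" and y :: "'n \<Rightarrow> int"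
  assumes x0: "(\<Sum>i\<in>UNIV. x $ i) = 0"
    and le: "\<And>I. (\<Sum>i\<in>I. x $ i) \<le> real (card I) * (real CARD('n) - real (card I)) / 2"
    and range: "\<And>i. m \<le> y i \<and> y i \<le> m + int k"
  shows "2 * (\<Sum>i\<in>UNIV. x $ i * of_int (y i)) \<le>
    real CARD('n) * (\<Sum>i\<in>UNIV. (of_int (y i))\<^sup>2) - (\<Sum>i\<in>UNIV. of_int (y i))\<^sup>2"
  using range
proof (induction k arbitrary: y)
  case 0
  then have "y i = m" for i by (simp add: order_antisym)
  then show ?case by (simp add: x0 power2_eq_square flip: sum_distrib_right)
next
  case (Suc k)
  define M where "M = m + int (Suc k)"
  define I where "I = {i. y i = M}"
  define z where "z i = (if i \<in> I then y i - 1 else y i)" for i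
  define n where "n = real CARD('n)"
  define c where "c = real (card I)"
  have "m \<le> z i \<and> z i \<le> m + int k" for i
    using Suc.prems[of i] by (auto simp: z_def I_def M_def)
  from Suc.IH[OF this] have IH: "2 * (\<Sum>i\<in>UNIV. x $ i * of_int (z i)) \<le>
    n * (\<Sum>i\<in>UNIV. (of_int (z i))\<^sup>2) - (\<Sum>i\<in>UNIV. of_int (z i))\<^sup>2" by (simp add: n_def)
  have ind: "(\<Sum>i\<in>UNIV. if i \<in> I then f i else 0) = sum f I" for f :: "'n \<Rightarrow> real"
    by (simp add: sum.If_cases)
  have e1: "(\<Sum>i\<in>UNIV. x $ i * of_int (z i)) = (\<Sum>i\<in>UNIV. x $ i * of_int (y i)) - (\<Sum>i\<in>I. x $ i)"
    unfolding ind[symmetric] sum_subtractf[symmetric]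
    by (intro sum.cong) (auto simp: z_def algebra_simps)
  have e2: "(\<Sum>i\<in>UNIV. (real_of_int (z i))\<^sup>2) = (\<Sum>i\<in>UNIV. (of_int (y i))\<^sup>2) - c * (2 * of_int M - 1)"
  proof -
    have "c * (2 * of_int M - 1) = (\<Sum>i\<in>I. 2 * of_int M - 1)" by (simp add: c_def)
    then show ?thesis
      unfolding ind[of "\<lambda>_. 2 * of_int M - 1", symmetric] by (simp only: sum_subtractf[symmetric])
        (intro sum.cong, auto simp: z_def I_def power2_eq_square algebra_simps)
  qed
  have e3: "(\<Sum>i\<in>UNIV. real_of_int (z i)) = (\<Sum>i\<in>UNIV. of_int (y i)) - c"
  proof -
    have "c = (\<Sum>i\<in>I. 1)" by (simp add: c_def)
    then show ?thesis
      unfolding ind[of "\<lambda>_. 1", symmetric] by (simp only: sum_subtractf[symmetric])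
        (intro sum.cong, auto simp: z_def)
  qed
  define s where "s = (\<Sum>i\<in>UNIV. real_of_int (y i))"
  have "s \<le> (\<Sum>i\<in>UNIV. (of_int M - 1) + (if i \<in> I then 1 else 0))"
    unfolding s_def
  proof (rule sum_mono)
    fix i
    have "i \<in> I \<or> y i \<le> M - 1" using Suc.prems[of i] by (auto simp: I_def M_def)
    then have "y i \<le> M - 1 + (if i \<in> I then 1 else 0)" by (auto simp: I_def)
    then have "real_of_int (y i) \<le> real_of_int (M - 1 + (if i \<in> I then 1 else 0))" by (simp only: of_int_le_iff)
    then show "real_of_int (y i) \<le> of_int M - 1 + (if i \<in> I then 1 else 0)" by (simp split: if_splits)
  qed
  also have "\<dots> = n * (of_int M - 1) + c"
    unfolding sum.distrib ind by (simp add: n_def c_def)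
  finally have "c * s \<le> c * (n * (of_int M - 1) + c)" by (intro mult_left_mono) (auto simp: c_def)
  moreover have "(\<Sum>i\<in>I. x $ i) \<le> c * (n - c) / 2" using le[of I] by (simp add: c_def n_def)
  moreover have step: "2 * A \<le> n * Q - s\<^sup>2"
    if "2 * (A - B) \<le> n * (Q - c * (2 * t - 1)) - (s - c)\<^sup>2" "c * s \<le> c * (n * (t - 1) + c)"
      "B \<le> c * (n - c) / 2" for A B Q t :: real
    using that by (simp add: power2_eq_square algebra_simps)
  ultimately show ?case
    using IH unfolding e1 e2 e3 s_def[symmetric] n_def[symmetric] by blast
qed

lemma inner_lattice_point:
  fixes x :: "real^'n::finite"
  shows "x \<bullet> lattice_point y = real CARD('n) * (\<Sum>i\<in>UNIV. x $ i * of_int (y i)) -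
     (\<Sum>i\<in>UNIV. x $ i) * (\<Sum>i\<in>UNIV. of_int (y i))"
proof -
  define s where "s = (\<Sum>i\<in>UNIV. real_of_int (y i))"
  have "x \<bullet> lattice_point y = (\<Sum>i\<in>UNIV. real CARD('n) * (x $ i * of_int (y i)) - x $ i * s)"
    by (simp add: inner_vec_def lattice_point_def s_def algebra_simps)
  then show ?thesis
    by (simp only: sum_subtractf sum_distrib_left[symmetric] sum_distrib_right[symmetric] s_def)
qed

lemma norm_lattice_point:
  fixes y :: "'n::finite \<Rightarrow> int"
  shows "lattice_point y \<bullet> lattice_point y = real CARD('n) *
     (real CARD('n) * (\<Sum>i\<in>UNIV. (of_int (y i))\<^sup>2) - (\<Sum>i\<in>UNIV. of_int (y i))\<^sup>2)"
proof -
  have "lattice_point y \<in> N_real" using lattice_N_subset_N_real lattice_N_eq by blast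
  then have z: "(\<Sum>i\<in>UNIV. lattice_point y $ i) = 0" by (simp add: N_real_eq)
  define s where "s = (\<Sum>i\<in>UNIV. real_of_int (y i))"
  have "(\<Sum>i\<in>UNIV. lattice_point y $ i * of_int (y i)) =
      (\<Sum>i\<in>UNIV. real CARD('n) * (of_int (y i))\<^sup>2 - s * of_int (y i))"
    by (simp add: lattice_point_def s_def power2_eq_square algebra_simps)
  also have "\<dots> = real CARD('n) * (\<Sum>i\<in>UNIV. (of_int (y i))\<^sup>2) - s\<^sup>2"
    unfolding sum_subtractf sum_distrib_left[symmetric] s_def[symmetric] by (simp add: power2_eq_square)
  finally show ?thesis unfolding inner_lattice_point z s_def[symmetric] by simp
qed

text \<open>
  For \<open>y\<close> the indicator of \<open>I\<close> the Voronoi inequality is the permutohedron inequality for \<open>I\<close>; these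
  special lattice points suffice by \<open>permutohedron_quadratic_bound\<close>.
\<close>

lemma voronoi_cell_0_iff:
  fixes x :: "real^'n::finite"
  shows "x \<in> voronoi_cell 0 \<longleftrightarrow> (\<Sum>i\<in>UNIV. x $ i) = 0 \<and>
    (\<forall>I. (\<Sum>i\<in>I. x $ i) \<le> real (card I) * (real CARD('n) - real (card I)) / 2)"
proof -
  have d: "dist x 0 \<le> dist x w \<longleftrightarrow> 2 * (x \<bullet> w) \<le> w \<bullet> w" for w
  proof -
    have "dist x 0 \<le> dist x w \<longleftrightarrow> (norm x)\<^sup>2 \<le> (norm (x - w))\<^sup>2" by (simp add: dist_norm)
    then show ?thesis by (simp add: power2_norm_eq_inner inner_diff inner_commute[of w x])
  qed
  have "x \<in> voronoi_cell 0 \<longleftrightarrow> (\<Sum>i\<in>UNIV. x $ i) = 0 \<and> (\<forall>w\<in>lattice_N. 2 * (x \<bullet> w) \<le> w \<bullet> w)"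
    unfolding voronoi_cell_def N_real_eq mem_Collect_eq d by auto
  also have "\<dots> \<longleftrightarrow> (\<Sum>i\<in>UNIV. x $ i) = 0 \<and> (\<forall>y::'n \<Rightarrow> int. 2 * (\<Sum>i\<in>UNIV. x $ i * of_int (y i)) \<le>
      real CARD('n) * (\<Sum>i\<in>UNIV. (of_int (y i))\<^sup>2) - (\<Sum>i\<in>UNIV. of_int (y i))\<^sup>2)"
    (is "_ \<longleftrightarrow> _ \<and> ?B")
  proof -
    have "2 * (x \<bullet> lattice_point y) \<le> lattice_point y \<bullet> lattice_point y \<longleftrightarrow> 2 * (\<Sum>i\<in>UNIV. x $ i * of_int (y i)) \<le>
      real CARD('n) * (\<Sum>i\<in>UNIV. (of_int (y i))\<^sup>2) - (\<Sum>i\<in>UNIV. of_int (y i))\<^sup>2"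
      if "(\<Sum>i\<in>UNIV. x $ i) = 0" for y
    proof -
      have "2 * (x \<bullet> lattice_point y) = real CARD('n) * (2 * (\<Sum>i\<in>UNIV. x $ i * of_int (y i)))"
        by (simp add: inner_lattice_point that)
      then show ?thesis unfolding norm_lattice_point by (simp only: mult_le_cancel_left_pos of_nat_0_less_iff zero_less_card_finite)
    qed
    then show ?thesis unfolding lattice_N_eq by auto
  qed
  also have "\<dots> \<longleftrightarrow> (\<Sum>i\<in>UNIV. x $ i) = 0 \<and>
    (\<forall>I. (\<Sum>i\<in>I. x $ i) \<le> real (card I) * (real CARD('n) - real (card I)) / 2)"
  proof (intro conj_cong refl iffI allI)
    fix I :: "'n set" assume *: ?B
    show "(\<Sum>i\<in>I. x $ i) \<le> real (card I) * (real CARD('n) - real (card I)) / 2"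
      using *[rule_format, of "\<lambda>i. if i \<in> I then 1 else 0"]
      by (simp add: if_distrib[of "\<lambda>z. _ * z"] if_distrib[of real_of_int] if_distrib[of "\<lambda>z. z\<^sup>2"]
          sum.If_cases power2_eq_square algebra_simps cong: if_cong)
  next
    fix y :: "'n \<Rightarrow> int"
    assume x0: "(\<Sum>i\<in>UNIV. x $ i) = 0"
      and le: "\<forall>I. (\<Sum>i\<in>I. x $ i) \<le> real (card I) * (real CARD('n) - real (card I)) / 2"
    define m where "m = Min (range y)"
    have "m \<le> y i \<and> y i \<le> m + int (nat (Max (range y) - m))" for i
      by (simp add: m_def)
    then show "2 * (\<Sum>i\<in>UNIV. x $ i * of_int (y i)) \<le>
      real CARD('n) * (\<Sum>i\<in>UNIV. (of_int (y i))\<^sup>2) - (\<Sum>i\<in>UNIV. of_int (y i))\<^sup>2"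
      using permutohedron_quadratic_bound[OF x0] le by blast
  qed
  finally show ?thesis .
qed

lemma voronoi_cell_0_symmetric:
  fixes x :: "real^'n::finite"
  assumes "x \<in> voronoi_cell 0"
  shows "- x \<in> voronoi_cell 0"
proof -
  have x: "(\<Sum>i\<in>UNIV. x $ i) = 0"
      "\<And>I. (\<Sum>i\<in>I. x $ i) \<le> real (card I) * (real CARD('n) - real (card I)) / 2"
    using assms by (auto simp: voronoi_cell_0_iff)
  have "(\<Sum>i\<in>I. - x $ i) \<le> real (card I) * (real CARD('n) - real (card I)) / 2" for I
  proof -
    have "(\<Sum>i\<in>UNIV. x $ i) = (\<Sum>i\<in>- I. x $ i) + (\<Sum>i\<in>I. x $ i)"
      by (simp add: sum.subset_diff[of I UNIV] Compl_eq_Diff_UNIV)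
    moreover have "real (card (- I)) = real CARD('n) - real (card I)"
      by (simp add: Compl_eq_Diff_UNIV card_Diff_subset of_nat_diff card_mono)
    ultimately show ?thesis using x(1) x(2)[of "- I"] by (simp add: sum_negf mult.commute)
  qed
  then show ?thesis using x(1) by (simp add: voronoi_cell_0_iff sum_negf)
qed

lemma convex_voronoi_cell: "convex (voronoi_cell (v :: real^'n::finite))"
proof -
  have E: "voronoi_cell v = N_real \<inter> (\<Inter>w\<in>{w \<in> lattice_N. w \<noteq> v}. {x. 2 * ((w - v) \<bullet> x) \<le> w \<bullet> w - v \<bullet> v})"
  proof -
    have "dist x v \<le> dist x w \<longleftrightarrow> 2 * ((w - v) \<bullet> x) \<le> w \<bullet> w - v \<bullet> v" for x w
    proof -
      have "dist x v \<le> dist x w \<longleftrightarrow> (norm (x - v))\<^sup>2 \<le> (norm (x - w))\<^sup>2" by (simp add: dist_norm)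
      then show ?thesis
        by (simp add: power2_norm_eq_inner inner_diff inner_commute[of w x] inner_commute[of v x] algebra_simps)
    qed
    then show ?thesis unfolding voronoi_cell_def by auto
  qed
  have H: "convex {x :: real^'n. 2 * (a \<bullet> x) \<le> b}" for a b
    using convex_halfspace_le[of "2 *\<^sub>R a" b] by simp
  show ?thesis
    unfolding E by (intro convex_Int convex_INT subspace_imp_convex[OF subspace_N_real] H)
qed

lemma closed_lattice_N: "closed (lattice_N :: (real^'n::finite) set)"
proof (rule discrete_imp_closed[of 1]; clarsimp)
  fix x y :: "real^'n" assume "x \<in> lattice_N" "y \<in> lattice_N" "dist y x < 1"
  then obtain u v where uv: "x = (\<chi> i. of_int (u i))" "y = (\<chi> i. of_int (v i))"
    by (auto simp: lattice_N_def)
  have "v i = u i" for i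
  proof -
    have "\<bar>(y - x) $ i\<bar> < 1"
      using component_le_norm_cart[of "y - x" i] \<open>dist y x < 1\<close> by (simp add: dist_norm)
    then show ?thesis by (simp add: uv flip: of_int_diff)
  qed
  then show "y = x" by (simp add: uv vec_eq_iff)
qed

lemma voronoi_cells_cover:
  assumes "x \<in> N_real"
  obtains w where "w \<in> lattice_N" "x \<in> voronoi_cell w"
proof -
  have "lattice_N \<noteq> ({} :: (real^'a) set)" using alpha_in_lattice_N by blast
  then obtain w where "w \<in> lattice_N" "\<And>y. y \<in> lattice_N \<Longrightarrow> dist x w \<le> dist x y"
    using distance_attains_inf[OF closed_lattice_N] by blast
  then show ?thesis using assms that by (auto simp: voronoi_cell_def)
qed

section \<open>The torus and its maximal cells\<close>

lemma lattice_N'_group: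
  "0 \<in> lattice_N' ix"
  "x \<in> lattice_N' ix \<Longrightarrow> y \<in> lattice_N' ix \<Longrightarrow> x - y \<in> lattice_N' ix"
  "x \<in> lattice_N' ix \<Longrightarrow> y \<in> lattice_N' ix \<Longrightarrow> x + y \<in> lattice_N' ix"
  "x \<in> lattice_N' ix \<Longrightarrow> - x \<in> lattice_N' ix"
  by (simp_all add: lattice_N'_def group_closure.diff group_closure_add)

lemma torus_class_eq_iff: "torus_class ix x = torus_class ix y \<longleftrightarrow> x - y \<in> lattice_N' ix"
proof
  assume eq: "torus_class ix x = torus_class ix y"
  have "x + 0 \<in> torus_class ix x" unfolding torus_class_def using lattice_N'_group(1) by blast
  then obtain v where "v \<in> lattice_N' ix" "x = y + v" using eq by (auto simp: torus_class_def)
  then show "x - y \<in> lattice_N' ix" by simp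
next
  have sub: "torus_class ix x \<subseteq> torus_class ix y" if "x - y \<in> lattice_N' ix" for x y
  proof
    fix u assume "u \<in> torus_class ix x"
    then obtain v where v: "v \<in> lattice_N' ix" "u = x + v" by (auto simp: torus_class_def)
    have "u = y + ((x - y) + v)" using v by simp
    moreover have "(x - y) + v \<in> lattice_N' ix" using lattice_N'_group(3)[OF that v(1)] .
    ultimately show "u \<in> torus_class ix y" unfolding torus_class_def by (rule image_eqI)
  qed
  assume d: "x - y \<in> lattice_N' ix"
  then have "y - x \<in> lattice_N' ix" using lattice_N'_group(4)[OF d] by simp
  then show "torus_class ix x = torus_class ix y" using sub d by blast
qed

lemma lattice_N'_subset:
  fixes ix :: "nat \<Rightarrow> 'n::finite"
  assumes "bij_betw ix {1..CARD('n)} UNIV"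
  shows "lattice_N' ix \<subseteq> lattice_N"
proof
  fix x assume "x \<in> lattice_N' ix"
  then obtain z where "x = root_point z" "(\<Sum>i\<in>UNIV. z i) = 0"
    by (auto simp: lattice_N'_eq[OF assms])
  then have "x = lattice_point z" by (simp add: root_point_def lattice_point_def)
  then show "x \<in> lattice_N" by (simp add: lattice_N_eq)
qed

lemma cis_eq_iff: "cis s = cis t \<longleftrightarrow> (\<exists>k::int. s = t + 2 * pi * of_int k)"
  by (auto simp: complex_eq_iff sin_cos_eq_iff[symmetric] mult.commute mult.left_commute)
    (metis sin_cos_eq_iff mult.assoc mult.commute)+

lemma lattice_N'_iff_cis:
  fixes ix :: "nat \<Rightarrow> 'n::finite" and x y :: "real^'n"
  assumes ix: "bij_betw ix {1..CARD('n)} UNIV" and xy: "x \<in> N_real" "y \<in> N_real"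
  shows "x - y \<in> lattice_N' ix \<longleftrightarrow>
    (\<forall>i. cis (2 * pi * (x $ i / real CARD('n))) = cis (2 * pi * (y $ i / real CARD('n))))"
proof -
  have n: "real CARD('n) > 0" by simp
  have 1: "cis (2 * pi * (s / real CARD('n))) = cis (2 * pi * (t / real CARD('n))) \<longleftrightarrow>
      (\<exists>k::int. s - t = real CARD('n) * of_int k)" for s t
  proof -
    have "2 * pi * (s / real CARD('n)) = 2 * pi * (t / real CARD('n)) + 2 * pi * of_int k \<longleftrightarrow>
        s - t = real CARD('n) * of_int k" for k
    proof -
      have "2 * pi * (t / real CARD('n)) + 2 * pi * of_int k = 2 * pi * (t / real CARD('n) + of_int k)"
        by (simp add: algebra_simps)
      then have "2 * pi * (s / real CARD('n)) = 2 * pi * (t / real CARD('n)) + 2 * pi * of_int k \<longleftrightarrow>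
          s / real CARD('n) = t / real CARD('n) + of_int k"
        by (simp only: mult_cancel_left) simp
      also have "\<dots> \<longleftrightarrow> s - t = real CARD('n) * of_int k"
        using n by (auto simp: field_simps)
      finally show ?thesis .
    qed
    then show ?thesis unfolding cis_eq_iff by simp
  qed
  show ?thesis unfolding 1
  proof
    assume "x - y \<in> lattice_N' ix"
    then obtain z where "x - y = root_point z" by (auto simp: lattice_N'_eq[OF ix])
    then have "x $ i - y $ i = real CARD('n) * of_int (z i)" for i
      by (simp add: root_point_def vec_eq_iff)
    then show "\<forall>i. \<exists>k. x $ i - y $ i = real CARD('n) * real_of_int k" by blast
  next
    assume "\<forall>i. \<exists>k. x $ i - y $ i = real CARD('n) * real_of_int k"
    then obtain z where z: "\<And>i. x $ i - y $ i = real CARD('n) * real_of_int (z i)" by metis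
    have "(\<Sum>i\<in>UNIV. x $ i - y $ i) = 0" using xy by (simp add: N_real_eq sum_subtractf)
    then have "real CARD('n) * (\<Sum>i\<in>UNIV. real_of_int (z i)) = 0"
      unfolding z by (simp only: sum_distrib_left)
    then have "(\<Sum>i\<in>UNIV. real_of_int (z i)) = 0" using n by simp
    then have "(\<Sum>i\<in>UNIV. z i) = 0" by (simp flip: of_int_sum)
    moreover have "x - y = root_point z" using z by (simp add: root_point_def vec_eq_iff)
    ultimately show "x - y \<in> lattice_N' ix" by (auto simp: lattice_N'_eq[OF ix])
  qed
qed

text \<open>
  The torus embeds continuously into \<open>\<complex>\<^sup>n\<close> by the coordinatewise exponential, whose periods on \<open>N_real\<close> are
  exactly \<open>N'\<close>.
\<close>

lemma Hausdorff_torus: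
  fixes ix :: "nat \<Rightarrow> 'n::finite"
  assumes ix: "bij_betw ix {1..CARD('n)} UNIV"
  shows "Hausdorff_space (torus_topology ix)"
proof -
  define \<phi> :: "real^'n \<Rightarrow> complex^'n" where
    "\<phi> x = (\<chi> i. cis (2 * pi * (x $ i / real CARD('n))))" for x
  have \<phi>: "\<phi> x = \<phi> y \<longleftrightarrow> torus_class ix x = torus_class ix y" if "x \<in> N_real" "y \<in> N_real" for x y
    unfolding torus_class_eq_iff lattice_N'_iff_cis[OF ix that] by (simp add: \<phi>_def vec_eq_iff)
  have q: "quotient_map (top_of_set N_real) (torus_topology ix) (torus_class ix)"
    unfolding torus_topology_def by (rule quotient_map_quotient_topology)
  have "continuous_on N_real \<phi>" unfolding \<phi>_def cis_conv_exp by (intro continuous_intros) auto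
  then have "continuous_map (top_of_set N_real) euclidean \<phi>" by simp
  then obtain g where g: "continuous_map (torus_topology ix) euclidean g"
      "\<And>x. x \<in> topspace (top_of_set N_real) \<Longrightarrow> g (torus_class ix x) = \<phi> x"
    using quotient_map_lift_exists[OF q, of euclidean \<phi>] \<phi> by (metis topspace_euclidean_subtopology)
  have "inj_on g (topspace (torus_topology ix))"
    unfolding torus_topology_def topspace_quotient_topology using g(2) \<phi> by (auto simp: inj_on_def)
  then show ?thesis
    using Hausdorff_space_injective_preimage[OF _ g(1)] by simp
qed

lemma voronoi_cell_center:
  assumes "v \<in> lattice_N"
  shows "v \<in> voronoi_cell v"
  using assms lattice_N_subset_N_real by (auto simp: voronoi_cell_def)

lemma lattice_point_in_voronoi_cell:
  assumes "u \<in> lattice_N" "u \<in> voronoi_cell v"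
  shows "u = v"
proof (rule ccontr)
  assume "u \<noteq> v"
  then have "dist u v \<le> dist u u" using assms unfolding voronoi_cell_def by blast
  then show False using \<open>u \<noteq> v\<close> by simp
qed

text \<open>
  The cell is symmetric about its centre, so the centre lies inside a segment with a prescribed end point.
\<close>

lemma face_of_voronoi_cell_center:
  fixes v :: "real^'n::finite"
  assumes v: "v \<in> lattice_N" and F: "F face_of voronoi_cell v" and vF: "v \<in> F"
  shows "F = voronoi_cell v"
proof
  show "F \<subseteq> voronoi_cell v" using F by (rule face_of_imp_subset)
  show "voronoi_cell v \<subseteq> F"
  proof
    fix x assume x: "x \<in> voronoi_cell v"
    show "x \<in> F"
    proof (cases "x = v")
      case False
      define y where "y = 2 *\<^sub>R v - x"
      have "y - v = - (x - v)" by (simp add: y_def scaleR_2)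
      then have y: "y \<in> voronoi_cell v"
        using x voronoi_cell_0_symmetric by (metis voronoi_cell_translate[OF v])
      have "x \<noteq> y"
      proof
        assume "x = y"
        then have "2 *\<^sub>R x = 2 *\<^sub>R v" by (simp add: y_def scaleR_2 algebra_simps)
        then show False using False by simp
      qed
      moreover have "v = (1 - 1/2) *\<^sub>R x + (1/2) *\<^sub>R y" by (simp add: y_def scaleR_diff_right)
      ultimately have "v \<in> open_segment x y"
        unfolding in_segment by (intro conjI exI[of _ "1/2"]) auto
      then show ?thesis using F x y vF by (auto simp: face_of_def)
    qed (use vF in simp)
  qed
qed

text \<open>
  If the image of a face contains the cell, then the face contains a translate of the centre, which is a
  lattice point; but a Voronoi cell contains no lattice point except its own centre.
\<close>

lemma PT_cell_maximal:
  fixes ix :: "nat \<Rightarrow> 'n::finite"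
  assumes ix: "bij_betw ix {1..CARD('n)} UNIV"
  shows "PT_cell ix k \<in> maximal_wonderful_cells ix"
proof -
  define v where "v = real k *\<^sub>R alpha (ix 1)"
  have v: "v \<in> lattice_N" by (simp add: v_def scaled_alpha_in_lattice_N)
  have P: "PT_cell ix k = torus_class ix ` voronoi_cell v" by (simp add: PT_cell_def v_def)
  have "voronoi_cell v face_of voronoi_cell v" by (intro face_of_refl convex_voronoi_cell)
  then have "PT_cell ix k \<in> wonderful_cells ix"
    unfolding wonderful_cells_def P using v voronoi_cell_center[OF v] by blast
  moreover have "C = PT_cell ix k" if C: "C \<in> wonderful_cells ix" "PT_cell ix k \<subseteq> C" for C
  proof -
    obtain F w where F: "C = torus_class ix ` F" "w \<in> lattice_N" "F face_of voronoi_cell w"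
      using C(1) by (auto simp: wonderful_cells_def)
    have "torus_class ix v \<in> C" using C(2) voronoi_cell_center[OF v] by (auto simp: P)
    then obtain u where u: "u \<in> F" "torus_class ix u = torus_class ix v" by (auto simp: F)
    then have uv: "u - v \<in> lattice_N' ix" by (simp add: torus_class_eq_iff)
    then have "u - v + v \<in> lattice_N" using lattice_N_add[OF _ v] lattice_N'_subset[OF ix] by blast
    then have "u \<in> lattice_N" by simp
    moreover have "u \<in> voronoi_cell w" using u F(3) face_of_imp_subset by blast
    ultimately have "u = w" by (rule lattice_point_in_voronoi_cell)
    then have Fw: "F = voronoi_cell w" using face_of_voronoi_cell_center F u by blast
    have wv: "w - v \<in> lattice_N' ix" using uv \<open>u = w\<close> by simp
    have "torus_class ix ` voronoi_cell w = torus_class ix ` voronoi_cell v"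
    proof -
      have shift: "torus_class ix ` voronoi_cell a \<subseteq> torus_class ix ` voronoi_cell b"
        if "a \<in> lattice_N" "b \<in> lattice_N" "b - a \<in> lattice_N' ix" for a b
      proof clarify
        fix x assume "x \<in> voronoi_cell a"
        then have "x + (b - a) \<in> voronoi_cell b"
          using voronoi_cell_translate[OF that(1)] voronoi_cell_translate[OF that(2)]
          by (simp add: algebra_simps)
        moreover have "torus_class ix x = torus_class ix (x + (b - a))"
          using lattice_N'_group(4)[OF that(3)] by (simp add: torus_class_eq_iff)
        ultimately show "torus_class ix x \<in> torus_class ix ` voronoi_cell b" by blast
      qed
      have "v - w \<in> lattice_N' ix" using lattice_N'_group(4)[OF wv] by simp
      then show ?thesis using shift[OF F(2) v] shift[OF v F(2) wv] by blast
    qed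
    then show ?thesis by (simp add: P F Fw)
  qed
  ultimately show ?thesis by (simp add: maximal_wonderful_cells_def)
qed

text \<open>
  The Voronoi cells cover \<open>N_real\<close>, and each lattice point \<open>\<Sum> y\<^sub>i \<alpha>\<^sub>i\<close> is congruent modulo \<open>N'\<close> to
  \<open>k \<alpha>\<^sub>1\<close> with \<open>k \<equiv> \<Sum> y\<^sub>i\<close> modulo \<open>n\<close>.
\<close>

lemma PT_cells_cover:
  fixes ix :: "nat \<Rightarrow> 'n::finite"
  assumes ix: "bij_betw ix {1..CARD('n)} UNIV" and x: "x \<in> N_real"
  shows "\<exists>k\<in>{1..CARD('n)}. torus_class ix x \<in> PT_cell ix k"
proof -
  define n where "n = int CARD('n)"
  obtain w where w: "w \<in> lattice_N" "x \<in> voronoi_cell w" using voronoi_cells_cover[OF x] .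
  obtain y where y: "w = lattice_point y" using w by (auto simp: lattice_N_eq)
  define s where "s = (\<Sum>i\<in>UNIV. y i)"
  have n: "n > 0" by (simp add: n_def)
  \<comment> \<open>the shift by one makes the residue range over \<open>1, \<dots>, n\<close>\<close>
  define k where "k = nat ((s - 1) mod n + 1)"
  have b: "0 \<le> (s - 1) mod n" "(s - 1) mod n < n" using n by auto
  have k: "int k = (s - 1) mod n + 1" using b by (simp add: k_def)
  then have "1 \<le> k" "k \<le> CARD('n)" using b unfolding n_def by linarith+
  then have kr: "k \<in> {1..CARD('n)}" by simp
  define q where "q = (s - 1) div n"
  have skq: "s = int k + n * q" unfolding k q_def
    using mult_div_mod_eq[of n "s - 1"] by linarith
  define v where "v = real k *\<^sub>R alpha (ix 1)"
  have v: "v \<in> lattice_N" by (simp add: v_def scaled_alpha_in_lattice_N)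
  define z where "z i = y i - (if i = ix 1 then int k else 0) - q" for i
  have "(\<Sum>i\<in>UNIV. z i) = 0"
    by (simp add: z_def sum_subtractf skq flip: s_def n_def)
  moreover have "w - v = root_point z"
    unfolding y v_def scaled_alpha lattice_point_diff
    by (simp add: lattice_point_def root_point_def z_def vec_eq_iff sum_subtractf skq flip: s_def n_def)
      (simp add: n_def algebra_simps)
  ultimately have wv: "w - v \<in> lattice_N' ix" by (auto simp: lattice_N'_eq[OF ix])
  have "x - (w - v) \<in> voronoi_cell v"
    using w voronoi_cell_translate[OF v] voronoi_cell_translate[OF w(1)] by (simp add: algebra_simps)
  moreover have "torus_class ix x = torus_class ix (x - (w - v))"
    using wv by (simp add: torus_class_eq_iff)
  ultimately have "torus_class ix x \<in> PT_cell ix k"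
    unfolding PT_cell_def v_def[symmetric] by simp
  then show ?thesis using kr by blast
qed


section \<open>Rotating the order of the rows\<close>

text \<open>
  The order \<open>r'\<close> arises from \<open>r\<close> by moving the first \<open>d\<close> rows to the end.
\<close>

definition rotated :: "nat \<Rightarrow> ('n::finite \<Rightarrow> nat) \<Rightarrow> ('n \<Rightarrow> nat) \<Rightarrow> bool" where
  "rotated d r r' \<longleftrightarrow> d < CARD('n) \<and>
     (\<forall>a. r' a = (if r a \<le> d then r a + CARD('n) - d else r a - d))"

lemma mean_rank_rotated:
  fixes r r' :: "'n::finite \<Rightarrow> nat"
  assumes rot: "rotated d r r'" and U: "unitary_matrix U" and J: "block_support r d J U"
  shows "mean_rank r' U i = mean_rank r U i - real d + (if i \<in> J then real CARD('n) else 0)"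
proof -
  have "real (r' a) * c = real (r a) * c - real d * c + real CARD('n) * (if r a \<le> d then c else 0)" for a c
    using rot by (auto simp: rotated_def of_nat_diff algebra_simps)
  then have "mean_rank r' U i = mean_rank r U i - real d * (\<Sum>a\<in>UNIV. (cmod (U $ i $ a))\<^sup>2)
      + real CARD('n) * (\<Sum>a\<in>UNIV. if r a \<le> d then (cmod (U $ i $ a))\<^sup>2 else 0)"
    unfolding mean_rank_def by (simp add: sum.distrib sum_subtractf sum_distrib_left)
  also have "(\<Sum>a\<in>UNIV. if r a \<le> d then (cmod (U $ i $ a))\<^sup>2 else 0) = (if i \<in> J then 1 else 0)"
    unfolding block_support_partial_row[OF U J, symmetric] by (simp add: sum.If_cases)
  finally show ?thesis by (simp add: unitary_row_norm[OF U])
qed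

lemma frames_rotated:
  fixes r r' :: "'n::finite \<Rightarrow> nat"
  assumes rot: "rotated d r r'" and r: "ranking r" and U: "U \<in> frames \<mu> r"
    and s: "splits r d (isospectral \<mu> U)"
  shows "U \<in> frames \<mu> r'"
proof -
  define L where "L = isospectral \<mu> U"
  have tri: "tridiagonal r L" and u: "unitary_matrix U" using U by (auto simp: frames_def L_def)
  have "tridiagonal r' L" unfolding tridiagonal_def
  proof (intro allI impI)
    fix a b assume *: "r' a + 1 < r' b"
    show "L $ a $ b = 0 \<and> L $ b $ a = 0"
    proof (cases "r a \<le> d \<longleftrightarrow> r b \<le> d")
      case True
      then have "r a + 1 < r b" using * rot ranking_range[OF r, of a] ranking_range[OF r, of b]
        by (auto simp: rotated_def split: if_splits)
      then show ?thesis using tri by (simp add: tridiagonal_def)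
    next
      case False
      then show ?thesis using s unfolding splits_def L_def[symmetric] by (metis not_le)
    qed
  qed
  then show ?thesis using u by (simp add: frames_def L_def)
qed

text \<open>
  The entry linking the ranks \<open>d\<close> and \<open>d + 1\<close> of \<open>r\<close> links the last and the first rank of \<open>r'\<close>, which are
  not neighbours as \<open>n \<ge> 3\<close>.
\<close>

lemma splits_if_rotated:
  fixes r r' :: "'n::finite \<Rightarrow> nat"
  assumes n: "CARD('n) \<ge> 3" and rot: "rotated d r r'" and r: "ranking r"
    and U: "U \<in> frames \<mu> r" "U \<in> frames \<mu> r'"
  shows "splits r d (isospectral \<mu> U)"
  unfolding splits_def
proof (intro allI impI)
  fix a b assume ab: "r a \<le> d \<and> d < r b"
  show "isospectral \<mu> U $ a $ b = 0 \<and> isospectral \<mu> U $ b $ a = 0"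
  proof (cases "r a + 1 < r b")
    case True
    then show ?thesis using U(1) by (simp add: frames_def tridiagonal_def)
  next
    case False
    then have "r a = d" "r b = d + 1" using ab by auto
    then have "r' b + 1 < r' a" using rot n by (simp add: rotated_def)
    then show ?thesis using U(2) by (simp add: frames_def tridiagonal_def)
  qed
qed

text \<open>
  All mean ranks lie in \<open>[1,n]\<close>, which leaves only \<open>0\<close> and \<open>-1\<close> as values of \<open>z\<close>.  On the set \<open>J\<close> with
  \<open>z = -1\<close>, of size \<open>d\<close>, the upper bound for the sum of the mean ranks of \<open>V\<close> becomes the lower bound for
  those of \<open>U\<close>; so this inequality is tight and \<open>U\<close> is tridiagonal in the rotated order too.
\<close>

lemma rotated_mean_rank_congruent:
  fixes r r' :: "'n::finite \<Rightarrow> nat"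
  assumes rot: "rotated d r r'" and r: "ranking r" and r': "ranking r'"
    and U: "U \<in> frames \<mu> r" and V: "unitary_matrix V"
    and cong: "\<And>i. mean_rank r U i = mean_rank r' V i + real d + real CARD('n) * of_int (z i)"
    and z: "(\<Sum>i\<in>UNIV. z i) = - int d"
  shows "U \<in> frames \<mu> r' \<and> (\<forall>i. mean_rank r' U i = mean_rank r' V i)"
proof -
  define n where "n = real CARD('n)"
  have u: "unitary_matrix U" using U by (simp add: frames_def)
  have dn: "d < CARD('n)" using rot by (simp add: rotated_def)
  have n0: "n > 0" by (simp add: n_def)
  have zi: "z i = 0 \<or> z i = - 1" for i
  proof -
    have b: "1 \<le> mean_rank r U i" "mean_rank r U i \<le> n" "1 \<le> mean_rank r' V i" "mean_rank r' V i \<le> n"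
      unfolding n_def using mean_rank_ge_1 mean_rank_le_card r r' u V by blast+
    have c: "mean_rank r U i = mean_rank r' V i + real d + n * of_int (z i)"
      using cong by (simp add: n_def)
    have "n * of_int (z i) < n * 1" using b c by linarith
    then have "of_int (z i) < (1::real)" using n0 by (simp only: mult_less_cancel_left_pos)
    moreover have "n * (- 2) < n * of_int (z i)" using b c dn unfolding n_def by linarith
    then have "- 2 < (of_int (z i) :: real)" using n0 by (simp only: mult_less_cancel_left_pos)
    ultimately show ?thesis by linarith
  qed
  define J where "J = {i. z i = - 1}"
  have zJ: "z i = (if i \<in> J then - 1 else 0)" for i using zi[of i] by (auto simp: J_def)
  have "(\<Sum>i\<in>UNIV. z i) = - int (card J)" by (simp add: zJ sum.If_cases)
  then have cJ: "card J = d" using z by simp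
  have "(\<Sum>i\<in>J. mean_rank r U i) = (\<Sum>i\<in>J. mean_rank r' V i) + real d * (real d - n)"
  proof -
    have "(\<Sum>i\<in>J. mean_rank r U i) = (\<Sum>i\<in>J. mean_rank r' V i + (real d - n))"
      by (intro sum.cong refl) (simp add: cong zJ n_def)
    then show ?thesis by (simp add: sum.distrib cJ)
  qed
  moreover have "(\<Sum>i\<in>J. mean_rank r' V i) \<le> n * (n + 1) / 2 - (n - real d) * (n - real d + 1) / 2"
  proof -
    have "(\<Sum>i\<in>UNIV. mean_rank r' V i) = (\<Sum>i\<in>- J. mean_rank r' V i) + (\<Sum>i\<in>J. mean_rank r' V i)"
      by (simp add: sum.subset_diff[of J UNIV] Compl_eq_Diff_UNIV)
    moreover have "(n - real d) * (n - real d + 1) / 2 \<le> (\<Sum>i\<in>- J. mean_rank r' V i)"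
    proof -
      have c: "real (card (- J)) = n - real d"
        using dn by (simp add: Compl_eq_Diff_UNIV card_Diff_subset cJ n_def of_nat_diff)
      show ?thesis using rank_sum_ge[OF r' V, of "- J"] unfolding c .
    qed
    moreover have "(\<Sum>i\<in>UNIV. mean_rank r' V i) = n * (n + 1) / 2"
      unfolding n_def by (rule mean_rank_total[OF r' V])
    ultimately show ?thesis by linarith
  qed
  moreover have "n * (n + 1) / 2 - (n - real d) * (n - real d + 1) / 2 + real d * (real d - n) =
      real d * (real d + 1) / 2" by (simp add: field_simps)
  ultimately have "(\<Sum>i\<in>J. mean_rank r U i) \<le> real (card J) * (real (card J) + 1) / 2"
    by (simp add: cJ)
  then have blk: "block_support r d J U" using block_support_if_tight[OF r u, of J] by (simp only: cJ)
  then have "U \<in> frames \<mu> r'" by (intro frames_rotated[OF rot r U] splits_if_block_support)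
  moreover have "mean_rank r' U i = mean_rank r' V i" for i
    unfolding mean_rank_rotated[OF rot u blk] cong by (simp add: zJ)
  ultimately show ?thesis by blast
qed

section \<open>The spaces of periodic tridiagonal matrices\<close>

definition position :: "(nat \<Rightarrow> 'n::finite) \<Rightarrow> 'n \<Rightarrow> nat" where
  "position ix = inv_into {1..CARD('n)} ix"

definition eigenvalue_label :: "(nat \<Rightarrow> 'n::finite) \<Rightarrow> (nat \<Rightarrow> real) \<Rightarrow> 'n \<Rightarrow> real" where
  "eigenvalue_label ix lam i = lam (position ix i)"

text \<open>
  The rank of a row in the cyclic order that starts right after position \<open>k\<close>.
\<close>

definition cyclic_rank :: "(nat \<Rightarrow> 'n::finite) \<Rightarrow> nat \<Rightarrow> 'n \<Rightarrow> nat" where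
  "cyclic_rank ix k a = (if k < position ix a then position ix a - k else position ix a + CARD('n) - k)"

context
  fixes ix :: "nat \<Rightarrow> 'n::finite"
  assumes ix: "bij_betw ix {1..CARD('n)} UNIV"
begin

lemma position_range: "1 \<le> position ix a \<and> position ix a \<le> CARD('n)"
proof -
  have "a \<in> ix ` {1..CARD('n)}" using ix by (simp add: bij_betw_def)
  then have "inv_into {1..CARD('n)} ix a \<in> {1..CARD('n)}" by (rule inv_into_into)
  then show ?thesis unfolding position_def by simp
qed

lemma position_ix: "i \<in> {1..CARD('n)} \<Longrightarrow> position ix (ix i) = i"
  unfolding position_def using ix by (intro inv_into_f_f) (auto simp: bij_betw_def)

lemma ix_position: "ix (position ix a) = a"
  unfolding position_def using ix by (intro f_inv_into_f) (auto simp: bij_betw_def)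

lemma inj_position: "inj (position ix)"
  by (metis injI ix_position)

lemma ix_cases:
  obtains i where "i \<in> {1..CARD('n)}" "a = ix i"
  using position_range[of a] ix_position[of a] by (metis atLeastAtMost_iff)

lemma inj_eigenvalue_label:
  assumes "strict_mono_on {1..CARD('n)} lam"
  shows "inj (eigenvalue_label ix lam)"
proof (rule injI)
  fix i j assume "eigenvalue_label ix lam i = eigenvalue_label ix lam j"
  then have "position ix i = position ix j"
    using strict_mono_on_eqD[OF assms] position_range by (simp add: eigenvalue_label_def)
  then show "i = j" using inj_position by (auto simp: inj_def)
qed

lemma range_eigenvalue_label:
  "range (\<lambda>i. complex_of_real (eigenvalue_label ix lam i)) = (\<lambda>i. complex_of_real (lam i)) ` {1..CARD('n)}"
proof (intro equalityI subsetI)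
  fix z assume "z \<in> range (\<lambda>i. complex_of_real (eigenvalue_label ix lam i))"
  then show "z \<in> (\<lambda>i. complex_of_real (lam i)) ` {1..CARD('n)}"
    using position_range by (auto simp: eigenvalue_label_def)
next
  fix z assume "z \<in> (\<lambda>i. complex_of_real (lam i)) ` {1..CARD('n)}"
  then obtain i where "i \<in> {1..CARD('n)}" "z = complex_of_real (lam i)" by blast
  then have "z = complex_of_real (eigenvalue_label ix lam (ix i))"
    by (simp add: eigenvalue_label_def position_ix)
  then show "z \<in> range (\<lambda>i. complex_of_real (eigenvalue_label ix lam i))" by blast
qed

lemma ranking_cyclic_rank:
  assumes k: "k \<in> {1..CARD('n)}"
  shows "ranking (cyclic_rank ix k)"
proof -
  have "inj (cyclic_rank ix k)"
  proof (rule injI)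
    fix a b assume "cyclic_rank ix k a = cyclic_rank ix k b"
    then have "position ix a = position ix b"
      using position_range[of a] position_range[of b] k by (auto simp: cyclic_rank_def split: if_splits)
    then show "a = b" using inj_position by (auto simp: inj_def)
  qed
  moreover have "range (cyclic_rank ix k) \<subseteq> {1..CARD('n)}"
  proof
    fix s assume "s \<in> range (cyclic_rank ix k)"
    then obtain a where "s = cyclic_rank ix k a" by blast
    then show "s \<in> {1..CARD('n)}"
      using position_range[of a] k by (auto simp: cyclic_rank_def)
  qed
  ultimately have "range (cyclic_rank ix k) = {1..CARD('n)}"
    by (intro card_subset_eq) (auto simp: card_image)
  then show ?thesis using \<open>inj _\<close> by (simp add: ranking_def bij_betw_def)
qed

lemma cyclic_rank_ix:
  "i \<in> {1..CARD('n)} \<Longrightarrow> cyclic_rank ix k (ix i) = (if k < i then i - k else i + CARD('n) - k)"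
  by (simp add: cyclic_rank_def position_ix)

lemma rotated_cyclic_rank:
  assumes "k \<in> {1..CARD('n)}" "l \<in> {1..CARD('n)}" "k \<le> l"
  shows "rotated (l - k) (cyclic_rank ix k) (cyclic_rank ix l)"
  unfolding rotated_def
proof (intro conjI allI)
  show "l - k < CARD('n)" using assms by auto
  fix a
  show "cyclic_rank ix l a = (if cyclic_rank ix k a \<le> l - k then cyclic_rank ix k a + CARD('n) - (l - k)
      else cyclic_rank ix k a - (l - k))"
    using assms position_range[of a] by (auto simp: cyclic_rank_def)
qed

lemma tridiag_entry_far:
  assumes n: "CARD('n) \<ge> 3" and k: "k \<in> {1..CARD('n)}" and b: "b k = 0"
    and ij: "i \<in> {1..CARD('n)}" "j \<in> {1..CARD('n)}"
    and far: "cyclic_rank ix k (ix i) + 1 < cyclic_rank ix k (ix j)"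
  shows "tridiag_entry CARD('n) a b i j = 0 \<and> tridiag_entry CARD('n) a b j i = 0"
proof -
  have far': "(if k < i then i - k else i + CARD('n) - k) + 1 < (if k < j then j - k else j + CARD('n) - k)"
    using far ij by (simp add: cyclic_rank_ix)
  consider "i = j" | "j = i + 1" | "i = j + 1" | "i = CARD('n) \<and> j = 1" | "i = 1 \<and> j = CARD('n)"
    | "i \<noteq> j \<and> j \<noteq> i + 1 \<and> i \<noteq> j + 1 \<and> \<not> (i = CARD('n) \<and> j = 1) \<and> \<not> (i = 1 \<and> j = CARD('n))"
    by blast
  then show ?thesis
  proof cases
    case 1
    then show ?thesis using far by simp
  next
    case 2
    then have "i = k" using far' k ij by (auto split: if_splits)
    then show ?thesis using 2 b by (simp add: tridiag_entry_def)
  next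
    case 3
    then have "j = k" using far' k ij by (auto split: if_splits)
    then show ?thesis using 3 b by (simp add: tridiag_entry_def)
  next
    case 4
    then have "k = CARD('n)" using far' k n by (auto split: if_splits)
    then show ?thesis using 4 b n by (simp add: tridiag_entry_def)
  next
    case 5
    then have "k = CARD('n)" using far' k n by (auto split: if_splits)
    then show ?thesis using 5 b n by (simp add: tridiag_entry_def)
  next
    case 6
    then show ?thesis by (auto simp: tridiag_entry_def)
  qed
qed

lemma tridiag_entry_cnj:
  assumes "CARD('n) \<ge> 3"
  shows "cnj (tridiag_entry CARD('n) a b j i) = tridiag_entry CARD('n) a b i j"
  using assms by (auto simp: tridiag_entry_def)

text \<open>
  The condition \<open>b\<^sub>k = 0\<close> removes the one entry linking the last and the first row of the cyclic order
  starting at \<open>k + 1\<close>, and all other cyclic neighbours are neighbours in this order.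
\<close>

lemma Y_space_eq:
  assumes n: "CARD('n) \<ge> 3" and lam: "strict_mono_on {1..CARD('n)} lam" and k: "k \<in> {1..CARD('n)}"
  shows "Y_space ix lam k =
    isospectral (eigenvalue_label ix lam) ` frames (eigenvalue_label ix lam) (cyclic_rank ix k)"
proof (intro equalityI subsetI)
  let ?\<mu> = "eigenvalue_label ix lam" and ?r = "cyclic_rank ix k"
  fix L assume "L \<in> Y_space ix lam k"
  then obtain a b where L: "L \<in> X_space ix lam" and ab: "is_periodic_tridiagonal ix a b L" "b k = 0"
    by (auto simp: Y_space_def)
  have ent: "L $ ix i $ ix j = tridiag_entry CARD('n) a b i j"
    if "i \<in> {1..CARD('n)}" "j \<in> {1..CARD('n)}" for i j
    using ab(1) that by (auto simp: is_periodic_tridiagonal_def)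
  have "cnj (L $ y $ x) = L $ x $ y" for x y
    by (rule ix_cases[of x], rule ix_cases[of y]) (simp add: ent tridiag_entry_cnj[OF n])
  then have herm: "conj_transpose L = L" by (simp add: vec_eq_iff)
  have "range (\<lambda>i. complex_of_real (?\<mu> i)) \<subseteq> matrix_spectrum L"
    using L by (simp add: X_space_def range_eigenvalue_label)
  then obtain U where U: "unitary_matrix U" "L = isospectral ?\<mu> U"
    using isospectral_exists[OF inj_eigenvalue_label[OF lam] herm] by blast
  have "tridiagonal ?r L" unfolding tridiagonal_def
  proof (intro allI impI)
    fix x y assume far: "?r x + 1 < ?r y"
    obtain i j where ij: "i \<in> {1..CARD('n)}" "x = ix i" "j \<in> {1..CARD('n)}" "y = ix j"
      by (rule ix_cases[of x], rule ix_cases[of y]) blast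
    then show "L $ x $ y = 0 \<and> L $ y $ x = 0"
      using tridiag_entry_far[where a = a and b = b and i = i and j = j, OF n k] ab(2) far
      by (simp add: ent)
  qed
  then show "L \<in> isospectral ?\<mu> ` frames ?\<mu> ?r" using U by (auto simp: frames_def)
next
  let ?\<mu> = "eigenvalue_label ix lam" and ?r = "cyclic_rank ix k"
  fix L assume "L \<in> isospectral ?\<mu> ` frames ?\<mu> ?r"
  then obtain U where U: "unitary_matrix U" "tridiagonal ?r L" "L = isospectral ?\<mu> U"
    by (auto simp: frames_def)
  have herm: "cnj (L $ x $ y) = L $ y $ x" for x y unfolding U(3) by (rule isospectral_hermitian_nth)
  have far: "L $ ix i $ ix j = 0" if "i \<in> {1..CARD('n)}" "j \<in> {1..CARD('n)}"
      "?r (ix i) + 1 < ?r (ix j) \<or> ?r (ix j) + 1 < ?r (ix i)" for i j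
    using U(2) that(3) by (auto simp: tridiagonal_def)
  define a where "a i = Re (L $ ix i $ ix i)" for i
  define b where "b i = (if i < CARD('n) then L $ ix i $ ix (i + 1) else L $ ix i $ ix 1)" for i
  have "L $ ix i $ ix j = tridiag_entry CARD('n) a b i j"
    if ij: "i \<in> {1..CARD('n)}" "j \<in> {1..CARD('n)}" for i j
  proof -
    consider "i = j" | "j = i + 1" | "i = j + 1" | "i = CARD('n) \<and> j = 1" | "i = 1 \<and> j = CARD('n)"
      | "i \<noteq> j \<and> j \<noteq> i + 1 \<and> i \<noteq> j + 1 \<and> \<not> (i = CARD('n) \<and> j = 1) \<and> \<not> (i = 1 \<and> j = CARD('n))"
      by blast
    then show ?thesis
    proof cases
      case 1
      have "Im (L $ ix i $ ix i) = 0" using herm[of "ix i" "ix i"] by (simp add: complex_eq_iff)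
      then show ?thesis using 1 by (simp add: tridiag_entry_def a_def complex_eq_iff)
    next
      case 6
      have "?r (ix i) + 1 < ?r (ix j) \<or> ?r (ix j) + 1 < ?r (ix i)"
        using 6 ij k by (auto simp: cyclic_rank_ix)
      then have "L $ ix i $ ix j = 0" using far[OF ij] by blast
      moreover have "tridiag_entry CARD('n) a b i j = 0" using 6 by (auto simp: tridiag_entry_def)
      ultimately show ?thesis by simp
    qed (use n ij herm in \<open>auto simp: tridiag_entry_def b_def\<close>)
  qed
  then have per: "is_periodic_tridiagonal ix a b L" by (simp add: is_periodic_tridiagonal_def)
  have "b k = 0"
  proof (cases "k < CARD('n)")
    case True
    then have "?r (ix (k + 1)) + 1 < ?r (ix k)" using k n by (simp add: cyclic_rank_ix)
    then show ?thesis using True k far[of k "k + 1"] by (simp add: b_def)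
  next
    case False
    then have "k = CARD('n)" using k by simp
    then have "?r (ix 1) + 1 < ?r (ix k)" using n by (simp add: cyclic_rank_ix)
    then show ?thesis using False k far[of k 1] by (simp add: b_def)
  qed
  moreover have "L \<in> X_space ix lam"
    using per matrix_spectrum_isospectral[OF U(1), of ?\<mu>] U(3)
    by (auto simp: X_space_def range_eigenvalue_label)
  ultimately show "L \<in> Y_space ix lam k" using per by (auto simp: Y_space_def)
qed


section \<open>The map to the torus\<close>

text \<open>
  The mean ranks enter with a negative sign: modulo \<open>n \<int>\<^sup>n\<close>, passing from \<open>k\<close> to \<open>l\<close> lowers every mean
  rank by \<open>l - k\<close>, and the centre of the cell also moves by \<open>(l - k) \<alpha>\<^sub>1 \<equiv> - (l - k) (1, \<dots>, 1)\<close>, so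
  the two shifts have to cancel.
\<close>

definition cell_point :: "nat \<Rightarrow> complex^'n^'n \<Rightarrow> real^'n" where
  "cell_point k U = (\<chi> i. (real CARD('n) + 1) / 2 - mean_rank (cyclic_rank ix k) U i) + real k *\<^sub>R alpha (ix 1)"

lemma cell_point_in_voronoi_cell:
  assumes k: "k \<in> {1..CARD('n)}" and U: "unitary_matrix U"
  shows "cell_point k U \<in> voronoi_cell (real k *\<^sub>R alpha (ix 1))"
proof -
  define r where "r = cyclic_rank ix k"
  have r: "ranking r" unfolding r_def by (rule ranking_cyclic_rank[OF k])
  define q where "q = (\<chi> i. (real CARD('n) + 1) / 2 - mean_rank r U i)"
  have "(\<Sum>i\<in>I. q $ i) = real (card I) * (real CARD('n) + 1) / 2 - (\<Sum>i\<in>I. mean_rank r U i)" for I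
    by (simp add: q_def sum_subtractf)
  moreover have "real (card I) * (real (card I) + 1) / 2 \<le> (\<Sum>i\<in>I. mean_rank r U i)" for I
    by (rule rank_sum_ge[OF r U])
  moreover have "real (card I) * (real CARD('n) - real (card I)) / 2 =
      real (card I) * (real CARD('n) + 1) / 2 - real (card I) * (real (card I) + 1) / 2" for I :: "'n set"
    by (simp add: algebra_simps diff_divide_distrib)
  ultimately have "(\<Sum>i\<in>I. q $ i) \<le> real (card I) * (real CARD('n) - real (card I)) / 2" for I
    by (simp only: diff_left_mono)
  moreover have "(\<Sum>i\<in>UNIV. q $ i) = 0"
    by (simp add: q_def sum_subtractf mean_rank_total[OF r U])
  ultimately have "q \<in> voronoi_cell 0" by (simp add: voronoi_cell_0_iff)
  then show ?thesis
    by (simp add: voronoi_cell_translate[OF scaled_alpha_in_lattice_N] cell_point_def q_def r_def)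
qed

lemma voronoi_cell_filled:
  assumes k: "k \<in> {1..CARD('n)}" and inj: "inj \<mu>" and x: "x \<in> voronoi_cell (real k *\<^sub>R alpha (ix 1))"
  shows "x \<in> cell_point k ` frames \<mu> (cyclic_rank ix k)"
proof -
  define r where "r = cyclic_rank ix k"
  have r: "ranking r" unfolding r_def by (rule ranking_cyclic_rank[OF k])
  define q where "q = x - real k *\<^sub>R alpha (ix 1)"
  have "q \<in> voronoi_cell 0"
    using x by (simp add: voronoi_cell_translate[OF scaled_alpha_in_lattice_N] q_def)
  then have q: "(\<Sum>i\<in>UNIV. q $ i) = 0"
      "\<And>I. (\<Sum>i\<in>I. q $ i) \<le> real (card I) * (real CARD('n) - real (card I)) / 2"
    by (auto simp: voronoi_cell_0_iff)
  define p where "p = (\<chi> i. (real CARD('n) + 1) / 2 - q $ i)"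
  have ps: "(\<Sum>i\<in>I. p $ i) = real (card I) * (real CARD('n) + 1) / 2 - (\<Sum>i\<in>I. q $ i)" for I
    by (simp add: p_def sum_subtractf)
  have "real (card I) * (real (card I) + 1) / 2 \<le> (\<Sum>i\<in>I. p $ i)" for I
  proof -
    have "real (card I) * (real CARD('n) - real (card I)) / 2 =
        real (card I) * (real CARD('n) + 1) / 2 - real (card I) * (real (card I) + 1) / 2"
      by (simp add: algebra_simps diff_divide_distrib)
    then show ?thesis unfolding ps using q(2)[of I] by linarith
  qed
  moreover have "(\<Sum>i\<in>UNIV. p $ i) = real CARD('n) * (real CARD('n) + 1) / 2"
    unfolding ps q(1) by simp
  ultimately obtain U where U: "U \<in> frames \<mu> r" "mean_rank_vector r U = p"
    using permutohedron_filled[OF r inj] by blast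
  have "mean_rank r U i = p $ i" for i using U(2) by (auto simp: mean_rank_vector_def)
  then have "cell_point k U = x" by (simp add: cell_point_def p_def q_def vec_eq_iff flip: r_def)
  then show ?thesis using U(1) by (auto simp: r_def)
qed

lemma continuous_on_cell_point: "continuous_on S (cell_point k)"
  unfolding cell_point_def by (intro continuous_intros continuous_on_mean_rank)

lemma cell_point_diff:
  assumes "k \<le> l"
  shows "(cell_point k U - cell_point l V) $ i =
    mean_rank (cyclic_rank ix l) V i - mean_rank (cyclic_rank ix k) U i
      - real (l - k) * (real CARD('n) * (if ix 1 = i then 1 else 0) - 1)"
  using assms by (simp add: cell_point_def alpha_nth of_nat_diff algebra_simps)

text \<open>
  Moving the block of the first \<open>l - k\<close> rows to the end adds \<open>n\<close> to the mean ranks of the \<open>l - k\<close>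
  eigenvectors carried by it and subtracts \<open>l - k\<close> from all of them; with the shift of the centre this
  is \<open>n\<close> times an integer vector of sum \<open>0\<close>.
\<close>

lemma cell_points_agree:
  assumes n: "CARD('n) \<ge> 3" and inj: "inj \<mu>" and kl: "k \<in> {1..CARD('n)}" "l \<in> {1..CARD('n)}" "k \<le> l"
    and U: "U \<in> frames \<mu> (cyclic_rank ix k)" "U \<in> frames \<mu> (cyclic_rank ix l)"
  shows "cell_point k U - cell_point l U \<in> lattice_N' ix"
proof -
  let ?r = "cyclic_rank ix k" and ?d = "l - k"
  have r: "ranking ?r" by (rule ranking_cyclic_rank[OF kl(1)])
  have rot: "rotated ?d ?r (cyclic_rank ix l)" by (rule rotated_cyclic_rank[OF kl])
  have u: "unitary_matrix U" using U by (simp add: frames_def)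
  obtain J where J: "block_support ?r ?d J U"
    using block_support_if_splits[OF u inj splits_if_rotated[OF n rot r U]] .
  have cJ: "card J = ?d" using block_support_card[OF r u J] rot by (simp add: rotated_def)
  define z where "z i = (if i \<in> J then 1 else 0) - (if ix 1 = i then int ?d else 0)" for i
  have "(\<Sum>i\<in>UNIV. z i) = 0"
    by (simp add: z_def sum_subtractf sum.If_cases cJ)
  moreover have "cell_point k U - cell_point l U = root_point z"
    by (simp only: vec_eq_iff cell_point_diff[OF kl(3)] mean_rank_rotated[OF rot u J])
      (simp add: root_point_def z_def algebra_simps)
  ultimately show ?thesis by (auto simp: lattice_N'_eq[OF ix])
qed

lemma torus_orbit_eq_if_cell_points_congruent:
  assumes inj: "inj \<mu>" and kl: "k \<in> {1..CARD('n)}" "l \<in> {1..CARD('n)}" "k \<le> l"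
    and U: "U \<in> frames \<mu> (cyclic_rank ix k)" and V: "V \<in> frames \<mu> (cyclic_rank ix l)"
    and cong: "cell_point k U - cell_point l V \<in> lattice_N' ix"
  shows "torus_orbit (isospectral \<mu> U) = torus_orbit (isospectral \<mu> V)"
proof -
  let ?r = "cyclic_rank ix k" and ?r' = "cyclic_rank ix l" and ?d = "l - k"
  have r: "ranking ?r" "ranking ?r'" using ranking_cyclic_rank kl by auto
  have rot: "rotated ?d ?r ?r'" by (rule rotated_cyclic_rank[OF kl])
  have v: "unitary_matrix V" using V by (simp add: frames_def)
  obtain z where z: "cell_point k U - cell_point l V = root_point z" "(\<Sum>i\<in>UNIV. z i) = 0"
    using cong by (auto simp: lattice_N'_eq[OF ix])
  define z' where "z' i = - z i - (if ix 1 = i then int ?d else 0)" for i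
  have "(\<Sum>i\<in>UNIV. z' i) = - int ?d"
    by (simp add: z'_def sum_subtractf sum_negf z(2))
  moreover have "mean_rank ?r U i = mean_rank ?r' V i + real ?d + real CARD('n) * of_int (z' i)" for i
  proof -
    have "(cell_point k U - cell_point l V) $ i = real CARD('n) * of_int (z i)"
      by (simp add: z(1) root_point_def)
    then show ?thesis
      unfolding cell_point_diff[OF kl(3)] by (simp add: z'_def algebra_simps)
  qed
  ultimately have "U \<in> frames \<mu> ?r' \<and> (\<forall>i. mean_rank ?r' U i = mean_rank ?r' V i)"
    by (intro rotated_mean_rank_congruent[OF rot r U v])
  then show ?thesis using torus_orbit_eq_if_mean_rank_eq[OF r(2) inj _ V] by blast
qed

end

lemma frames_if_torus_orbit_eq:
  assumes U: "U \<in> frames \<mu> r" and V: "unitary_matrix V"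
    and orb: "torus_orbit (isospectral \<mu> U) = torus_orbit (isospectral \<mu> V)"
  shows "V \<in> frames \<mu> r"
proof -
  obtain D where D: "D \<in> diagonal_unitary" "isospectral \<mu> V = D ** isospectral \<mu> U ** conj_transpose D"
    using mem_torus_orbit_self[of "isospectral \<mu> V"] orb by (auto simp: torus_orbit_def)
  have D0: "\<And>i j. i \<noteq> j \<Longrightarrow> D $ i $ j = 0" using D by (simp add: diagonal_unitary_def)
  have "isospectral \<mu> V $ a $ b = D $ a $ a * isospectral \<mu> U $ a $ b * cnj (D $ b $ b)" for a b
  proof -
    have "isospectral \<mu> V $ a $ b = (D ** isospectral \<mu> U) $ a $ b * conj_transpose D $ b $ b"
      unfolding D(2) by (rule mult_diagonal_column) (simp add: D0)
    also have "(D ** isospectral \<mu> U) $ a $ b = D $ a $ a * isospectral \<mu> U $ a $ b"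
      by (rule mult_diagonal_row) (simp add: D0)
    finally show ?thesis by simp
  qed
  then have "tridiagonal r (isospectral \<mu> V)"
    using U by (auto simp: frames_def tridiagonal_def)
  then show ?thesis using V by (simp add: frames_def)
qed

theorem theorem5p7:
  fixes ix :: "nat \<Rightarrow> 'n::finite"
    and lam :: "nat \<Rightarrow> real"
  assumes "CARD('n) \<ge> 3"
    and "bij_betw ix {1..CARD('n)} UNIV"
    and "strict_mono_on {1..CARD('n)} lam"
  shows "\<exists>h. homeomorphic_map (Q0_topology ix lam) (torus_topology ix) h \<and>
             (\<forall>k\<in>{1..CARD('n)}.
                PT_cell ix k \<in> maximal_wonderful_cells ix \<and>
                h ` Q_space ix lam k = PT_cell ix k)"
proof -
  define K where "K = {1..CARD('n)}"
  define \<mu> where "\<mu> = eigenvalue_label ix lam"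
  define T where "T k = frames \<mu> (cyclic_rank ix k)" for k
  define W where "W = (\<Union>k\<in>K. T k)"
  define p where "p k U = torus_class ix (cell_point ix k U)" for k U
  note ix = assms(2)
  have inj: "inj \<mu>" unfolding \<mu>_def by (rule inj_eigenvalue_label[OF ix assms(3)])
  have Tu: "U \<in> T k \<Longrightarrow> unitary_matrix U" for U k by (simp add: T_def frames_def)
  have Y: "Y_space ix lam k = isospectral \<mu> ` T k" if "k \<in> K" for k
    using Y_space_eq[OF ix assms(1,3)] that by (simp add: \<mu>_def T_def K_def)
  have X0: "X0_space ix lam = isospectral \<mu> ` W"
    unfolding X0_space_def W_def image_UN K_def[symmetric] using Y by simp
  have cW: "compact W" unfolding W_def T_def by (intro compact_UN compact_frames) (simp add: K_def)
  have cell: "cell_point ix k U \<in> voronoi_cell (real k *\<^sub>R alpha (ix 1))" if "k \<in> K" "U \<in> T k" for k U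
    using cell_point_in_voronoi_cell[OF ix] that Tu by (simp add: K_def)
  have pagree: "p k U = p l U" if kl: "k \<in> K" "l \<in> K" and U: "U \<in> T k" "U \<in> T l" for k l U
  proof -
    have "p k U = p l U" if "k \<in> K" "l \<in> K" "U \<in> T k" "U \<in> T l" "k \<le> l" for k l
      using cell_points_agree[OF ix assms(1) inj, of k l U] that
      by (simp add: p_def torus_class_eq_iff K_def T_def)
    then show ?thesis using kl U by (metis nle_le)
  qed
  have pinj: "torus_orbit (isospectral \<mu> U) = torus_orbit (isospectral \<mu> V)"
    if kl: "k \<in> K" "l \<in> K" and UV: "U \<in> T k" "V \<in> T l" "p k U = p l V" for k l U V
  proof -
    have "torus_orbit (isospectral \<mu> U) = torus_orbit (isospectral \<mu> V)"
      if "k \<in> K" "l \<in> K" "U \<in> T k" "V \<in> T l" "p k U = p l V" "k \<le> l" for k l U V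
      using torus_orbit_eq_if_cell_points_congruent[OF ix inj, of k l U V] that
      by (simp add: p_def torus_class_eq_iff K_def T_def)
    then show ?thesis using kl UV by (metis nle_le)
  qed
  have qt: "quotient_map (top_of_set N_real) (torus_topology ix) (torus_class ix)"
    unfolding torus_topology_def by (rule quotient_map_quotient_topology)
  have pcont: "continuous_map (top_of_set (T k)) (torus_topology ix) (p k)" if "k \<in> K" for k
  proof -
    have "cell_point ix k ` T k \<subseteq> N_real" using cell[OF that] by (auto simp: voronoi_cell_def)
    then have "continuous_map (top_of_set (T k)) (top_of_set N_real) (cell_point ix k)"
      using continuous_on_cell_point[OF ix] by auto
    then have "continuous_map (top_of_set (T k)) (torus_topology ix) (torus_class ix \<circ> cell_point ix k)"
      using quotient_imp_continuous_map[OF qt] by (rule continuous_map_compose)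
    then show ?thesis by (simp add: p_def[abs_def] comp_def)
  qed
  \<comment> \<open>the maps \<open>p k\<close> agree on overlaps of the finitely many closed sets \<open>T k\<close>\<close>
  obtain g where g: "continuous_map (top_of_set W) (torus_topology ix) g"
      "\<And>U k. k \<in> K \<Longrightarrow> U \<in> T k \<Longrightarrow> g U = p k U"
  proof (rule pasting_lemma_exists_closed[of K "top_of_set W" T "torus_topology ix" p])
    show "finite K" by (simp add: K_def)
    show "topspace (top_of_set W) \<subseteq> \<Union> (T ` K)" by (simp add: W_def)
    fix k assume k: "k \<in> K"
    then have TW: "T k \<subseteq> W" by (auto simp: W_def)
    have "closed (T k)" unfolding T_def by (intro compact_imp_closed compact_frames)
    then show "closedin (top_of_set W) (T k)" using TW by (simp add: closed_subset)
    show "continuous_map (subtopology (top_of_set W) (T k)) (torus_topology ix) (p k)"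
      using pcont[OF k] TW by (simp add: subtopology_subtopology inf.absorb2)
  next
    fix k l U assume "k \<in> K" "l \<in> K" "U \<in> topspace (top_of_set W) \<inter> T k \<inter> T l"
    then show "p k U = p l U" using pagree by blast
  next
    fix g assume g: "continuous_map (top_of_set W) (torus_topology ix) g"
      "\<And>U k. k \<in> K \<Longrightarrow> U \<in> topspace (top_of_set W) \<inter> T k \<Longrightarrow> g U = p k U"
    show thesis
    proof (rule that[OF g(1)])
      fix U k assume "k \<in> K" "U \<in> T k"
      then show "g U = p k U" using g(2)[of k U] by (auto simp: W_def)
    qed
  qed
  \<comment> \<open>\<open>Q\<^sup>0\<close> is also a quotient of the compact space of frames, so maps out of it can be defined on frames\<close>
  define orb where "orb U = torus_orbit (isospectral \<mu> U)" for U
  have "quotient_map (top_of_set W) (top_of_set (X0_space ix lam)) (isospectral \<mu>)"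
    using cW by (intro continuous_imp_quotient_map)
      (auto simp: X0 continuous_on_isospectral Hausdorff_space_subtopology compact_space_subtopology)
  then have "quotient_map (top_of_set W) (Q0_topology ix lam) (torus_orbit \<circ> isospectral \<mu>)"
    unfolding Q0_topology_def using quotient_map_quotient_topology by (rule quotient_map_compose)
  then have qo: "quotient_map (top_of_set W) (Q0_topology ix lam) orb"
    by (simp add: orb_def[abs_def] comp_def)
  have "g U = g V" if UV: "U \<in> W" "V \<in> W" "orb U = orb V" for U V
  proof -
    obtain k where k: "k \<in> K" "U \<in> T k" using UV by (auto simp: W_def)
    have V: "unitary_matrix V" using UV Tu by (auto simp: W_def)
    then have VT: "V \<in> T k"
      using frames_if_torus_orbit_eq k UV(3) unfolding T_def orb_def by blast
    have "mean_rank r U i = mean_rank r V i" for r i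
      unfolding mean_rank_def
      using cmod_eq_if_torus_orbit_eq[OF Tu[OF k(2)] V inj] UV(3) by (simp add: orb_def)
    then have "p k U = p k V" by (simp add: p_def cell_point_def[OF ix])
    then show ?thesis using g(2) k VT by metis
  qed
  then obtain h where h: "continuous_map (Q0_topology ix lam) (torus_topology ix) h"
      "h ` topspace (Q0_topology ix lam) = g ` W" "\<And>U. U \<in> W \<Longrightarrow> h (orb U) = g U"
    using quotient_map_lift_exists[OF qo g(1)] by (metis topspace_euclidean_subtopology)
  have gT: "g ` T k = PT_cell ix k" if k: "k \<in> K" for k
  proof -
    have "cell_point ix k ` T k = voronoi_cell (real k *\<^sub>R alpha (ix 1))"
      using cell[OF k] voronoi_cell_filled[OF ix _ inj] k by (fastforce simp: K_def T_def)
    moreover have "g ` T k = torus_class ix ` cell_point ix k ` T k"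
      using g(2)[OF k] by (auto simp: p_def)
    ultimately show ?thesis by (simp add: PT_cell_def)
  qed
  have topQ: "topspace (Q0_topology ix lam) = orb ` W"
    using qo by (auto simp: quotient_map_def)
  have onto: "h ` topspace (Q0_topology ix lam) = topspace (torus_topology ix)"
  proof
    show "h ` topspace (Q0_topology ix lam) \<subseteq> topspace (torus_topology ix)"
      using continuous_map_image_subset_topspace[OF h(1)] .
    show "topspace (torus_topology ix) \<subseteq> h ` topspace (Q0_topology ix lam)"
    proof
      fix c assume "c \<in> topspace (torus_topology ix)"
      then obtain x where x: "x \<in> N_real" "c = torus_class ix x"
        by (auto simp: torus_topology_def topspace_quotient_topology)
      then obtain k where "k \<in> K" "c \<in> PT_cell ix k"
        using PT_cells_cover[OF ix x(1)] unfolding K_def by blast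
      then have "c \<in> g ` T k" using gT by simp
      then have "c \<in> g ` W" using \<open>k \<in> K\<close> unfolding W_def by blast
      then show "c \<in> h ` topspace (Q0_topology ix lam)" by (simp add: h(2))
    qed
  qed
  have "inj_on h (topspace (Q0_topology ix lam))"
    unfolding topQ
  proof (rule inj_onI, clarify)
    fix U V assume UV: "U \<in> W" "V \<in> W" "h (orb U) = h (orb V)"
    then obtain k l where "k \<in> K" "U \<in> T k" "l \<in> K" "V \<in> T l" by (auto simp: W_def)
    moreover have "g U = g V" using UV h(3) by simp
    ultimately show "orb U = orb V" unfolding orb_def using pinj g(2) by metis
  qed
  moreover have "compact_space (Q0_topology ix lam)"
    using image_compactin[of "top_of_set W" W "Q0_topology ix lam" orb]
      quotient_imp_continuous_map[OF qo] cW
    by (simp add: compact_space_def topQ compactin_subtopology)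
  ultimately have "homeomorphic_map (Q0_topology ix lam) (torus_topology ix) h"
    using h(1) onto by (intro continuous_imp_homeomorphic_map Hausdorff_torus[OF ix])
  moreover have "h ` Q_space ix lam k = PT_cell ix k" if k: "k \<in> K" for k
  proof -
    have "Q_space ix lam k = orb ` T k" by (simp add: Q_space_def Y[OF k] orb_def image_image)
    moreover have "h ` orb ` T k = g ` T k"
      unfolding image_image using h(3) k by (intro image_cong refl) (auto simp: W_def)
    ultimately show ?thesis using gT[OF k] by simp
  qed
  ultimately show ?thesis using PT_cell_maximal[OF ix] unfolding K_def by blast
qed

end
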